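(* For each positive integer $n$ let $X_n$ be the random variable `size' on the set of $(2n+1,2n+3)$-core partitions with distinct parts, equipped with the uniform distribution. Then the coefficient of variation (the quotient of the standard deviation by the mean) satisfies $$ \lim_{n\to\infty}\frac{\sqrt{\mathrm{Var}(X_n)}}{\mathbb{E}[X_n]}=\frac{\sqrt{14010}}{150}. $$ In particular this limit is not zero, so there is no concentration about the mean.
   Context: A partition is a non-increasing finite sequence $\lambda=(\lambda_1,\dots,\lambda_k)$, $k\ge 0$, of positive integers (the empty partition is allowed); its size is $\lambda_1+\dots+\lambda_k$, and it has distinct parts if the $\lambda_i$ are pairwise distinct. The hook length of a cell $(i,j)$, $1\le j\le\lambda_i$, of its Ferrers (Young) diagram is $\lambda_i-i+\lambda'_j-j+1$, where $\lambda'$ is the conjugate partition. A partition is an $(s,t)$-core partition if none of its hook lengths equals $s$ and none equals $t$. For $s=2n+1$, $t=2n+3$ (relatively prime) the set of $(s,t)$-core partitions is finite. "Concentration about the mean" means that the coefficient of variation tends to $0$ as $n\to\infty$. *)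

theory Defs
  imports "HOL-Probability.Probability"
begin

definition partitions :: "nat list set" where
  "partitions = {xs. sorted_wrt (\<ge>) xs \<and> (\<forall>x\<in>set xs. 0 < x)}"

definition size_of :: "nat list \<Rightarrow> nat" where
  "size_of xs = sum_list xs"

text \<open>Rows and columns of the diagram are numbered from 1, so the \<open>i\<close>-th part is \<open>xs ! (i - 1)\<close>.\<close>

definition part :: "nat list \<Rightarrow> nat \<Rightarrow> nat" where
  "part xs i = xs ! (i - 1)"

definition conj_part :: "nat list \<Rightarrow> nat \<Rightarrow> nat" where
  "conj_part xs j = card {i \<in> {1..length xs}. j \<le> part xs i}"

definition cells :: "nat list \<Rightarrow> (nat \<times> nat) set" where
  "cells xs = {(i, j). 1 \<le> i \<and> i \<le> length xs \<and> 1 \<le> j \<and> j \<le> part xs i}"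

text \<open>Integer-valued because \<open>part xs i - i\<close> may be negative.\<close>

definition hook_length :: "nat list \<Rightarrow> nat \<times> nat \<Rightarrow> int" where
  "hook_length xs = (\<lambda>(i, j).
     int (part xs i) - int i + int (conj_part xs j) - int j + 1)"

definition core_partition :: "nat \<Rightarrow> nat \<Rightarrow> nat list \<Rightarrow> bool" where
  "core_partition s t xs \<longleftrightarrow> xs \<in> partitions \<and>
     (\<forall>c \<in> cells xs. hook_length xs c \<noteq> int s \<and> hook_length xs c \<noteq> int t)"

definition distinct_cores :: "nat \<Rightarrow> nat \<Rightarrow> nat list set" where
  "distinct_cores s t = {xs. core_partition s t xs \<and> distinct xs}"

definition coeff_of_variation :: "'a pmf \<Rightarrow> ('a \<Rightarrow> real) \<Rightarrow> real" where
  "coeff_of_variation p X =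
     sqrt (measure_pmf.variance p X) / measure_pmf.expectation p X"

definition concentrated_about_mean ::
    "(nat \<Rightarrow> 'a pmf) \<Rightarrow> (nat \<Rightarrow> 'a \<Rightarrow> real) \<Rightarrow> bool" where
  "concentrated_about_mean p X \<longleftrightarrow>
     (\<lambda>n. coeff_of_variation (p n) (X n)) \<longlonglongrightarrow> 0"

end

theory Submission
  imports Defs
begin

text \<open>
  Write \<open>s = 2 n + 1\<close>. A partition is determined by its beta set, the set of its first-column hook
  lengths. The hook lengths in the row of \<open>b\<close> are the numbers \<open>b - x\<close> with \<open>x < b\<close> outside the beta
  set, so \<open>r\<close> is not a hook length iff the beta set is closed under subtracting \<open>r\<close>
  (\<open>hooks_avoid_iff\<close>); and the parts are distinct iff the beta set has no two consecutive elements.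
  Sort the beta set of a core by residues modulo \<open>s\<close>: it becomes a family of columns \<open>c r\<close>, and
  closure under \<open>s + 2\<close> says that along \<open>2, 4, \<dots>, 2 n, 1, 3, \<dots>, 2 n - 1\<close> the height rises by at
  most one per step, by at most two where the list passes from \<open>2 n\<close> to \<open>1\<close>. Distinctness says that
  of two neighbouring residues one has an empty column. Hence the columns \<open>2 k - 1\<close> and \<open>2 k\<close> can be
  stored as one integer whose sign tells which of them is occupied, and replacing each jump by unit
  steps turns the sequence of these integers into a walk with \<open>2 n + 1\<close> steps \<open>\<plusminus>1\<close>
  (\<open>heights_bij\<close>, \<open>towers_bij\<close>). All \<open>4 ^ n\<close> walks with positive displacement occur, each once, when
  the starting point is chosen so that the end point is its mirror image.

  The size of a core is half of \<open>s * (sum of the squared heights) - (sum of the heights)\<^sup>2\<close> up to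
  lower order, and the sums over the columns are half the corresponding sums over all times of the
  walk, again up to lower order (\<open>size_approx\<close>). What is left is to find the first two moments of
  a quadratic expression in \<open>height_sum\<close> and \<open>height_square_sum\<close> for a uniformly random walk.

  These come from a generating function. Give a visit at level \<open>m\<close> an arbitrary weight \<open>\<omega> m\<close> and let
  \<open>F m\<close> count the first passages from level \<open>m\<close> to the level below. Then
  \<open>F m = X * \<omega> m * (1 + F m * F (m + 1))\<close>, and the walks from a point above the
  mirror to its mirror image are counted by \<open>X * F 0' / (1 - (F 0)\<^sup>2)\<close> (\<open>closed_walks_fps\<close>). For the weights
  \<open>exp (\<theta> * (m + 1) + c * \<theta>\<^sup>2 * (m + 1)\<^sup>2)\<close> the coefficients of \<open>\<theta>\<^sup>k\<close> satisfy linear recurrences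
  in \<open>m\<close> with polynomial solutions. In the end the moments of order two and four are the coefficients
  of explicit polynomials in \<open>W = (1 + 1 / sqrt (1 - 4 X\<^sup>2)) / 2\<close>, whose growth is governed by their
  leading terms. This gives mean \<open>5/16 n\<^sup>3\<close> and second moment \<open>1217/7680 n\<^sup>6\<close> to leading order, and
  \<open>1217/7680 / (5/16)\<^sup>2 - 1 = 467/750 = 14010 / 150\<^sup>2\<close>.
\<close>

unbundle no vec_syntax
unbundle fps_syntax

section \<open>Weighted walks on the integers and first passages\<close>

text \<open>The integers are folded at the point \<open>1/2\<close>: \<open>i\<close> and its mirror image \<open>1 - i\<close> have the same level,
  and the walk crosses the mirror on the edge between \<open>0\<close> and \<open>1\<close>.\<close>

definition level :: "int \<Rightarrow> nat" where
  "level i = nat (if i \<ge> 1 then i - 1 else - i)"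

fun step :: "bool \<Rightarrow> int" where "step b = (if b then 1 else -1)"

definition disp :: "bool list \<Rightarrow> int" where
  "disp w = (\<Sum>b\<leftarrow>w. step b)"

lemma disp_simps [simp]: "disp [] = 0" "disp (b # w) = step b + disp w" "disp (v @ w) = disp v + disp w"
  by (simp_all add: disp_def)

definition walks :: "nat \<Rightarrow> bool list set" where
  "walks n = {w. length w = n}"

lemma finite_walks [simp]: "finite (walks n)"
  unfolding walks_def using finite_lists_length_eq[of "UNIV :: bool set" n] by simp

lemma card_walks: "card (walks n) = 2 ^ n"
  unfolding walks_def using card_lists_length_eq[of "UNIV :: bool set" n] by simp

lemma sum_walks_0: "sum f (walks 0) = f []"
  by (simp add: walks_def)

lemma sum_walks_Suc:
  "sum f (walks (Suc n)) = (\<Sum>w\<in>walks n. f (True # w)) + (\<Sum>w\<in>walks n. f (False # w))"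
proof -
  have eq: "walks (Suc n) = Cons True ` walks n \<union> Cons False ` walks n"
    by (auto simp: walks_def length_Suc_conv image_iff)
  show ?thesis unfolding eq
    by (subst sum.union_disjoint) (auto simp: sum.reindex)
qed

fun walk_weight :: "(nat \<Rightarrow> 'a::idom) \<Rightarrow> int \<Rightarrow> bool list \<Rightarrow> 'a" where
  "walk_weight om i [] = 1"
| "walk_weight om i (b # w) = om (level i) * walk_weight om (i + step b) w"

fun kern :: "(nat \<Rightarrow> 'a::idom) \<Rightarrow> nat \<Rightarrow> int \<Rightarrow> int \<Rightarrow> 'a" where
  "kern om 0 i e = (if i = e then 1 else 0)"
| "kern om (Suc n) i e = om (level i) * (kern om n (i + 1) e + kern om n (i - 1) e)"

lemma kern_eq_sum:
  "kern om n i e = (\<Sum>w\<in>walks n. if i + disp w = e then walk_weight om i w else 0)"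
proof (induction n arbitrary: i)
  case 0
  show ?case by (simp add: sum_walks_0)
next
  case (Suc n)
  show ?case
    unfolding sum_walks_Suc kern.simps Suc.IH
    by (auto simp: distrib_left sum_distrib_left intro!: arg_cong2[where f = "(+)"] sum.cong)
qed

lemma kern_snoc:
  "kern om (Suc n) i e =
     kern om n i (e - 1) * om (level (e - 1)) + kern om n i (e + 1) * om (level (e + 1))"
proof (induction n arbitrary: i)
  case 0
  show ?case by (auto simp: algebra_simps)
next
  case (Suc n)
  have "kern om (Suc (Suc n)) i e = om (level i) * (kern om (Suc n) (i + 1) e
      + kern om (Suc n) (i - 1) e)"
    by (simp only: kern.simps)
  also have "\<dots> = kern om (Suc n) i (e - 1) * om (level (e - 1)) + kern om (Suc n) i (e
      + 1) * om (level (e + 1))"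
    unfolding Suc.IH by (simp add: algebra_simps)
  finally show ?case .
qed

text \<open>Reading a walk backwards exchanges the weighted and the unweighted end: the weight counts all
  visited points except the last one.\<close>

lemma kern_reverse: "kern om n i e * om (level e) = om (level i) * kern om n e i"
proof (induction n arbitrary: i e)
  case 0
  show ?case by auto
next
  case (Suc n)
  have "kern om (Suc n) i e * om (level e) =
     om (level i) * (kern om n (i + 1) e * om (level e) + kern om n (i - 1) e * om (level e))"
    by (simp add: algebra_simps)
  also have "\<dots> = om (level i) *
     (kern om n e (i - 1) * om (level (i - 1)) + kern om n e (i + 1) * om (level (i + 1)))"
    unfolding Suc.IH[of "i + 1" e] Suc.IH[of "i - 1" e] by (simp only: mult_ac add_ac)
  also have "\<dots> = om (level i) * kern om (Suc n) e i"
    by (simp only: kern_snoc)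
  finally show ?case .
qed

lemma level_reflect: "level (1 - i) = level i"
  by (auto simp: level_def)

lemma kern_reflect: "kern om n (1 - i) (1 - e) = kern om n i e"
proof (induction n arbitrary: i)
  case (Suc n)
  show ?case using Suc.IH[of "i - 1"] Suc.IH[of "i + 1"]
    by (simp add: level_reflect algebra_simps)
qed auto

lemma kern_eq_0: "int n < \<bar>i - e\<bar> \<Longrightarrow> kern om n i e = 0"
  by (induction n arbitrary: i) auto

text \<open>Coefficients of the series of first passages from level \<open>m\<close> to level \<open>m - 1\<close> (across the mirror
  if \<open>m = 0\<close>): a passage steps down at once, or it steps up, returns to level \<open>m\<close>, and starts again.\<close>

fun passage :: "(nat \<Rightarrow> 'a::idom) \<Rightarrow> nat \<Rightarrow> nat \<Rightarrow> 'a" where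
  "passage om 0 m = 0"
| "passage om (Suc n) m =
     om m * ((if n = 0 then 1 else 0) + (\<Sum>i\<le>n. passage om i m * passage om (n - i) (Suc m)))"

definition passage_fps :: "(nat \<Rightarrow> 'a::idom) \<Rightarrow> nat \<Rightarrow> 'a fps" where
  "passage_fps om m = Abs_fps (\<lambda>n. passage om n m)"

definition kern_fps :: "(nat \<Rightarrow> 'a::idom) \<Rightarrow> int \<Rightarrow> int \<Rightarrow> 'a fps" where
  "kern_fps om i e = Abs_fps (\<lambda>n. kern om n i e)"

lemma passage_fps_eq:
  "passage_fps om m =
     fps_X * fps_const (om m) * (1 + passage_fps om m * passage_fps om (Suc m))"
proof (rule fps_ext)
  fix n
  show "passage_fps om m $ n =
    (fps_X * fps_const (om m) * (1 + passage_fps om m * passage_fps om (Suc m))) $ n"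
    by (cases n) (auto simp: passage_fps_def mult.assoc fps_mult_nth[of "Abs_fps _"] atLeast0AtMost)
qed

lemma kern_fps_eq:
  "kern_fps om i e = (if i = e then 1 else 0) +
     fps_X * fps_const (om (level i)) * (kern_fps om (i + 1) e + kern_fps om (i - 1) e)"
proof (rule fps_ext)
  fix n
  show "kern_fps om i e $ n = ((if i = e then 1 else 0) +
     fps_X * fps_const (om (level i)) * (kern_fps om (i + 1) e + kern_fps om (i - 1) e)) $ n"
    by (cases n) (auto simp: kern_fps_def mult.assoc)
qed

text \<open>The factor \<open>X\<close> makes all the linear systems below contractions: a solution of the homogeneous
  system vanishes, coefficient by coefficient, by strong induction on the degree.\<close>

lemma fps_nth_X_mult_zero:
  assumes "\<And>k. k < n \<Longrightarrow> A $ k = 0"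
  shows "(fps_X * fps_const c * (A :: 'a::idom fps)) $ n = 0"
  using assms by (cases n) (auto simp: mult.assoc)

lemma fps_nth_mult_zero_right:
  assumes "\<And>k. k \<le> n \<Longrightarrow> A $ k = 0"
  shows "(B * (A :: 'a::idom fps)) $ n = 0"
  using assms by (auto simp: fps_mult_nth)

text \<open>A walk from \<open>i\<close> to a point below must pass \<open>i - 1\<close>. Formally, the defect of the claimed equation
  satisfies a homogeneous system with a factor \<open>X\<close>.\<close>

lemma first_passage:
  assumes "i \<ge> 1" "e < i"
  shows "kern_fps om i e = passage_fps om (level i) * kern_fps om (i - 1) e"
proof -
  define d where "d i = kern_fps om i e - passage_fps om (level i) * kern_fps om (i - 1) e" for i
  \<comment> \<open>the contributions of \<open>d (i + 1)\<close> and of \<open>d i\<close> arise by reducing walks from \<open>i + 1\<close> in two steps\<close>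
  have d_eq: "d i = fps_X * fps_const (om (level i)) * (d (i + 1) + passage_fps om (level (i
      + 1)) * d i)"
    if "i \<ge> 1" "e < i" for i
  proof -
    have lev: "level (i + 1) = Suc (level i)"
      using that by (simp add: level_def)
    have K: "kern_fps om i e =
        fps_X * fps_const (om (level i)) * (kern_fps om (i + 1) e + kern_fps om (i - 1) e)"
      using that by (subst kern_fps_eq) simp
    have F: "passage_fps om (level i) = fps_X * fps_const (om (level i)) *
        (1 + passage_fps om (level i) * passage_fps om (level (i + 1)))"
      unfolding lev by (rule passage_fps_eq)
    show ?thesis
      unfolding d_def using K F by (simp; algebra)
  qed
  have "d i $ n = 0" if "i \<ge> 1" "e < i" for i n
    using that
  proof (induction n arbitrary: i rule: less_induct)
    case (less n)
    have "(d (i + 1) + passage_fps om (level (i + 1)) * d i) $ k = 0" if "k < n" for k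
    proof -
      have "(passage_fps om (level (i + 1)) * d i) $ k = 0"
        using less that by (intro fps_nth_mult_zero_right) auto
      thus ?thesis using less.IH[of k "i + 1"] less.prems that by simp
    qed
    thus ?case
      using d_eq[OF less.prems] fps_nth_X_mult_zero by metis
  qed
  hence "d i = 0" using assms by (intro fps_ext) auto
  thus ?thesis by (simp add: d_def)
qed

text \<open>Walks from a point above the mirror to the image of that point. The bound on the sum loses nothing:
  crossing from level \<open>m\<close> to its image takes \<open>2 m + 1\<close> steps.\<close>

definition closed_walks :: "(nat \<Rightarrow> 'a::idom) \<Rightarrow> 'a fps" where
  "closed_walks om = Abs_fps (\<lambda>n. \<Sum>m\<le>n. kern om n (int m + 1) (- int m))"

context
  fixes om :: "nat \<Rightarrow> 'a::idom"
  assumes nz: "om m \<noteq> 0"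
begin

private abbreviation "F \<equiv> passage_fps om"
private abbreviation "Xom m \<equiv> fps_X * fps_const (om m)"

lemma Xom_nz: "Xom m \<noteq> 0"
  using nz by simp

lemma kern_fps_prod_to_0:
  "kern_fps om (int m + 1) (- int j) = (\<Prod>k\<le>m. F k) * kern_fps om 0 (- int j)"
proof (induction m)
  case 0
  show ?case by (subst first_passage) (auto simp: level_def)
next
  case (Suc m)
  have "kern_fps om (int (Suc m) + 1) (- int j) = F (Suc m) * kern_fps om (int m + 1) (- int j)"
    by (subst first_passage) (auto simp: level_def nat_add_distrib add.commute)
  thus ?case by (simp add: Suc.IH mult_ac)
qed

lemma kern_fps_prod_to_1:
  "kern_fps om (int m + 1) 1 * F 0 = (\<Prod>k\<le>m. F k) * kern_fps om 1 1"
proof (induction m)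
  case 0
  show ?case by (simp add: mult_ac)
next
  case (Suc m)
  have "kern_fps om (int (Suc m) + 1) 1 = F (Suc m) * kern_fps om (int m + 1) 1"
    by (subst first_passage) (auto simp: level_def nat_add_distrib add.commute)
  hence "kern_fps om (int (Suc m) + 1) 1 * F 0 = F (Suc m) * (kern_fps om (int m + 1) 1 * F 0)"
    by (simp add: mult_ac)
  thus ?case unfolding Suc.IH prod.atMost_Suc by (simp only: mult_ac)
qed

lemma kern_fps_reflect: "kern_fps om (1 - i) (1 - e) = kern_fps om i e"
  by (simp add: kern_fps_def kern_reflect)

lemma kern_fps_reverse:
  "kern_fps om i e * fps_const (om (level e)) = fps_const (om (level i)) * kern_fps om e i"
  by (rule fps_ext) (simp add: kern_fps_def kern_reverse)

text \<open>From level \<open>0\<close> above the mirror a walk can go up and come back, or cross the mirror, which by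
  reflection is the same situation again.\<close>

lemma kern_fps_1_1: "Xom 0 * (1 - (F 0)\<^sup>2) * kern_fps om 1 1 = F 0"
proof -
  have 1: "kern_fps om 1 1 = 1 + Xom 0 * (kern_fps om 2 1 + kern_fps om 0 1)"
    by (subst kern_fps_eq) (simp add: level_def)
  have 2: "kern_fps om 2 1 = F 1 * kern_fps om 1 1"
    by (subst first_passage) (auto simp: level_def)
  have 3: "kern_fps om 0 1 = F 0 * kern_fps om 1 1"
  proof -
    have "kern_fps om 0 1 = kern_fps om 1 0" using kern_fps_reflect[of 1 0] by simp
    also have "\<dots> = F 0 * kern_fps om 0 0"
      by (subst first_passage) (auto simp: level_def)
    also have "kern_fps om 0 0 = kern_fps om 1 1" using kern_fps_reflect[of 1 1] by simp
    finally show ?thesis .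
  qed
  have 4: "F 0 = Xom 0 * (1 + F 0 * F 1)"
    using passage_fps_eq[of om 0] by simp
  show ?thesis using 1 2 3 4 by algebra
qed

text \<open>A walk from level \<open>m\<close> to its image descends to the mirror, moves between the two sides, and then
  climbs on the other side. By reversal the climb is counted by the same product of first passages
  as the descent, except for the passage across the mirror.\<close>

lemma kern_fps_closed:
  "Xom m * ((1 - (F 0)\<^sup>2) * kern_fps om (int m + 1) (- int m)) = (\<Prod>k\<le>m. F k)\<^sup>2"
proof -
  define P where "P = (\<Prod>k\<le>m. F k)"
  have 1: "kern_fps om (int m + 1) (- int m) = P * kern_fps om 1 (int m + 1)"
    using kern_fps_prod_to_0[of m m] kern_fps_reflect[of 1 "int m + 1"] by (simp add: P_def)
  have 2: "kern_fps om 1 (int m + 1) * fps_const (om m) = fps_const (om 0) * kern_fps om (int m + 1) 1"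
    using kern_fps_reverse[of 1 "int m + 1"] by (simp add: level_def)
  have 3: "kern_fps om (int m + 1) 1 * F 0 = P * kern_fps om 1 1"
    by (simp add: kern_fps_prod_to_1 P_def)
  have nzF: "F 0 \<noteq> 0"
  proof
    assume "F 0 = 0"
    hence "F 0 $ 1 = 0" by simp
    thus False using nz[of 0] by (simp add: passage_fps_def)
  qed
  have "F 0 * (Xom m * ((1 - (F 0)\<^sup>2) * kern_fps om (int m + 1) (- int m))) = F 0 * P\<^sup>2"
    using 1 2 3 kern_fps_1_1 by algebra
  thus ?thesis using nzF by (simp add: P_def)
qed

text \<open>The derivation \<open>X d/dX\<close> applied to the functional equation of the first passages. It marks one of the
  visited points; the right-hand side separates the marks at level \<open>m\<close> from the marks higher up.\<close>

lemma deriv_passage_fps: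
  "Xom m * (fps_X * fps_deriv (F m)) =
     (F m)\<^sup>2 * (1 + Xom m * (fps_X * fps_deriv (F (Suc m))))"
proof -
  have eq: "F m = Xom m * (1 + F m * F (Suc m))" by (rule passage_fps_eq)
  have "fps_deriv (F m) = fps_const (om m) * (1 + F m * F (Suc m)) +
     Xom m * (fps_deriv (F m) * F (Suc m) + F m * fps_deriv (F (Suc m)))"
    by (subst eq) (simp add: algebra_simps)
  hence "fps_X * fps_deriv (F m) = F m +
     Xom m * (fps_X * fps_deriv (F m) * F (Suc m) + F m * (fps_X * fps_deriv (F (Suc m))))"
    using eq by algebra
  thus ?thesis using eq by algebra
qed

text \<open>Iterating the marking equation from level \<open>0\<close> upwards produces, level by level, exactly the walks of
  \<open>kern_fps_closed\<close>; this is where the sum over all starting points gets a closed form.\<close>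

lemma deriv_passage_telescope:
  "fps_X * fps_deriv (F 0) =
     (1 - (F 0)\<^sup>2) * (\<Sum>m<M. kern_fps om (int m + 1) (- int m))
      + (\<Prod>k<M. F k)\<^sup>2 * (fps_X * fps_deriv (F M))"
proof (induction M)
  case (Suc M)
  define s where "s = (1 - (F 0)\<^sup>2) * kern_fps om (int M + 1) (- int M)"
  define P where "P = (\<Prod>k<M. F k)"
  have "Xom M * s = (P * F M)\<^sup>2"
    using kern_fps_closed[of M] by (simp add: s_def P_def lessThan_Suc_atMost[symmetric])
  hence "Xom M * (P\<^sup>2 * (fps_X * fps_deriv (F M))) =
         Xom M * (s + (P * F M)\<^sup>2 * (fps_X * fps_deriv (F (Suc M))))"
    using deriv_passage_fps[of M] by algebra
  hence "P\<^sup>2 * (fps_X * fps_deriv (F M)) = s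
      + (P * F M)\<^sup>2 * (fps_X * fps_deriv (F (Suc M)))"
    using Xom_nz[of M] by (metis mult_left_cancel)
  thus ?case using Suc.IH
    by (simp add: s_def P_def distrib_left)
qed simp

lemma nth_prod_passage_0: "n < M \<Longrightarrow> (\<Prod>k<M. F k) $ n = 0"
proof (induction M arbitrary: n)
  case (Suc M)
  have "(\<Prod>k<M. F k) $ i * F M $ (n - i) = 0" if "i \<le> n" for i
  proof (cases "i < M")
    case True thus ?thesis using Suc.IH by simp
  next
    case False hence "n - i = 0" using that Suc.prems by simp
    thus ?thesis by (simp add: passage_fps_def)
  qed
  thus ?case unfolding prod.lessThan_Suc fps_mult_nth by (intro sum.neutral) auto
qed simp

text \<open>A closed walk that alternates between the two sides of the mirror is a cyclic sequence of an odd
  number of arches, each counted by \<open>F 0\<close>, with a marked point; so its series is \<open>X d/dX\<close> of the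
  area hyperbolic tangent of \<open>F 0\<close>.\<close>

lemma closed_walks_fps:
  "(1 - (F 0)\<^sup>2) * closed_walks om = fps_X * fps_deriv (F 0)"
proof (rule fps_ext)
  fix n
  define S where "S = (\<Sum>m<Suc n. kern_fps om (int m + 1) (- int m))"
  have S: "closed_walks om $ k = S $ k" if "k \<le> n" for k
  proof -
    have "(\<Sum>m<Suc n. kern om k (int m + 1) (- int m)) = (\<Sum>m\<le>k. kern om k (int m
        + 1) (- int m))"
      using that by (intro sum.mono_neutral_right) (auto intro: kern_eq_0)
    thus ?thesis by (simp add: closed_walks_def S_def fps_sum_nth kern_fps_def)
  qed
  have "((1 - (F 0)\<^sup>2) * closed_walks om) $ n = ((1 - (F 0)\<^sup>2) * S) $ n"
    unfolding fps_mult_nth by (intro sum.cong) (auto simp: S)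
  also have "((\<Prod>k<Suc n. F k)\<^sup>2 * (fps_X * fps_deriv (F (Suc n)))) $ n = 0"
  proof -
    have "((\<Prod>k<Suc n. F k) * (fps_X * fps_deriv (F (Suc n))) * (\<Prod>k<Suc n. F k)) $ n = 0"
      by (rule fps_nth_mult_zero_right, rule nth_prod_passage_0) simp
    thus ?thesis by (simp add: power2_eq_square mult_ac)
  qed
  hence "((1 - (F 0)\<^sup>2) * S) $ n = (fps_X * fps_deriv (F 0)) $ n"
    using deriv_passage_telescope[of "Suc n"] by (simp add: S_def)
  finally show "((1 - (F 0)\<^sup>2) * closed_walks om) $ n = (fps_X * fps_deriv (F 0)) $ n" .
qed

end

section \<open>Polynomial solutions of the moment equations\<close>

text \<open>Up to the factor \<open>arch\<close>, the polynomial \<open>passage_polyk c M W\<close> is \<open>k!\<close> times the coefficient of \<open>\<theta>\<^sup>k\<close> in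
  the series of first passages from level \<open>M\<close>, for the weight \<open>exp (\<theta> v + c \<theta>\<^sup>2 v\<^sup>2)\<close> at \<open>v = M + 1\<close>.
  They are found degree by degree: the coefficient of \<open>\<theta>\<^sup>k\<close> enters its own equation only through
  \<open>W g(M) - (W - 1) g(M + 1)\<close>, which keeps the leading coefficient in \<open>M\<close>, so the equation can be
  solved by comparing powers of \<open>M\<close> from the top, without leaving the polynomials in \<open>W\<close>.\<close>

definition passage_poly1 :: "'a::idom \<Rightarrow> 'a \<Rightarrow> 'a \<Rightarrow> 'a" where
 "passage_poly1 c M W =
   2 * M * W - M + 2 * W^2 - W"

definition passage_poly2 :: "'a::idom \<Rightarrow> 'a \<Rightarrow> 'a \<Rightarrow> 'a" where
 "passage_poly2 c M W =
   8 * M^2 * W^3 - 8 * M^2 * W^2 + M^2 + 32 * M * W^4 - 48 * M * W^3 + 20 * M * W^2 - 2 * M * W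
   + 40 * W^5 - 80 * W^4 + 54 * W^3 - 14 * W^2 + W + 4 * c * M^2 * W - 2 * c * M^2 + 8 * c * M * W^2
   - 4 * c * M * W + 8 * c * W^3 - 8 * c * W^2 + 2 * c * W"

definition passage_poly3 :: "'a::idom \<Rightarrow> 'a \<Rightarrow> 'a \<Rightarrow> 'a" where
 "passage_poly3 c M W =
   96 * M^3 * W^5 - 192 * M^3 * W^4 + 120 * M^3 * W^3 - 24 * M^3 * W^2 + 2 * M^3 * W - M^3
   + 768 * M^2 * W^6 - 1920 * M^2 * W^5 + 1728 * M^2 * W^4 - 672 * M^2 * W^3 + 102 * M^2 * W^2
   - 3 * M^2 * W + 2400 * M * W^7 - 7200 * M * W^6 + 8304 * M * W^5 - 4608 * M * W^4 + 1242 * M * W^3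
   - 138 * M * W^2 + 3 * M * W + 2880 * W^8 - 10080 * W^7 + 14112 * W^6 - 10080 * W^5 + 3864 * W^4
   - 756 * W^3 + 62 * W^2 - W + 48 * c * M^3 * W^3 - 48 * c * M^3 * W^2 + 6 * c * M^3 + 288 * c * M^2 *
       W^4
   - 432 * c * M^2 * W^3 + 180 * c * M^2 * W^2 - 18 * c * M^2 * W + 768 * c * M * W^5 - 1536 * c * M *
       W^4
   + 1032 * c * M * W^3 - 264 * c * M * W^2 + 18 * c * M * W + 864 * c * W^6 - 2160 * c * W^5
   + 1968 * c * W^4 - 792 * c * W^3 + 132 * c * W^2 - 6 * c * W"

definition passage_poly4 :: "'a::idom \<Rightarrow> 'a \<Rightarrow> 'a \<Rightarrow> 'a" where
 "passage_poly4 c M W =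
   1920 * M^4 * W^7 - 5760 * M^4 * W^6 + 6528 * M^4 * W^5 - 3456 * M^4 * W^4 + 848 * M^4 * W^3
   - 80 * M^4 * W^2 + M^4 + 24576 * M^3 * W^8 - 86016 * M^3 * W^7 + 119808 * M^3 * W^6 - 84480 * M^3 *
       W^5
   + 31552 * M^3 * W^4 - 5856 * M^3 * W^3 + 424 * M^3 * W^2 - 4 * M^3 * W + 134400 * M^2 * W^9
   - 537600 * M^2 * W^8 + 884160 * M^2 * W^7 - 770880 * M^2 * W^6 + 382032 * M^2 * W^5 - 106464 * M^2 *
       W^4
   + 15204 * M^2 * W^3 - 852 * M^2 * W^2 + 6 * M^2 * W + 368640 * M * W^10 - 1658880 * M * W^9
   + 3140352 * M * W^8 - 3249792 * M * W^7 + 1997184 * M * W^6 - 739200 * M * W^5 + 158560 * M * W^4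
   - 17616 * M * W^3 + 760 * M * W^2 - 4 * M * W + 424320 * W^11 - 2121600 * W^10 + 4540224 * W^9
   - 5431296 * W^8 + 3977208 * W^7 - 1832808 * W^6 + 524848 * W^5 - 88328 * W^4 + 7686 * W^3
   - 254 * W^2 + W + 1152 * c * M^4 * W^5 - 2304 * c * M^4 * W^4 + 1440 * c * M^4 * W^3 - 288 * c * M^4
       * W^2
   + 24 * c * M^4 * W - 12 * c * M^4 + 12288 * c * M^3 * W^6 - 30720 * c * M^3 * W^5 + 27648 * c * M^3 *
       W^4
   - 10752 * c * M^3 * W^3 + 1632 * c * M^3 * W^2 - 48 * c * M^3 * W + 59520 * c * M^2 * W^7
   - 178560 * c * M^2 * W^6 + 205824 * c * M^2 * W^5 - 114048 * c * M^2 * W^4 + 30648 * c * M^2 * W^3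
   - 3384 * c * M^2 * W^2 + 72 * c * M^2 * W + 152064 * c * M * W^8 - 532224 * c * M * W^7
   + 744576 * c * M * W^6 - 530880 * c * M * W^5 + 202752 * c * M * W^4 - 39360 * c * M * W^3
   + 3168 * c * M * W^2 - 48 * c * M * W + 169728 * c * W^9 - 678912 * c * W^8 + 1115904 * c * W^7
   - 971520 * c * W^6 + 480432 * c * W^5 - 133728 * c * W^4 + 19224 * c * W^3 - 1128 * c * W^2
   + 12 * c * W + 96 * c^2 * M^4 * W^3 - 96 * c^2 * M^4 * W^2 + 12 * c^2 * M^4 + 768 * c^2 * M^3 * W^4
   - 1152 * c^2 * M^3 * W^3 + 480 * c^2 * M^3 * W^2 - 48 * c^2 * M^3 * W + 3072 * c^2 * M^2 * W^5
   - 6144 * c^2 * M^2 * W^4 + 4128 * c^2 * M^2 * W^3 - 1056 * c^2 * M^2 * W^2 + 72 * c^2 * M^2 * W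
   + 6912 * c^2 * M * W^6 - 17280 * c^2 * M * W^5 + 15744 * c^2 * M * W^4 - 6336 * c^2 * M * W^3
   + 1056 * c^2 * M * W^2 - 48 * c^2 * M * W + 7296 * c^2 * W^7 - 21888 * c^2 * W^6 + 25152 * c^2 * W^5
   - 13824 * c^2 * W^4 + 3672 * c^2 * W^3 - 408 * c^2 * W^2 + 12 * c^2 * W"

text \<open>In the same normalisation, \<open>closed_polyk c W\<close> belongs to the series of closed walks; here the
  factor split off is \<open>arch * W\<close>.\<close>

definition closed_poly1 :: "'a::idom \<Rightarrow> 'a \<Rightarrow> 'a" where
 "closed_poly1 c W =
   24 * W^4 - 40 * W^3 + 20 * W^2 - 3 * W"

definition closed_poly2 :: "'a::idom \<Rightarrow> 'a \<Rightarrow> 'a" where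
 "closed_poly2 c W =
   1152 * W^7 - 3552 * W^6 + 4240 * W^5 - 2464 * W^4 + 712 * W^3 - 90 * W^2 + 3 * W + 128 * c * W^5
   - 272 * c * W^4 + 200 * c * W^3 - 60 * c * W^2 + 6 * c * W"

definition closed_poly3 :: "'a::idom \<Rightarrow> 'a \<Rightarrow> 'a" where
 "closed_poly3 c W =
   123264 * W^10 - 561024 * W^9 + 1076448 * W^8 - 1132416 * W^7 + 710568 * W^6 - 270384 * W^5
   + 60342 * W^4 - 7144 * W^3 + 350 * W^2 - 3 * W + 26880 * c * W^8 - 96000 * c * W^7 + 137760 * c * W^6
   - 101568 * c * W^5 + 40656 * c * W^4 - 8484 * c * W^3 + 780 * c * W^2 - 18 * c * W"

definition closed_poly4 :: "'a::idom \<Rightarrow> 'a \<Rightarrow> 'a" where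
 "closed_poly4 c W =
   23445504 * W^13 - 141548544 * W^12 + 375948288 * W^11 - 577714176 * W^10 + 568114176 * W^9
   - 373178880 * W^8 + 165752256 * W^7 - 49220448 * W^6 + 9415984 * W^5 - 1076020 * W^4 + 63208 * W^3
   - 1350 * W^2 + 3 * W + 7557120 * c * W^11 - 38149632 * c * W^10 + 82556928 * c * W^9 - 100081536 * c
       * W^8
   + 74487552 * c * W^7 - 35035872 * c * W^6 + 10306080 * c * W^5 - 1800504 * c * W^4 + 165960 * c * W^3
   - 6120 * c * W^2 + 36 * c * W + 245760 * c^2 * W^9 - 998400 * c^2 * W^8 + 1672704 * c^2 * W^7
   - 1492224 * c^2 * W^6 + 762240 * c^2 * W^5 - 222048 * c^2 * W^4 + 34224 * c^2 * W^3 - 2280 * c^2 *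
       W^2
   + 36 * c^2 * W"

text \<open>The coefficients of \<open>\<theta>\<^sup>k\<close> in \<open>F M = X \<omega> (1 + F M * F (M + 1))\<close>, after multiplication by
  \<open>1 / sqrt (1 - 4 X\<^sup>2) = 2 W - 1\<close> and cancellation of \<open>arch\<close>. The factors \<open>(M + 1)\<^sup>j * \<dots>\<close> are the
  moments of the weight.\<close>

lemma passage_poly1_rec:
  "(2*W-1) * passage_poly1 c M W = (M+1)*(W+(W-1)) + (W-1)*(passage_poly1 c M W
      + passage_poly1 c (M+1) W)"
  unfolding passage_poly1_def by algebra

lemma passage_poly2_rec:
  "(2*W-1) * passage_poly2 c M W = (M+1)^2*(1+2*c)*(W+(W-1)) +
   (W-1)*(2*(M+1)*(passage_poly1 c M W + passage_poly1 c (M+1) W)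
    + (passage_poly2 c M W + 2*passage_poly1 c M W * passage_poly1 c (M+1) W
        + passage_poly2 c (M+1) W))"
  unfolding passage_poly1_def passage_poly2_def by algebra

lemma passage_poly3_rec:
  "(2*W-1) * passage_poly3 c M W = (M+1)^3*(1+6*c)*(W+(W-1)) +
   (W-1)*(3*((M+1)^2*(1+2*c))*(passage_poly1 c M W + passage_poly1 c (M+1) W)
    + 3*(M+1)*(passage_poly2 c M W + 2*passage_poly1 c M W * passage_poly1 c (M+1) W + passage_poly2 c
        (M+1) W)
    + (passage_poly3 c M W + 3*passage_poly2 c M W * passage_poly1 c (M+1) W
        + 3*passage_poly1 c M W * passage_poly2 c (M+1) W + passage_poly3 c (M+1) W))"
  unfolding passage_poly1_def passage_poly2_def passage_poly3_def by algebra

lemma passage_poly4_rec: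
  "(2*W-1) * passage_poly4 c M W = (M+1)^4*(1+12*c+12*c^2)*(W+(W-1)) +
   (W-1)*(4*((M+1)^3*(1+6*c))*(passage_poly1 c M W + passage_poly1 c (M+1) W)
    + 6*((M+1)^2*(1+2*c))*(passage_poly2 c M W + 2*passage_poly1 c M W * passage_poly1 c (M+1) W +
        passage_poly2 c (M+1) W)
    + 4*(M+1)*(passage_poly3 c M W + 3*passage_poly2 c M W * passage_poly1 c (M+1) W + 3*passage_poly1 c
        M W * passage_poly2 c (M+1) W + passage_poly3 c (M+1) W)
    + (passage_poly4 c M W + 4*passage_poly3 c M W * passage_poly1 c (M+1) W + 6*passage_poly2 c M
        W*passage_poly2 c (M+1) W + 4*passage_poly1 c M W * passage_poly3 c (M+1) W
       + passage_poly4 c (M+1) W))"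
  unfolding passage_poly1_def passage_poly2_def passage_poly3_def passage_poly4_def by algebra

lemmas zero_simps = mult_zero_left mult_zero_right power_zero_numeral diff_zero add_0_left add_0_right

definition passage_poly_deriv1 :: "'a::idom \<Rightarrow> 'a \<Rightarrow> 'a" where
 "passage_poly_deriv1 c W =
   4 * W - 1"

definition passage_poly_deriv2 :: "'a::idom \<Rightarrow> 'a \<Rightarrow> 'a" where
 "passage_poly_deriv2 c W =
   200 * W^4 - 320 * W^3 + 162 * W^2 - 28 * W + 1 + 24 * c * W^2 - 16 * c * W + 2 * c"

definition passage_poly_deriv3 :: "'a::idom \<Rightarrow> 'a \<Rightarrow> 'a" where
 "passage_poly_deriv3 c W =
   23040 * W^7 - 70560 * W^6 + 84672 * W^5 - 50400 * W^4 + 15456 * W^3 - 2268 * W^2 + 124 * W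
   - 1 + 5184 * c * W^5 - 10800 * c * W^4 + 7872 * c * W^3 - 2376 * c * W^2 + 264 * c * W - 6 * c"

definition passage_poly_deriv4 :: "'a::idom \<Rightarrow> 'a \<Rightarrow> 'a" where
 "passage_poly_deriv4 c W =
   4667520 * W^10 - 21216000 * W^9 + 40862016 * W^8 - 43450368 * W^7 + 27840456 * W^6 - 10996848 * W^5
   + 2624240 * W^4 - 353312 * W^3 + 23058 * W^2 - 508 * W + 1 + 1527552 * c * W^8 - 5431296 * c * W^7
   + 7811328 * c * W^6 - 5829120 * c * W^5 + 2402160 * c * W^4 - 534912 * c * W^3 + 57672 * c * W^2
   - 2256 * c * W + 12 * c + 51072 * c^2 * W^6 - 131328 * c^2 * W^5 + 125760 * c^2 * W^4 - 55296 * c^2 *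
       W^3
   + 11016 * c^2 * W^2 - 816 * c^2 * W + 12 * c^2"

text \<open>The coefficients of \<open>\<theta>\<^sup>k\<close> in \<open>(1 - (F 0)\<^sup>2) * G = X * (F 0)'\<close>, solved for the one of \<open>G\<close>. The factor
  \<open>2 W (W - 1)\<close> is the derivative of \<open>W\<close> under \<open>X d/dX\<close>, up to \<open>2 W - 1\<close>.\<close>

lemma closed_poly1_rec:
  "closed_poly1 c W = (2*W-1) * (passage_poly1 c 0 W + 2*W*(W-1) * passage_poly_deriv1 c W)
    + (W-1) * ((2 * passage_poly1 c 0 W) * (2*W-1))"
  unfolding passage_poly1_def closed_poly1_def passage_poly_deriv1_def zero_simps by algebra

lemma closed_poly2_rec:
  "closed_poly2 c W = (2*W-1) * (passage_poly2 c 0 W + 2*W*(W-1) * passage_poly_deriv2 c W)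
    + (W-1) * (2 * (2 * passage_poly1 c 0 W) * closed_poly1 c W + (2 * passage_poly2 c 0 W
        + 2 * passage_poly1 c 0 W^2) * (2*W-1))"
  unfolding passage_poly1_def closed_poly1_def passage_poly2_def closed_poly2_def
      passage_poly_deriv2_def zero_simps by algebra

lemma closed_poly3_rec:
  "closed_poly3 c W = (2*W-1) * (passage_poly3 c 0 W + 2*W*(W-1) * passage_poly_deriv3 c W)
    + (W-1) * (3 * (2 * passage_poly1 c 0 W) * closed_poly2 c W + 3 * (2 * passage_poly2 c 0 W
        + 2 * passage_poly1 c 0 W^2) * closed_poly1 c W + (2 * passage_poly3 c 0 W
        + 6 * passage_poly1 c 0 W * passage_poly2 c 0 W) * (2*W-1))"
  unfolding passage_poly1_def closed_poly1_def passage_poly2_def closed_poly2_def passage_poly3_def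
      closed_poly3_def passage_poly_deriv3_def zero_simps by algebra

lemma closed_poly4_rec:
  "closed_poly4 c W = (2*W-1) * (passage_poly4 c 0 W + 2*W*(W-1) * passage_poly_deriv4 c W)
    + (W-1) * (4 * (2 * passage_poly1 c 0 W) * closed_poly3 c W + 6 * (2 * passage_poly2 c 0 W
        + 2 * passage_poly1 c 0 W^2) * closed_poly2 c W + 4 * (2 * passage_poly3 c 0 W
        + 6 * passage_poly1 c 0 W * passage_poly2 c 0 W) * closed_poly1 c W + (2 * passage_poly4 c 0 W
        + 8 * passage_poly1 c 0 W * passage_poly3 c 0 W + 6 * passage_poly2 c 0 W^2) * (2*W-1))"
  unfolding passage_poly1_def closed_poly1_def passage_poly2_def closed_poly2_def passage_poly3_def
      closed_poly3_def passage_poly4_def closed_poly4_def passage_poly_deriv4_def zero_simps by algebra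

section \<open>Exponential weights and their moments\<close>

text \<open>The series \<open>exp (a \<theta> + b \<theta>\<^sup>2)\<close> in \<open>\<theta>\<close>. It is multiplicative in the pair \<open>(a, b)\<close>, so a product
  over the visited points remembers the two sums over these points.\<close>

definition exp_weight :: "real \<Rightarrow> real \<Rightarrow> real fps" where
  "exp_weight a b = fps_exp a * (fps_exp b oo fps_X ^ 2)"

lemma fps_compose_X2_nth:
  "((f :: 'a::idom fps) oo fps_X ^ 2) $ n = (if even n then f $ (n div 2) else 0)"
proof -
  have "(f oo fps_X ^ 2) $ n = (\<Sum>i = 0..n. f $ i * (if n = 2 * i then 1 else 0))"
    by (simp add: fps_compose_nth power_mult[symmetric] fps_X_power_nth)
  also have "\<dots> = (\<Sum>i = 0..n. if i = n div 2 \<and> even n then f $ i else 0)"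
    by (intro sum.cong) auto
  also have "\<dots> = (if even n then f $ (n div 2) else 0)"
    by (cases "even n") simp_all
  finally show ?thesis .
qed

lemma exp_weight_0: "exp_weight 0 0 = 1"
  by (simp add: exp_weight_def)

lemma exp_weight_add: "exp_weight (a + a') (b + b') = exp_weight a b * exp_weight a' b'"
  by (simp add: exp_weight_def fps_exp_add_mult fps_compose_mult_distrib mult_ac)

lemma exp_weight_nth:
  "exp_weight a b $ 0 = 1" "exp_weight a b $ 1 = a" "2 * exp_weight a b $ 2 = a^2 + 2 * b"
  "6 * exp_weight a b $ 3 = a^3 + 6 * a * b" "24 * exp_weight a b $ 4 = a^4 + 12 * a^2 * b + 12 * b^2"
proof -
  define G where "G = fps_exp b oo (fps_X ^ 2 :: real fps)"
  have G: "G $ 0 = 1" "G $ 1 = 0" "G $ 2 = b" "G $ 3 = 0" "G $ 4 = b\<^sup>2 / 2"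
    by (simp_all add: G_def fps_compose_X2_nth fact_numeral)
  have "exp_weight a b $ n = (\<Sum>i = 0..n. a ^ i / fact i * G $ (n - i))" for n
    by (simp add: exp_weight_def G_def fps_mult_nth)
  thus "exp_weight a b $ 0 = 1" "exp_weight a b $ 1 = a" "2 * exp_weight a b $ 2 = a^2 + 2 * b"
    "6 * exp_weight a b $ 3 = a^3 + 6 * a * b" "24 * exp_weight a b $ 4 = a^4 + 12 * a^2 * b + 12 * b^2"
    using G by (simp_all add: numeral_eq_Suc field_simps)
qed

text \<open>The coefficient of \<open>\<theta>\<^sup>k\<close>, scaled by \<open>k!\<close> so that products follow the binomial rule and all
  polynomials have integer coefficients.\<close>

definition slice :: "nat \<Rightarrow> real fps fps \<Rightarrow> real fps" where
  "slice k F = Abs_fps (\<lambda>n. fact k * (F $ n $ k))"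

lemma slice_nth: "slice k F $ n = fact k * (F $ n $ k)"
  by (simp add: slice_def)

lemma slice_add: "slice k (F + G) = slice k F + slice k G"
  by (rule fps_ext) (simp add: slice_nth distrib_left)

lemma slice_diff: "slice k (F - G) = slice k F - slice k G"
  by (rule fps_ext) (simp add: slice_nth right_diff_distrib)

lemma slice_X: "slice k (fps_X * F) = fps_X * slice k F"
  by (rule fps_ext) (simp add: slice_nth)

lemma slice_1: "slice k 1 = (if k = 0 then 1 else 0)"
  by (rule fps_ext) (simp add: slice_nth fps_one_nth)

lemma slice_const: "slice k (fps_const a) = fps_const (fact k * a $ k)"
  by (rule fps_ext) (simp add: slice_nth)

lemma slice_deriv: "slice k (fps_deriv F) = fps_deriv (slice k F)"
proof (rule fps_ext)
  fix n
  have "(of_nat (Suc n) :: real fps) = fps_const (of_nat (Suc n))"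
    by (simp only: fps_of_nat)
  thus "slice k (fps_deriv F) $ n = fps_deriv (slice k F) $ n"
    by (simp add: slice_nth del: of_nat_Suc)
qed

lemma slice_mult:
  "slice k (F * G) = (\<Sum>i\<le>k. of_nat (k choose i) * slice i F * slice (k - i) G)"
proof (rule fps_ext)
  fix n
  have "slice k (F * G) $ n = (\<Sum>i\<le>k. \<Sum>j\<le>n. fact k * (F $ j $ i * G $ (n - j) $ (k - i)))"
    by (subst sum.swap)
       (simp add: slice_nth fps_mult_nth fps_sum_nth sum_distrib_left atLeast0AtMost)
  also have "\<dots> = (\<Sum>i\<le>k. of_nat (k choose i) *
       (\<Sum>j\<le>n. (fact i * F $ j $ i) * (fact (k - i) * G $ (n - j) $ (k - i))))"
  proof (intro sum.cong refl)
    fix i assume "i \<in> {..k}"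
    hence "of_nat (fact i * fact (k - i) * (k choose i)) = (of_nat (fact k) :: real)"
      by (subst binomial_fact_lemma) auto
    hence "fact k = (of_nat (k choose i) * fact i * fact (k - i) :: real)"
      by (simp add: mult_ac)
    thus "(\<Sum>j\<le>n. fact k * (F $ j $ i * G $ (n - j) $ (k - i))) = of_nat (k choose i) *
       (\<Sum>j\<le>n. (fact i * F $ j $ i) * (fact (k - i) * G $ (n - j) $ (k - i)))"
      by (simp add: sum_distrib_left mult_ac)
  qed
  also have "\<dots> = (\<Sum>i\<le>k. of_nat (k choose i) * slice i F * slice (k - i) G) $ n"
    by (simp add: fps_sum_nth fps_of_nat[symmetric] mult.assoc)
       (simp add: fps_mult_nth slice_nth atLeast0AtMost mult_ac)
  finally show "slice k (F * G) $ n = \<dots>" .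
qed

text \<open>The substitution of \<open>- 4 X\<^sup>2\<close> for \<open>X\<close>.\<close>

definition rescale :: "real fps \<Rightarrow> real fps" where
  "rescale F = (F oo (fps_const (-4) * fps_X)) oo fps_X ^ 2"

lemma rescale_mult: "rescale (F * G) = rescale F * rescale G"
  by (simp add: rescale_def fps_compose_mult_distrib)

lemma rescale_1 [simp]: "rescale 1 = 1"
  by (simp add: rescale_def)

lemma rescale_power: "rescale (F ^ k) = rescale F ^ k"
  by (induction k) (simp_all add: rescale_mult)

lemma rescale_nth: "rescale F $ (2 * n) = (-4) ^ n * F $ n"
  unfolding rescale_def fps_compose_linear by (simp add: fps_compose_X2_nth)

text \<open>\<open>1 / sqrt (1 - 4 X\<^sup>2)\<close>, the series of the central binomial coefficients.\<close>

definition central :: "real fps" where "central = rescale (fps_binomial (-1/2))"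

text \<open>The quantity \<open>W\<close> of the polynomials above; also \<open>1 / (1 - arch\<^sup>2)\<close>.\<close>

definition pole :: "real fps" where "pole = fps_const (1/2) * (1 + central)"

text \<open>The Catalan series of first passages with trivial weight: \<open>arch = (1 - sqrt (1 - 4 X\<^sup>2)) / (2 X)\<close>.
  Both \<open>arch\<^sup>2\<close> and \<open>1 / (1 - arch\<^sup>2)\<close> are rational in \<open>pole\<close>.\<close>

definition arch :: "real fps" where "arch = fps_X * central * inverse pole"

lemma central_power_nth: "(central ^ k) $ (2 * n) = (-4) ^ n * ((- (real k / 2)) gchoose n)"
proof -
  have "central ^ k = rescale (fps_binomial (- (real k / 2)))"
    unfolding central_def rescale_power[symmetric] by (simp add: fps_binomial_power)
  thus ?thesis by (simp add: rescale_nth)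
qed

lemma central_square: "central\<^sup>2 * (1 - 4 * fps_X\<^sup>2) = 1"
proof -
  have "(1 + fps_X) * (fps_binomial (-1/2))\<^sup>2 = (1 :: real fps)"
    by (simp add: fps_binomial_power fps_binomial_minus_one inverse_mult_eq_1')
  hence "rescale (1 + fps_X) * central\<^sup>2 = 1"
    by (metis central_def rescale_1 rescale_mult rescale_power)
  moreover have "rescale (1 + fps_X) = 1 - 4 * fps_X\<^sup>2"
    by (simp add: rescale_def fps_compose_add_distrib fps_compose_mult_distrib numeral_fps_const)
  ultimately show ?thesis by (simp add: mult.commute)
qed

lemma central_nth_0: "central $ 0 = 1"
  using central_power_nth[of 1 0] by simp

lemma central_eq: "central = 2 * pole - 1"
proof -
  have "2 * pole = 2 * fps_const (1/2) * (1 + central)" by (simp add: pole_def)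
  also have "2 * fps_const (1/2) = (1 :: real fps)" by (simp add: numeral_fps_const)
  finally show ?thesis by simp
qed

lemma central_nz: "central \<noteq> 0" and pole_nz: "pole \<noteq> 0" and pole_nth_0: "pole $ 0 = 1"
proof -
  show "pole $ 0 = 1" by (simp add: pole_def central_nth_0)
  thus "pole \<noteq> 0" by auto
  show "central \<noteq> 0" using central_nth_0 by auto
qed

lemma arch_pole: "arch * pole = fps_X * central"
  using pole_nth_0 by (simp add: arch_def mult.assoc inverse_mult_eq_1)

lemma arch_square: "arch\<^sup>2 * pole = pole - 1"
proof -
  have "4 * (fps_X\<^sup>2 * central\<^sup>2) = central\<^sup>2 - 1" using central_square by algebra
  also have "\<dots> = 4 * (pole * (pole - 1))" unfolding central_eq by algebra
  finally have "fps_X\<^sup>2 * central\<^sup>2 = pole * (pole - 1)" by simp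
  hence "pole * (arch\<^sup>2 * pole) = pole * (pole - 1)"
    using arch_pole by algebra
  thus ?thesis using pole_nz by simp
qed

lemma arch_eq: "arch = fps_X * (1 + arch * arch)"
proof -
  have "pole * central * arch = pole * central * (fps_X * (1 + arch * arch))"
    using arch_pole arch_square central_eq by algebra
  thus ?thesis using pole_nz central_nz by simp
qed

definition moment_weight :: "real \<Rightarrow> nat \<Rightarrow> real fps" where
  "moment_weight c m = exp_weight (real m + 1) (c * (real m + 1)\<^sup>2)"

abbreviation passage_slice :: "real \<Rightarrow> nat \<Rightarrow> nat \<Rightarrow> real fps" where
  "passage_slice c k m \<equiv> slice k (passage_fps (moment_weight c) m)"

lemma moment_weight_nz: "moment_weight c m \<noteq> 0"
  using exp_weight_nth(1)[of "real m + 1" "c * (real m + 1)\<^sup>2"] by (auto simp: moment_weight_def)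

lemma slice_moment_weight:
  fixes c :: real and m :: nat
  defines "C \<equiv> fps_const c" and "M \<equiv> of_nat m"
  shows "slice 0 (fps_const (moment_weight c m)) = 1"
    "slice 1 (fps_const (moment_weight c m)) = M + 1"
    "slice 2 (fps_const (moment_weight c m)) = (M + 1)^2 * (1 + 2 * C)"
    "slice 3 (fps_const (moment_weight c m)) = (M + 1)^3 * (1 + 6 * C)"
    "slice 4 (fps_const (moment_weight c m)) = (M + 1)^4 * (1 + 12 * C + 12 * C^2)"
proof -
  have M1: "M + 1 = fps_const (real m + 1)"
    unfolding M_def fps_of_nat[symmetric] by (simp add: fps_const_add[symmetric] del: fps_const_add)
  have num: "numeral k * fps_const (x::real) = fps_const (numeral k * x)" for k x
    by (simp add: numeral_fps_const)
  have one: "1 + fps_const x = fps_const (1 + x)" for x :: real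
    by (simp add: fps_const_add[symmetric] del: fps_const_add)
  define x where "x = real m + 1"
  have om: "moment_weight c m = exp_weight x (c * x\<^sup>2)" by (simp add: moment_weight_def x_def)
  have facts: "fact 2 = (2::real)" "fact 3 = (6::real)" "fact 4 = (24::real)"
    by (simp_all add: fact_numeral)
  note e = exp_weight_nth[of x "c * x\<^sup>2"]
  show "slice 0 (fps_const (moment_weight c m)) = 1" using e(1) by (simp add: slice_const om)
  show "slice 1 (fps_const (moment_weight c m)) = M
      + 1" using e(2) by (simp add: slice_const om M1 x_def)
  have "fact 2 * moment_weight c m $ 2 = x ^ 2 * (1 + 2 * c)"
    unfolding om facts using e(3) by algebra
  thus "slice 2 (fps_const (moment_weight c m)) = (M + 1)^2 * (1 + 2 * C)"
    by (simp add: slice_const M1 C_def num one fps_const_power x_def)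
  have "fact 3 * moment_weight c m $ 3 = x ^ 3 * (1 + 6 * c)"
    unfolding om facts using e(4) by algebra
  thus "slice 3 (fps_const (moment_weight c m)) = (M + 1)^3 * (1 + 6 * C)"
    by (simp add: slice_const M1 C_def num one fps_const_power x_def)
  have "fact 4 * moment_weight c m $ 4 = x ^ 4 * (1 + 12 * c + 12 * c^2)"
    unfolding om facts using e(5) by algebra
  thus "slice 4 (fps_const (moment_weight c m)) = (M + 1)^4 * (1 + 12 * C + 12 * C^2)"
    by (simp add: slice_const M1 C_def num one fps_const_power x_def)
qed

abbreviation pair_slice :: "real \<Rightarrow> nat \<Rightarrow> nat \<Rightarrow> real fps" where
  "pair_slice c k m \<equiv> slice k (1
      + passage_fps (moment_weight c) m * passage_fps (moment_weight c) (Suc m))"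

lemma passage_slice_rec:
  "passage_slice c k m = fps_X * (\<Sum>i\<le>k. of_nat (k choose i) * slice i (fps_const (moment_weight c m)) * pair_slice c (k - i) m)"
proof -
  have "passage_slice c k m = fps_X * slice k (fps_const (moment_weight c m) *
     (1 + passage_fps (moment_weight c) m * passage_fps (moment_weight c) (Suc m)))"
    by (subst passage_fps_eq) (simp only: mult.assoc slice_X)
  thus ?thesis by (simp only: slice_mult[of k "fps_const (moment_weight c m)"])
qed

lemma sum_le_numeral:
  fixes h :: "nat \<Rightarrow> real fps"
  shows "(\<Sum>i\<le>1. h i) = h 0 + h 1" "(\<Sum>i\<le>2. h i) = h 0 + h 1 + h 2"
    "(\<Sum>i\<le>3. h i) = h 0 + h 1 + h 2 + h 3" "(\<Sum>i\<le>4. h i) = h 0 + h 1 + h 2 + h 3 + h 4"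
  by (simp_all add: numeral_eq_Suc)

lemma choose_numeral:
  "2 choose 1 = (2::nat)" "3 choose 1 = (3::nat)" "3 choose 2 = (3::nat)"
  "4 choose 1 = (4::nat)" "4 choose 2 = (6::nat)" "4 choose 3 = (4::nat)"
  by (simp_all add: numeral_eq_Suc)

lemma slice_mult_le_4:
  "slice 0 (F * G) = slice 0 F * slice 0 G"
  "slice 1 (F * G) = slice 0 F * slice 1 G + slice 1 F * slice 0 G"
  "slice 2 (F * G) = slice 0 F * slice 2 G + 2 * slice 1 F * slice 1 G + slice 2 F * slice 0 G"
  "slice 3 (F * G) = slice 0 F * slice 3 G + 3 * slice 1 F * slice 2 G + 3 * slice 2 F * slice 1 G
     + slice 3 F * slice 0 G"
  "slice 4 (F * G) = slice 0 F * slice 4 G + 4 * slice 1 F * slice 3 G + 6 * slice 2 F * slice 2 G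
     + 4 * slice 3 F * slice 1 G + slice 4 F * slice 0 G"
  by (simp_all only: slice_mult sum_le_numeral choose_numeral)
     simp_all

lemma contraction_zero:
  assumes "\<And>m. d m = fps_X * (A m * d m + B m * d (Suc m) :: real fps)"
  shows "d m = 0"
proof -
  have "d m $ n = 0" for m n
  proof (induction n arbitrary: m rule: less_induct)
    case (less n)
    show ?case
    proof (cases n)
      case 0
      thus ?thesis by (subst assms) simp
    next
      case (Suc k)
      have "(A m * d m) $ k = 0" "(B m * d (Suc m)) $ k = 0"
        using less.IH Suc by (auto intro!: fps_nth_mult_zero_right)
      thus ?thesis by (subst assms) (simp add: Suc)
    qed
  qed
  thus ?thesis by (intro fps_ext) simp
qed

lemma passage_slice_0: "passage_slice c 0 m = arch"
proof -
  have "passage_slice c 0 m - arch = fps_X * (passage_slice c 0 (Suc m) * (passage_slice c 0 m - arch)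
      + arch * (passage_slice c 0 (Suc m) - arch))" for m
  proof -
    have "passage_slice c 0 m = fps_X * (1 + passage_slice c 0 m * passage_slice c 0 (Suc m))"
      by (subst passage_slice_rec) (simp add: slice_moment_weight slice_add slice_1 slice_mult_le_4)
    thus ?thesis using arch_eq by algebra
  qed
  from contraction_zero[where d = "\<lambda>m. passage_slice c 0 m - arch" and A = "\<lambda>m. passage_slice c 0 (Suc m)" and B = "\<lambda>_. arch", OF this]
  have "passage_slice c 0 m - arch = 0" .
  thus ?thesis by simp
qed

text \<open>For every \<open>k > 0\<close> the slice of order \<open>k\<close> occurs in its own equation only in this linear form, with
  the lower slices as inhomogeneity.\<close>

lemma linear_unique:
  assumes "\<And>m. p m - fps_X * arch * (p m + p (Suc m)) = q m - fps_X * arch * (q m + q (Suc m))"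
  shows "p m = (q m :: real fps)"
proof -
  have "p m - q m = fps_X * (arch * (p m - q m) + arch * (p (Suc m) - q (Suc m)))" for m
    using assms[of m] by algebra
  from contraction_zero[where d = "\<lambda>m. p m - q m" and A = "\<lambda>_. arch" and B = "\<lambda>_. arch", OF this]
  have "p m - q m = 0" .
  thus ?thesis by simp
qed

text \<open>Translates a polynomial recurrence into an equation of power series.\<close>

lemma passage_poly_fps_eq:
  assumes "(2 * pole - 1) * g = a * (pole + (pole - 1)) + (pole - 1) * p"
  shows "arch * g = fps_X * (a * (1 + arch * arch) + arch * arch * p)"
proof -
  have "central * (fps_X * (a * (1 + arch * arch) + arch * arch * p)) = arch * pole * (a + (a
      + p) * arch\<^sup>2)"
    unfolding arch_pole by algebra
  also have "\<dots> = arch * (a * pole + (a + p) * (arch\<^sup>2 * pole))" by algebra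
  also have "\<dots> = arch * ((2 * pole - 1) * g)" unfolding arch_square assms by algebra
  also have "\<dots> = central * (arch * g)" unfolding central_eq by algebra
  finally show ?thesis using central_nz by simp
qed

lemma pair_slice_eqs:
  "pair_slice c 0 m = 1 + arch * arch"
  "pair_slice c 1 m = arch * passage_slice c 1 (Suc m) + passage_slice c 1 m * arch"
  "pair_slice c 2 m = arch * passage_slice c 2 (Suc m)
      + 2 * passage_slice c 1 m * passage_slice c 1 (Suc m) + passage_slice c 2 m * arch"
  "pair_slice c 3 m = arch * passage_slice c 3 (Suc m)
      + 3 * passage_slice c 1 m * passage_slice c 2 (Suc m)
      + 3 * passage_slice c 2 m * passage_slice c 1 (Suc m) + passage_slice c 3 m * arch"
  "pair_slice c 4 m = arch * passage_slice c 4 (Suc m)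
      + 4 * passage_slice c 1 m * passage_slice c 3 (Suc m)
      + 6 * passage_slice c 2 m * passage_slice c 2 (Suc m)
     + 4 * passage_slice c 3 m * passage_slice c 1 (Suc m) + passage_slice c 4 m * arch"
  by (simp_all add: slice_add slice_1 slice_mult_le_4 passage_slice_0 del: One_nat_def)

lemma passage_slice_recs:
  fixes m :: nat
  defines "C \<equiv> \<lambda>c. fps_const c" and "M \<equiv> of_nat m"
  shows
  "passage_slice c 1 m = fps_X * (pair_slice c 1 m + (M + 1) * pair_slice c 0 m)"
  "passage_slice c 2 m = fps_X * (pair_slice c 2 m + 2 * (M + 1) * pair_slice c 1 m + (M + 1)^2 * (1
      + 2 * C c) * pair_slice c 0 m)"
  "passage_slice c 3 m = fps_X * (pair_slice c 3 m + 3 * (M + 1) * pair_slice c 2 m + 3 * ((M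
      + 1)^2 * (1 + 2 * C c)) * pair_slice c 1 m
     + (M + 1)^3 * (1 + 6 * C c) * pair_slice c 0 m)"
  "passage_slice c 4 m = fps_X * (pair_slice c 4 m + 4 * (M + 1) * pair_slice c 3 m + 6 * ((M
      + 1)^2 * (1 + 2 * C c)) * pair_slice c 2 m
     + 4 * ((M + 1)^3 * (1 + 6 * C c)) * pair_slice c 1 m + (M + 1)^4 * (1 + 12 * C c
         + 12 * (C c)^2) * pair_slice c 0 m)"
  unfolding C_def M_def
  by (subst passage_slice_rec, simp only: sum_le_numeral slice_moment_weight choose_numeral, simp)+

lemma slice_step:
  assumes 1: "F = fps_X * (arch * F' + F * arch + r)"
    and 2: "arch * G = fps_X * (a * (1 + arch * arch) + arch * arch * (s + (G + G')))"
    and 3: "r = a * (1 + arch * arch) + arch * arch * s"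
  shows "F - fps_X * arch * (F + F') = arch * G - fps_X * arch * (arch * G + arch * G')"
proof -
  have "F - fps_X * arch * (F + F') = fps_X * (arch * F' + F * arch + r) - fps_X * arch * (F + F')"
    by (rule arg_cong[OF 1])
  also have "\<dots> = fps_X * (a * (1 + arch * arch) + arch * arch * (s + (G
      + G'))) - fps_X * arch * (arch * G + arch * G')"
    unfolding 3 by algebra
  also have "\<dots> = arch * G - fps_X * arch * (arch * G + arch * G')"
    by (simp only: 2)
  finally show ?thesis .
qed

lemma passage_slice_1: "passage_slice c 1 m = arch * passage_poly1 (fps_const c) (of_nat m) pole"
proof (rule linear_unique[where p = "passage_slice c 1" and q = "\<lambda>m. arch * passage_poly1 (fps_const c) (of_nat m) pole"])
  fix m
  let ?f = "passage_slice c"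
  define M where "M = (of_nat m :: real fps)"
  define C where "C = fps_const c"
  have S: "of_nat (Suc m) = M + 1" by (simp add: M_def)
  define r :: "real fps" where "r = 0 + (M+1) * (1 + arch * arch)"
  define s :: "real fps" where "s = 0"
  have "?f 1 m - fps_X * arch * (?f 1 m + ?f 1 (Suc m)) =
    arch * passage_poly1 C M pole - fps_X * arch * (arch * passage_poly1 C M pole
        + arch * passage_poly1 C (M + 1) pole)"
  proof (rule slice_step[where r = r and a = "(M+1)" and s = s])
    show "?f 1 m = fps_X * (arch * ?f 1 (Suc m) + ?f 1 m * arch + r)"
      by (rule trans[OF passage_slice_recs(1)]) (unfold pair_slice_eqs r_def M_def C_def, algebra)
    show "arch * passage_poly1 C M pole = fps_X * ((M+1) * (1 + arch * arch) + arch * arch * (s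
        + (passage_poly1 C M pole + passage_poly1 C (M + 1) pole)))"
      by (rule trans[OF passage_poly_fps_eq[OF passage_poly1_rec]]) (unfold s_def, algebra)
    show "r = (M+1) * (1 + arch * arch) + arch * arch * s"
      unfolding r_def s_def  S C_def[symmetric] M_def[symmetric] by algebra
  qed
  thus "?f 1 m - fps_X * arch * (?f 1 m + ?f 1 (Suc m)) =
    arch * passage_poly1 (fps_const c) (of_nat m) pole - fps_X * arch *
      (arch * passage_poly1 (fps_const c) (of_nat m) pole
          + arch * passage_poly1 (fps_const c) (of_nat (Suc m)) pole)"
    unfolding S C_def M_def .
qed

lemma passage_slice_2: "passage_slice c 2 m = arch * passage_poly2 (fps_const c) (of_nat m) pole"
proof (rule linear_unique[where p = "passage_slice c 2" and q = "\<lambda>m. arch * passage_poly2 (fps_const c) (of_nat m) pole"])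
  fix m
  let ?f = "passage_slice c"
  define M where "M = (of_nat m :: real fps)"
  define C where "C = fps_const c"
  have S: "of_nat (Suc m) = M + 1" by (simp add: M_def)
  define r :: "real fps" where "r = 2 * ?f 1 m * ?f 1 (Suc m)
      + 2 * (M+1) * (arch * ?f 1 (Suc m) + 0 + ?f 1 m * arch) + ((M+1)^2*(1+2*C)) * (1 + arch * arch)"
  define s :: "real fps" where "s = 2 * passage_poly1 C M pole * passage_poly1 C (M + 1) pole
      + 2 * (M+1) * (passage_poly1 C (M + 1) pole + 0 + passage_poly1 C M pole)"
  have "?f 2 m - fps_X * arch * (?f 2 m + ?f 2 (Suc m)) =
    arch * passage_poly2 C M pole - fps_X * arch * (arch * passage_poly2 C M pole
        + arch * passage_poly2 C (M + 1) pole)"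
  proof (rule slice_step[where r = r and a = "((M+1)^2*(1+2*C))" and s = s])
    show "?f 2 m = fps_X * (arch * ?f 2 (Suc m) + ?f 2 m * arch + r)"
      by (rule trans[OF passage_slice_recs(2)]) (unfold pair_slice_eqs r_def M_def C_def, algebra)
    show "arch * passage_poly2 C M pole = fps_X * (((M+1)^2*(1+2*C)) * (1 + arch * arch)
        + arch * arch * (s + (passage_poly2 C M pole + passage_poly2 C (M + 1) pole)))"
      by (rule trans[OF passage_poly_fps_eq[OF passage_poly2_rec]]) (unfold s_def, algebra)
    show "r = ((M+1)^2*(1+2*C)) * (1 + arch * arch) + arch * arch * s"
      unfolding r_def s_def passage_slice_1 S C_def[symmetric] M_def[symmetric] by algebra
  qed
  thus "?f 2 m - fps_X * arch * (?f 2 m + ?f 2 (Suc m)) =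
    arch * passage_poly2 (fps_const c) (of_nat m) pole - fps_X * arch *
      (arch * passage_poly2 (fps_const c) (of_nat m) pole
          + arch * passage_poly2 (fps_const c) (of_nat (Suc m)) pole)"
    unfolding S C_def M_def .
qed

lemma passage_slice_3: "passage_slice c 3 m = arch * passage_poly3 (fps_const c) (of_nat m) pole"
proof (rule linear_unique[where p = "passage_slice c 3" and q = "\<lambda>m. arch * passage_poly3 (fps_const c) (of_nat m) pole"])
  fix m
  let ?f = "passage_slice c"
  define M where "M = (of_nat m :: real fps)"
  define C where "C = fps_const c"
  have S: "of_nat (Suc m) = M + 1" by (simp add: M_def)
  define r :: "real fps" where "r = 3 * ?f 1 m * ?f 2 (Suc m) + 3 * ?f 2 m * ?f 1 (Suc m)
      + 3 * (M+1) * (arch * ?f 2 (Suc m) + 2 * ?f 1 m * ?f 1 (Suc m) + ?f 2 m * arch)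
      + 3 * ((M+1)^2*(1+2*C)) * (arch * ?f 1 (Suc m) + 0 + ?f 1 m * arch) + ((M+1)^3*(1+6*C)) * (1
          + arch * arch)"
  define s :: "real fps" where "s = 3 * passage_poly1 C M pole * passage_poly2 C (M + 1) pole
      + 3 * passage_poly2 C M pole * passage_poly1 C (M + 1) pole
      + 3 * (M+1) * (passage_poly2 C (M + 1) pole + 2 * passage_poly1 C M pole * passage_poly1 C (M + 1)
          pole + passage_poly2 C M pole)
      + 3 * ((M+1)^2*(1+2*C)) * (passage_poly1 C (M + 1) pole + 0 + passage_poly1 C M pole)"
  have "?f 3 m - fps_X * arch * (?f 3 m + ?f 3 (Suc m)) =
    arch * passage_poly3 C M pole - fps_X * arch * (arch * passage_poly3 C M pole
        + arch * passage_poly3 C (M + 1) pole)"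
  proof (rule slice_step[where r = r and a = "((M+1)^3*(1+6*C))" and s = s])
    show "?f 3 m = fps_X * (arch * ?f 3 (Suc m) + ?f 3 m * arch + r)"
      by (rule trans[OF passage_slice_recs(3)]) (unfold pair_slice_eqs r_def M_def C_def, algebra)
    show "arch * passage_poly3 C M pole = fps_X * (((M+1)^3*(1+6*C)) * (1 + arch * arch)
        + arch * arch * (s + (passage_poly3 C M pole + passage_poly3 C (M + 1) pole)))"
      by (rule trans[OF passage_poly_fps_eq[OF passage_poly3_rec]]) (unfold s_def, algebra)
    show "r = ((M+1)^3*(1+6*C)) * (1 + arch * arch) + arch * arch * s"
      unfolding r_def s_def passage_slice_1 passage_slice_2 S C_def[symmetric] M_def[symmetric] by
          algebra
  qed
  thus "?f 3 m - fps_X * arch * (?f 3 m + ?f 3 (Suc m)) =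
    arch * passage_poly3 (fps_const c) (of_nat m) pole - fps_X * arch *
      (arch * passage_poly3 (fps_const c) (of_nat m) pole
          + arch * passage_poly3 (fps_const c) (of_nat (Suc m)) pole)"
    unfolding S C_def M_def .
qed

lemma passage_slice_4: "passage_slice c 4 m = arch * passage_poly4 (fps_const c) (of_nat m) pole"
proof (rule linear_unique[where p = "passage_slice c 4" and q = "\<lambda>m. arch * passage_poly4 (fps_const c) (of_nat m) pole"])
  fix m
  let ?f = "passage_slice c"
  define M where "M = (of_nat m :: real fps)"
  define C where "C = fps_const c"
  have S: "of_nat (Suc m) = M + 1" by (simp add: M_def)
  define r :: "real fps" where "r = 4 * ?f 1 m * ?f 3 (Suc m) + 6 * ?f 2 m * ?f 2 (Suc m)
      + 4 * ?f 3 m * ?f 1 (Suc m)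
      + 4 * (M+1) * (arch * ?f 3 (Suc m) + 3 * ?f 1 m * ?f 2 (Suc m) + 3 * ?f 2 m * ?f 1 (Suc m) + ?f 3
          m * arch)
      + 6 * ((M+1)^2*(1+2*C)) * (arch * ?f 2 (Suc m) + 2 * ?f 1 m * ?f 1 (Suc m) + ?f 2 m * arch)
      + 4 * ((M+1)^3*(1+6*C)) * (arch * ?f 1 (Suc m) + 0 + ?f 1 m * arch)
          + ((M+1)^4*(1+12*C+12*C^2)) * (1 + arch * arch)"
  define s :: "real fps" where "s = 4 * passage_poly1 C M pole * passage_poly3 C (M + 1) pole
      + 6 * passage_poly2 C M pole * passage_poly2 C (M + 1) pole
      + 4 * passage_poly3 C M pole * passage_poly1 C (M + 1) pole
      + 4 * (M+1) * (passage_poly3 C (M + 1) pole + 3 * passage_poly1 C M pole * passage_poly2 C (M + 1)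
          pole + 3 * passage_poly2 C M pole * passage_poly1 C (M + 1) pole + passage_poly3 C M pole)
      + 6 * ((M+1)^2*(1+2*C)) * (passage_poly2 C (M + 1) pole + 2 * passage_poly1 C M pole *
          passage_poly1 C (M + 1) pole + passage_poly2 C M pole)
      + 4 * ((M+1)^3*(1+6*C)) * (passage_poly1 C (M + 1) pole + 0 + passage_poly1 C M pole)"
  have "?f 4 m - fps_X * arch * (?f 4 m + ?f 4 (Suc m)) =
    arch * passage_poly4 C M pole - fps_X * arch * (arch * passage_poly4 C M pole
        + arch * passage_poly4 C (M + 1) pole)"
  proof (rule slice_step[where r = r and a = "((M+1)^4*(1+12*C+12*C^2))" and s = s])
    show "?f 4 m = fps_X * (arch * ?f 4 (Suc m) + ?f 4 m * arch + r)"
      by (rule trans[OF passage_slice_recs(4)]) (unfold pair_slice_eqs r_def M_def C_def, algebra)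
    show "arch * passage_poly4 C M pole = fps_X * (((M+1)^4*(1+12*C+12*C^2)) * (1 + arch * arch)
        + arch * arch * (s + (passage_poly4 C M pole + passage_poly4 C (M + 1) pole)))"
      by (rule trans[OF passage_poly_fps_eq[OF passage_poly4_rec]]) (unfold s_def, algebra)
    show "r = ((M+1)^4*(1+12*C+12*C^2)) * (1 + arch * arch) + arch * arch * s"
      unfolding r_def s_def passage_slice_1 passage_slice_2 passage_slice_3 S C_def[symmetric]
          M_def[symmetric] by algebra
  qed
  thus "?f 4 m - fps_X * arch * (?f 4 m + ?f 4 (Suc m)) =
    arch * passage_poly4 (fps_const c) (of_nat m) pole - fps_X * arch *
      (arch * passage_poly4 (fps_const c) (of_nat m) pole
          + arch * passage_poly4 (fps_const c) (of_nat (Suc m)) pole)"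
    unfolding S C_def M_def .
qed

section \<open>Moments of closed walks\<close>

lemma X_square_central_square: "fps_X\<^sup>2 * central\<^sup>2 = pole * (pole - 1)"
proof -
  have "4 * (fps_X\<^sup>2 * central\<^sup>2) = central\<^sup>2 - 1" using central_square by algebra
  also have "\<dots> = 4 * (pole * (pole - 1))" unfolding central_eq by algebra
  finally show ?thesis by simp
qed

lemma deriv_pole: "fps_X * fps_deriv pole = 2 * pole * (pole - 1) * central"
proof -
  have num: "fps_deriv (numeral k :: real fps) = 0" for k
    by (simp add: numeral_fps_const)
  have "fps_deriv (1 - 4 * fps_X\<^sup>2 :: real fps) = - 8 * fps_X"
    by (simp add: power2_eq_square num)
  moreover have "fps_deriv (central\<^sup>2) = 2 * central * fps_deriv central"
    by (simp add: power2_eq_square)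
  moreover have "fps_deriv (central\<^sup>2 * (1 - 4 * fps_X\<^sup>2)) = 0"
    unfolding central_square by simp
  ultimately have "2 * central * fps_deriv central * (1 - 4 * fps_X\<^sup>2) = 8 * fps_X * central\<^sup>2"
    unfolding fps_deriv_mult[of "central\<^sup>2"] by algebra
  hence "central * (2 * central * fps_deriv central * (1 - 4 * fps_X\<^sup>2)) * fps_X = central * (8 * fps_X * central\<^sup>2) * fps_X"
    by simp
  hence "2 * (fps_X * fps_deriv central) = 8 * (fps_X\<^sup>2 * central\<^sup>2) * central"
    using central_square by algebra
  moreover have "fps_deriv central = 2 * fps_deriv pole"
    unfolding central_eq by (simp add: num)
  ultimately have "4 * (fps_X * fps_deriv pole) = 4 * (2 * pole * (pole - 1) * central)"
    unfolding X_square_central_square by algebra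
  thus ?thesis by (metis mult_left_cancel zero_neq_numeral)
qed

lemma arch_nz: "arch \<noteq> 0"
  using arch_pole central_nz by auto

lemma deriv_arch: "fps_X * fps_deriv arch = arch * central"
proof -
  have "fps_deriv (arch\<^sup>2 * pole) = fps_deriv pole"
    unfolding arch_square by simp
  hence "2 * arch * fps_deriv arch * pole = (1 - arch\<^sup>2) * fps_deriv pole"
    by (simp add: power2_eq_square algebra_simps)
  hence "2 * arch * pole * pole * (fps_X * fps_deriv arch) = (pole - arch\<^sup>2 * pole) * (fps_X * fps_deriv pole)"
    by algebra
  also have "\<dots> = 2 * pole * (pole - 1) * central" unfolding deriv_pole arch_square by simp
  also have "\<dots> = 2 * arch * pole * pole * (arch * central)" unfolding arch_square[symmetric] by algebra
  finally show ?thesis using arch_nz pole_nz by simp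
qed

lemma deriv_passage_poly1: "fps_deriv (passage_poly1 (fps_const c) 0 pole) = passage_poly_deriv1 (fps_const c) pole * fps_deriv pole"
proof -
  have num: "fps_deriv (numeral k :: real fps) = 0" for k
    by (simp add: numeral_fps_const)
  show ?thesis unfolding passage_poly1_def passage_poly_deriv1_def
    by (simp add: num fps_deriv_power fps_const_power) (simp add: numeral_fps_const[symmetric]
        fps_of_nat algebra_simps)?
qed

lemma deriv_passage_poly2: "fps_deriv (passage_poly2 (fps_const c) 0 pole) = passage_poly_deriv2 (fps_const c) pole * fps_deriv pole"
proof -
  have num: "fps_deriv (numeral k :: real fps) = 0" for k
    by (simp add: numeral_fps_const)
  show ?thesis unfolding passage_poly2_def passage_poly_deriv2_def
    by (simp add: num fps_deriv_power fps_const_power) (simp add: numeral_fps_const[symmetric]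
        fps_of_nat algebra_simps)?
qed

lemma deriv_passage_poly3: "fps_deriv (passage_poly3 (fps_const c) 0 pole) = passage_poly_deriv3 (fps_const c) pole * fps_deriv pole"
proof -
  have num: "fps_deriv (numeral k :: real fps) = 0" for k
    by (simp add: numeral_fps_const)
  show ?thesis unfolding passage_poly3_def passage_poly_deriv3_def
    by (simp add: num fps_deriv_power fps_const_power) (simp add: numeral_fps_const[symmetric]
        fps_of_nat algebra_simps)?
qed

lemma deriv_passage_poly4: "fps_deriv (passage_poly4 (fps_const c) 0 pole) = passage_poly_deriv4 (fps_const c) pole * fps_deriv pole"
proof -
  have num: "fps_deriv (numeral k :: real fps) = 0" for k
    by (simp add: numeral_fps_const)
  show ?thesis unfolding passage_poly4_def passage_poly_deriv4_def
    by (simp add: num fps_deriv_power fps_const_power) (simp add: numeral_fps_const[symmetric]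
        fps_of_nat algebra_simps)?
qed

abbreviation closed_slice :: "real \<Rightarrow> nat \<Rightarrow> real fps" where
  "closed_slice c k \<equiv> slice k (closed_walks (moment_weight c))"

lemma closed_slice_eq:
  "slice k ((1 - (passage_fps (moment_weight c) 0)\<^sup>2) * closed_walks (moment_weight c)) =
     fps_X * fps_deriv (passage_slice c k 0)"
  unfolding closed_walks_fps[OF moment_weight_nz] slice_X slice_deriv ..

lemma slice_1_le_4:
  "slice 0 1 = 1" "slice 1 1 = 0" "slice 2 1 = 0" "slice 3 1 = 0" "slice 4 1 = 0"
  by (simp_all add: slice_1)

lemma one_minus_square_slices:
  fixes c :: real
  defines "B \<equiv> 1 - (passage_fps (moment_weight c) 0)\<^sup>2" and "C \<equiv> fps_const c"
  shows "slice 0 B = 1 - arch * arch"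
    "slice 1 B = - (arch * arch * (2 * passage_poly1 C 0 pole))"
    "slice 2 B = - (arch * arch * (2 * passage_poly2 C 0 pole + 2 * passage_poly1 C 0 pole ^ 2))"
    "slice 3 B = - (arch * arch * (2 * passage_poly3 C 0 pole
        + 6 * passage_poly1 C 0 pole * passage_poly2 C 0 pole))"
    "slice 4 B = - (arch * arch * (2 * passage_poly4 C 0 pole
        + 8 * passage_poly1 C 0 pole * passage_poly3 C 0 pole + 6 * passage_poly2 C 0 pole ^ 2))"
  unfolding B_def C_def power2_eq_square[of "passage_fps _ _"] slice_diff slice_1_le_4 slice_mult_le_4
    passage_slice_0 passage_slice_1 passage_slice_2 passage_slice_3 passage_slice_4 of_nat_0 by (rule
        refl, algebra+)

lemma one_minus_arch_square: "(1 - arch * arch) * pole = 1"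
  using arch_square by algebra

text \<open>The slices of \<open>(1 - (F 0)\<^sup>2) * G\<close> are triangular with diagonal \<open>1 - arch\<^sup>2 = 1 / pole\<close>. Here \<open>R\<close>
  collects the terms with lower slices of \<open>G\<close>.\<close>

lemma slice_solve:
  assumes "(1 - arch * arch) * K + R = fps_X * fps_deriv (arch * g)"
    and "R = - (arch * arch * (arch * pole * s))"
    and "fps_deriv g = d * fps_deriv pole"
    and "h = (2 * pole - 1) * (g + 2 * pole * (pole - 1) * d) + (pole - 1) * s"
  shows "K = arch * pole * h"
proof -
  have "fps_X * fps_deriv (arch * g) = (fps_X * fps_deriv arch) * g
      + arch * d * (fps_X * fps_deriv pole)"
    unfolding fps_deriv_mult assms(3) by algebra
  also have "\<dots> = arch * central * (g + 2 * pole * (pole - 1) * d)"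
    unfolding deriv_pole deriv_arch by algebra
  finally have eq: "(1 - arch * arch) * K = arch * central * (g + 2 * pole * (pole - 1) * d)
      + arch * arch * (arch * pole * s)"
    using assms(1,2) by algebra
  have "K = ((1 - arch * arch) * pole) * K" by (simp add: one_minus_arch_square)
  also have "\<dots> = pole * ((1 - arch * arch) * K)" by algebra
  also have "\<dots> = arch * pole * (central * (g + 2 * pole * (pole - 1) * d)
      + (arch\<^sup>2 * pole) * s)"
    unfolding eq by algebra
  also have "\<dots> = arch * pole * h"
    unfolding arch_square assms(4) central_eq ..
  finally show ?thesis .
qed

lemma closed_slice_0: "closed_slice c 0 = arch * pole * (2 * pole - 1)"
proof (rule slice_solve[where R = 0 and g = 1 and s = 0 and d = 0])
  show "(1 - arch * arch) * closed_slice c 0 + 0 = fps_X * fps_deriv (arch * 1)"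
    using closed_slice_eq[of 0 c] unfolding slice_mult_le_4 one_minus_square_slices passage_slice_0 by
        simp
qed simp_all

lemma closed_slice_1: "closed_slice c 1 = arch * pole * closed_poly1 (fps_const c) pole"
proof -
  let ?passage_poly1 = "passage_poly1 (fps_const c) 0 pole"
  let ?s = "(2 * ?passage_poly1) * (2 * pole - 1)"
  let ?R = "(- (arch * arch * (2 * ?passage_poly1))) * closed_slice c 0"
  show ?thesis
  proof (rule slice_solve[where d = "passage_poly_deriv1 (fps_const c) pole" and g = "?passage_poly1" and
      s = "?s" and
      R = "?R"])
    show "(1 - arch * arch) * closed_slice c 1 + (?R) = fps_X * fps_deriv (arch * ?passage_poly1)"
      using closed_slice_eq[of 1 c]
      unfolding slice_mult_le_4 one_minus_square_slices passage_slice_1 of_nat_0 .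
    show "?R = - (arch * arch * (arch * pole * (?s)))"
      unfolding closed_slice_0 by algebra
  qed (rule deriv_passage_poly1 closed_poly1_rec)+
qed

lemma closed_slice_2: "closed_slice c 2 = arch * pole * closed_poly2 (fps_const c) pole"
proof -
  let ?passage_poly1 = "passage_poly1 (fps_const c) 0 pole"
  let ?passage_poly2 = "passage_poly2 (fps_const c) 0 pole"
  let ?s = "2 * (2 * ?passage_poly1) * closed_poly1 (fps_const c) pole + (2 * ?passage_poly2
      + 2 * ?passage_poly1^2) * (2 * pole - 1)"
  let ?R = "2 * (- (arch * arch * (2 * ?passage_poly1))) * closed_slice c 1
      + (- (arch * arch * (2 * ?passage_poly2 + 2 * ?passage_poly1^2))) * closed_slice c 0"
  show ?thesis
  proof (rule slice_solve[where d = "passage_poly_deriv2 (fps_const c) pole" and g = "?passage_poly2" and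
      s = "?s" and
      R = "?R"])
    show "(1 - arch * arch) * closed_slice c 2 + (?R) = fps_X * fps_deriv (arch * ?passage_poly2)"
      using closed_slice_eq[of 2 c]
      unfolding slice_mult_le_4 one_minus_square_slices passage_slice_2 of_nat_0 by algebra
    show "?R = - (arch * arch * (arch * pole * (?s)))"
      unfolding closed_slice_0 closed_slice_1 by algebra
  qed (rule deriv_passage_poly2 closed_poly2_rec)+
qed

lemma closed_slice_3: "closed_slice c 3 = arch * pole * closed_poly3 (fps_const c) pole"
proof -
  let ?passage_poly1 = "passage_poly1 (fps_const c) 0 pole"
  let ?passage_poly2 = "passage_poly2 (fps_const c) 0 pole"
  let ?passage_poly3 = "passage_poly3 (fps_const c) 0 pole"
  let ?s = "3 * (2 * ?passage_poly1) * closed_poly2 (fps_const c) pole + 3 * (2 * ?passage_poly2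
      + 2 * ?passage_poly1^2) * closed_poly1 (fps_const c) pole + (2 * ?passage_poly3
      + 6 * ?passage_poly1 * ?passage_poly2) * (2 * pole - 1)"
  let ?R = "3 * (- (arch * arch * (2 * ?passage_poly1))) * closed_slice c 2
      + 3 * (- (arch * arch * (2 * ?passage_poly2 + 2 * ?passage_poly1^2))) * closed_slice c 1
      + (- (arch * arch * (2 * ?passage_poly3
      + 6 * ?passage_poly1 * ?passage_poly2))) * closed_slice c 0"
  show ?thesis
  proof (rule slice_solve[where d = "passage_poly_deriv3 (fps_const c) pole" and g = "?passage_poly3" and
      s = "?s" and
      R = "?R"])
    show "(1 - arch * arch) * closed_slice c 3 + (?R) = fps_X * fps_deriv (arch * ?passage_poly3)"
      using closed_slice_eq[of 3 c]
      unfolding slice_mult_le_4 one_minus_square_slices passage_slice_3 of_nat_0 by algebra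
    show "?R = - (arch * arch * (arch * pole * (?s)))"
      unfolding closed_slice_0 closed_slice_1 closed_slice_2 by algebra
  qed (rule deriv_passage_poly3 closed_poly3_rec)+
qed

lemma closed_slice_4: "closed_slice c 4 = arch * pole * closed_poly4 (fps_const c) pole"
proof -
  let ?passage_poly1 = "passage_poly1 (fps_const c) 0 pole"
  let ?passage_poly2 = "passage_poly2 (fps_const c) 0 pole"
  let ?passage_poly3 = "passage_poly3 (fps_const c) 0 pole"
  let ?passage_poly4 = "passage_poly4 (fps_const c) 0 pole"
  let ?s = "4 * (2 * ?passage_poly1) * closed_poly3 (fps_const c) pole + 6 * (2 * ?passage_poly2
      + 2 * ?passage_poly1^2) * closed_poly2 (fps_const c) pole + 4 * (2 * ?passage_poly3
      + 6 * ?passage_poly1 * ?passage_poly2) * closed_poly1 (fps_const c) pole + (2 * ?passage_poly4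
      + 8 * ?passage_poly1 * ?passage_poly3 + 6 * ?passage_poly2^2) * (2 * pole - 1)"
  let ?R = "4 * (- (arch * arch * (2 * ?passage_poly1))) * closed_slice c 3
      + 6 * (- (arch * arch * (2 * ?passage_poly2 + 2 * ?passage_poly1^2))) * closed_slice c 2
      + 4 * (- (arch * arch * (2 * ?passage_poly3
      + 6 * ?passage_poly1 * ?passage_poly2))) * closed_slice c 1
      + (- (arch * arch * (2 * ?passage_poly4 + 8 * ?passage_poly1 * ?passage_poly3
      + 6 * ?passage_poly2^2))) * closed_slice c 0"
  show ?thesis
  proof (rule slice_solve[where d = "passage_poly_deriv4 (fps_const c) pole" and g = "?passage_poly4" and
      s = "?s" and
      R = "?R"])
    show "(1 - arch * arch) * closed_slice c 4 + (?R) = fps_X * fps_deriv (arch * ?passage_poly4)"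
      using closed_slice_eq[of 4 c]
      unfolding slice_mult_le_4 one_minus_square_slices passage_slice_4 of_nat_0 by algebra
    show "?R = - (arch * arch * (arch * pole * (?s)))"
      unfolding closed_slice_0 closed_slice_1 closed_slice_2 closed_slice_3 by algebra
  qed (rule deriv_passage_poly4 closed_poly4_rec)+
qed

section \<open>Growth of the coefficients\<close>

text \<open>Growth of the even coefficients relative to \<open>4 ^ n * n ^ (j - 1)\<close>, which is the growth for
  \<open>1 / (1 - 4 X\<^sup>2) ^ j\<close>.\<close>

definition lead :: "nat \<Rightarrow> real fps \<Rightarrow> real \<Rightarrow> bool" where
  "lead j F l \<longleftrightarrow> (\<lambda>n. F $ (2 * n) / (4 ^ n * real n ^ (j - 1))) \<longlonglongrightarrow> l"

lemma lead_eqI: "lead j F l' \<Longrightarrow> l' = l \<Longrightarrow> lead j F l"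
  by simp

lemma lead_add: "lead j F a \<Longrightarrow> lead j G b \<Longrightarrow> lead j (F + G) (a + b)"
  unfolding lead_def by (drule (1) tendsto_add) (simp add: add_divide_distrib)

lemma lead_diff: "lead j F a \<Longrightarrow> lead j G b \<Longrightarrow> lead j (F - G) (a - b)"
  unfolding lead_def by (drule (1) tendsto_diff) (simp add: diff_divide_distrib)

lemma lead_const_mult: "lead j F a \<Longrightarrow> lead j (fps_const k * F) (k * a)"
  unfolding lead_def by (drule tendsto_mult_left[where c = k]) simp

lemma lead_numeral_mult: "lead j F a \<Longrightarrow> lead j (numeral k * F) (numeral k * a)"
  unfolding numeral_fps_const by (rule lead_const_mult)

lemma lead_0: "lead j 0 0"
  by (simp add: lead_def)

lemma lead_sum: "(\<And>i. i \<in> A \<Longrightarrow> lead j (F i) (a i)) \<Longrightarrow> lead j (sum F A) (sum a A)"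
  by (induction A rule: infinite_finite_induct) (auto intro: lead_add lead_0)

text \<open>The powers of \<open>central\<close> are binomial series, so the asymptotics of generalised binomial
  coefficients apply; the odd powers fall between two integer orders of growth.\<close>

lemma lead_central_power:
  assumes "1 \<le> j" "k \<le> 2 * j"
  shows "lead j (central ^ k) (if k = 2 * j then 1 / fact (j - 1) else 0)"
proof -
  define z where "z = - (real k / 2)"
  define a where "a n = (z gchoose n) / ((-1) ^ n / exp ((z + 1) * ln (real n)))" for n
  have a: "a \<longlonglongrightarrow> inverse (Gamma (real k / 2))"
    unfolding a_def[abs_def] z_def using gbinomial_asymptotic[of "- (real k / 2)"] by simp
  have eq: "(central ^ k) $ (2 * n) / (4 ^ n * real n ^ (j - 1)) = a n * real n powr (real k / 2 - real j)"
    if "n > 0" for n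
  proof -
    have "real n ^ (j - 1) = exp ((real j - 1) * ln (real n))"
      using that assms by (simp add: powr_realpow[symmetric] powr_def of_nat_diff mult.commute)
    moreover have "exp ((z + 1) * ln (real n)) * real n powr (real k / 2 - real j) *
        exp ((real j - 1) * ln (real n)) = 1"
      using that by (simp add: powr_def exp_add[symmetric] z_def algebra_simps)
    moreover have "(-4 :: real) ^ n = (-1) ^ n * 4 ^ n"
      by (simp add: power_mult_distrib[symmetric])
    ultimately show ?thesis
      unfolding a_def central_power_nth z_def[symmetric]
      by (simp add: field_simps)
  qed
  have "(\<lambda>n. a n * real n powr (real k / 2 - real j)) \<longlonglongrightarrow>
     (if k = 2 * j then 1 / fact (j - 1) else 0)"
  proof (cases "k = 2 * j")
    case True
    have "Gamma (real j) = fact (j - 1)"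
      using Gamma_fact[of "j - 1", where 'a = real] assms by (simp add: of_nat_diff)
    moreover have "eventually (\<lambda>n. a n = a n * real n powr (real k / 2 - real j)) at_top"
      using eventually_gt_at_top[of 0] by eventually_elim (simp add: True)
    ultimately show ?thesis
      using Lim_transform_eventually[OF a] True by (simp add: inverse_eq_divide)
  next
    case False
    hence "real k / 2 - real j < 0" using assms by (auto simp: field_simps)
    hence "(\<lambda>n. real n powr (real k / 2 - real j)) \<longlonglongrightarrow> 0"
      using tendsto_neg_powr[OF _ filterlim_real_sequentially] by simp
    from tendsto_mult[OF a this] show ?thesis using False by simp
  qed
  moreover have "eventually (\<lambda>n. (central ^ k) $ (2 * n) / (4 ^ n * real n ^ (j - 1)) =
      a n * real n powr (real k / 2 - real j)) at_top"
    using eventually_gt_at_top[of 0] by eventually_elim (rule eq)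
  ultimately show ?thesis
    unfolding lead_def by (simp add: tendsto_cong)
qed

lemma lead_pole_power:
  assumes "1 \<le> j" "k \<le> 2 * j"
  shows "lead j (pole ^ k) (if k = 2 * j then 1 / (2 ^ k * fact (j - 1)) else 0)"
proof -
  have "pole ^ k = fps_const ((1/2) ^ k) * (central + 1) ^ k"
    by (simp add: pole_def power_mult_distrib fps_const_power add.commute)
  also have "(central + 1) ^ k = (\<Sum>i\<le>k. fps_const (of_nat (k choose i)) * central ^ i)"
    by (simp add: binomial_ring fps_of_nat)
  finally have eq: "pole ^ k = fps_const ((1/2) ^ k) * (\<Sum>i\<le>k. fps_const (of_nat (k choose i)) * central ^ i)" .
  have "lead j (pole ^ k) ((1/2) ^ k * (\<Sum>i\<le>k. of_nat (k choose i) *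
      (if i = 2 * j then 1 / fact (j - 1) else 0)))"
    unfolding eq using assms by (intro lead_const_mult lead_sum lead_central_power) auto
  moreover have "(\<Sum>i\<le>k. of_nat (k choose i) * (if i = 2 * j then 1 / fact (j - 1) else 0)) =
      (if k = 2 * j then 1 / fact (j - 1) else (0::real))"
    using assms by (auto intro!: sum.neutral simp: if_distrib cong: if_cong)
  ultimately show ?thesis by (cases "k = 2 * j") (simp_all add: power_divide mult.commute)
qed

lemma lead_top: "1 \<le> j \<Longrightarrow> k = 2 * j \<Longrightarrow> lead j (pole ^ k) (1 / (2 ^ k * fact (j - 1)))"
  using lead_pole_power[of j k] by simp

lemma lead_low: "k < 2 * j \<Longrightarrow> lead j (pole ^ k) 0"
  using lead_pole_power[of j k] by simp

lemma lead_pole: "1 \<le> j \<Longrightarrow> lead j pole 0"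
  using lead_low[of 1 j] by simp

lemma lead_1: "1 \<le> j \<Longrightarrow> lead j 1 0"
  using lead_low[of 0 j] by simp

text \<open>In each of the following polynomials the degree is twice the order of growth, and only the leading
  monomial contributes to the limit.\<close>

lemma lead_2_0: "lead 4 (2304 * pole^8 - 8256 * pole^7 + 12032 * pole^6 - 9168 * pole^5
    + 3888 * pole^4 - 892 * pole^3 + 96 * pole^2 - 3 * pole) (3/2)"
  by (rule lead_eqI, (rule lead_add lead_diff lead_numeral_mult | (rule lead_low, (simp; fail))
      | (rule lead_top, (simp; fail), (simp; fail)) | (rule lead_pole lead_1, (simp; fail)))+)
     (simp add: fact_numeral)

lemma lead_2_1: "lead 3 (256 * pole^6 - 672 * pole^5 + 672 * pole^4 - 320 * pole^3
    + 72 * pole^2 - 6 * pole) (2)"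
  by (rule lead_eqI, (rule lead_add lead_diff lead_numeral_mult | (rule lead_low, (simp; fail))
      | (rule lead_top, (simp; fail), (simp; fail)) | (rule lead_pole lead_1, (simp; fail)))+)
     (simp add: fact_numeral)

lemma lead_4_0: "lead 7 (46891008 * pole^14 - 306542592 * pole^13
    + 893445120 * pole^12 - 1531376640 * pole^11 + 1713942528 * pole^10
   - 1314471936 * pole^9 + 704683392 * pole^8 - 264193152 * pole^7 + 68052416 * pole^6 - 11568024 *
       pole^5
   + 1202436 * pole^4 - 65908 * pole^3 + 1356 * pole^2 - 3 * pole) (159/40)"
  by (rule lead_eqI, (rule lead_add lead_diff lead_numeral_mult | (rule lead_low, (simp; fail))
      | (rule lead_top, (simp; fail), (simp; fail)) | (rule lead_pole lead_1, (simp; fail)))+)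
     (simp add: fact_numeral)

lemma lead_4_1: "lead 6 (15114240 * pole^12 - 83856384 * pole^11
    + 203263488 * pole^10 - 282720000 * pole^9 + 249056640 * pole^8
   - 144559296 * pole^7 + 55648032 * pole^6 - 13907088 * pole^5 + 2132424 * pole^4 - 178200 * pole^3 +
       6192 * pole^2
   - 36 * pole) (123/4)"
  by (rule lead_eqI, (rule lead_add lead_diff lead_numeral_mult | (rule lead_low, (simp; fail))
      | (rule lead_top, (simp; fail), (simp; fail)) | (rule lead_pole lead_1, (simp; fail)))+)
     (simp add: fact_numeral)

lemma lead_4_2: "lead 5 (491520 * pole^10 - 2242560 * pole^9 + 4343808 * pole^8 - 4657152 * pole^7
    + 3016704 * pole^6 - 1206336 * pole^5
   + 290496 * pole^4 - 38784 * pole^3 + 2352 * pole^2 - 36 * pole) (20)"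
  by (rule lead_eqI, (rule lead_add lead_diff lead_numeral_mult | (rule lead_low, (simp; fail))
      | (rule lead_top, (simp; fail), (simp; fail)) | (rule lead_pole lead_1, (simp; fail)))+)
     (simp add: fact_numeral)

lemma central_closed_poly2:
  obtains A0 A1 where "\<And>C. central * closed_poly2 C pole = A0
      + C * A1" "lead 4 A0 (3/2)" "lead 3 A1 2"
proof (rule that[OF _ lead_2_0 lead_2_1])
  show "central * closed_poly2 C pole = (2304 * pole^8 - 8256 * pole^7 + 12032 * pole^6 - 9168 * pole^5
      + 3888 * pole^4 - 892 * pole^3 + 96 * pole^2 - 3 * pole) + C * (256 * pole^6 - 672 * pole^5
      + 672 * pole^4 - 320 * pole^3 + 72 * pole^2 - 6 * pole)" for C
    unfolding closed_poly2_def central_eq by algebra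
qed

lemma central_closed_poly4:
  obtains A0 A1 A2 where "\<And>C. central * closed_poly4 C pole = A0 + C * A1 + C\<^sup>2 * A2"
    "lead 7 A0 (159/40)" "lead 6 A1 (123/4)" "lead 5 A2 20"
proof (rule that[OF _ lead_4_0 lead_4_1 lead_4_2])
  show "central * closed_poly4 C pole = (46891008 * pole^14 - 306542592 * pole^13
      + 893445120 * pole^12 - 1531376640 * pole^11 + 1713942528 * pole^10
   - 1314471936 * pole^9 + 704683392 * pole^8 - 264193152 * pole^7 + 68052416 * pole^6 - 11568024 *
       pole^5
   + 1202436 * pole^4 - 65908 * pole^3 + 1356 * pole^2 - 3 * pole) + C * (15114240 * pole^12 - 83856384
       * pole^11 + 203263488 * pole^10 - 282720000 * pole^9 + 249056640 * pole^8
   - 144559296 * pole^7 + 55648032 * pole^6 - 13907088 * pole^5 + 2132424 * pole^4 - 178200 * pole^3 +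
       6192 * pole^2
   - 36 * pole) + C\<^sup>2 * (491520 * pole^10 - 2242560 * pole^9 + 4343808 * pole^8 - 4657152 * pole^7
       + 3016704 * pole^6 - 1206336 * pole^5
   + 290496 * pole^4 - 38784 * pole^3 + 2352 * pole^2 - 36 * pole)" for C
    unfolding closed_poly4_def central_eq by algebra
qed

section \<open>The limiting moments of the model size\<close>

fun path_sum :: "(nat \<Rightarrow> real) \<Rightarrow> int \<Rightarrow> bool list \<Rightarrow> real" where
  "path_sum v i [] = 0"
| "path_sum v i (b # w) = v (level i) + path_sum v (i + step b) w"

text \<open>The starting point from which the walk ends at the mirror image \<open>1 - start w\<close> of where it began.
  It is an integer because the length, and with it the displacement, is odd.\<close>

definition start :: "bool list \<Rightarrow> int" where
  "start w = (1 - disp w) div 2"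

definition height_sum :: "bool list \<Rightarrow> real" where
  "height_sum w = path_sum (\<lambda>m. real m + 1) (start w) w"

definition height_square_sum :: "bool list \<Rightarrow> real" where
  "height_square_sum w = path_sum (\<lambda>m. (real m + 1)\<^sup>2) (start w) w"

text \<open>Walks with negative displacement are the mirror images of these.\<close>

definition rising :: "nat \<Rightarrow> bool list set" where
  "rising n = {w \<in> walks (2 * n + 1). disp w > 0}"

lemma finite_rising [simp]: "finite (rising n)"
  by (simp add: rising_def)

lemma walk_weight_moment:
  "walk_weight (moment_weight c) i w =
     exp_weight (path_sum (\<lambda>m. real m + 1) i w) (c * path_sum (\<lambda>m. (real m
         + 1)\<^sup>2) i w)"
  by (induction w arbitrary: i)
     (simp_all add: exp_weight_0 exp_weight_add distrib_left moment_weight_def)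

lemma odd_disp: "odd (disp w) \<longleftrightarrow> odd (length w)"
  by (induction w) auto

lemma disp_map_Not: "disp (map Not w) = - disp w"
  by (induction w) auto

lemma path_sum_map_Not: "path_sum v (1 - i) (map Not w) = path_sum v i w"
proof (induction w arbitrary: i)
  case (Cons b w)
  have eq: "1 - i + step (\<not> b) = 1 - (i + step b)" by simp
  show ?case by (simp only: list.map path_sum.simps eq level_reflect Cons.IH)
qed simp

lemma start_map_Not: "odd (length w) \<Longrightarrow> start (map Not w) = 1 - start w"
  using odd_disp[of w] by (auto simp: start_def disp_map_Not elim!: oddE)

lemma T_map_Not: "odd (length w) \<Longrightarrow> height_sum (map Not w) = height_sum w" "odd (length w) \<Longrightarrow> height_square_sum (map Not w) = height_square_sum w"
  by (simp_all add: height_sum_def height_square_sum_def start_map_Not path_sum_map_Not)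

lemma abs_disp_le: "\<bar>disp w\<bar> \<le> int (length w)"
  by (induction w) auto

lemma closed_walks_nth:
  assumes "odd n"
  shows "closed_walks v $ n = (\<Sum>w | w \<in> walks n \<and> disp w < 0. walk_weight v (start w) w)"
proof -
  have "(\<Sum>m\<le>n. if int m + 1 + disp w = - int m then walk_weight v (int m + 1) w else 0) =
        (if disp w < 0 then walk_weight v (start w) w else 0)" if "w \<in> walks n" for w
  proof -
    have len: "length w = n" using that by (simp add: walks_def)
    obtain d where d: "disp w = 2 * d + 1"
      using odd_disp[of w] assms len by (auto elim: oddE)
    have st: "start w = - d" unfolding start_def d by presburger
    have "int m + 1 + disp w = - int m \<longleftrightarrow> int m = - d - 1" for m
      using d by auto
    hence "(\<Sum>m\<le>n. if int m + 1 + disp w = - int m then walk_weight v (int m + 1) w else 0) =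
        (\<Sum>m\<le>n. if int m = - d - 1 then walk_weight v (start w) w else 0)"
      by (intro sum.cong) (auto simp: st)
    also have "\<dots> = (if disp w < 0 then walk_weight v (start w) w else 0)"
    proof (cases "disp w < 0")
      case True
      have "nat (- d - 1) \<le> n" using abs_disp_le[of w] d True len by simp
      moreover have "int m = - d - 1 \<longleftrightarrow> m = nat (- d - 1)" for m
        using True d by auto
      ultimately show ?thesis using True by simp
    next
      case False
      thus ?thesis using d by (auto intro!: sum.neutral)
    qed
    finally show ?thesis .
  qed
  hence "closed_walks v $ n = (\<Sum>w\<in>walks n. if disp w < 0 then walk_weight v (start w) w else 0)"
    unfolding closed_walks_def kern_eq_sum fps_nth_Abs_fps by (subst sum.swap) simp
  thus ?thesis by (simp add: sum.inter_filter)
qed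

lemma sum_falling_eq_rising:
  assumes "\<And>w. length w = 2 * n + 1 \<Longrightarrow> f (map Not w) = f w"
  shows "(\<Sum>w | w \<in> walks (2 * n + 1) \<and> disp w < 0. f w) = (\<Sum>w\<in>rising n. f w)"
  by (rule sum.reindex_bij_witness[where i = "map Not" and j = "map Not"])
     (auto simp: rising_def walks_def disp_map_Not comp_def assms)

lemma closed_slice_nth:
  "closed_slice c k $ (2 * n + 1) =
     (\<Sum>w\<in>rising n. fact k * exp_weight (height_sum w) (c * height_square_sum w) $ k)"
proof -
  have "closed_slice c k $ (2 * n + 1) =
     (\<Sum>w | w \<in> walks (2 * n
         + 1) \<and> disp w < 0. fact k * exp_weight (height_sum w) (c * height_square_sum w) $ k)"
    unfolding slice_nth
    by (subst closed_walks_nth) (simp_all add: fps_sum_nth sum_distrib_left walk_weight_moment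
        height_sum_def height_square_sum_def)
  also have "\<dots> = (\<Sum>w\<in>rising n. fact k * exp_weight (height_sum w) (c * height_square_sum w) $ k)"
    by (rule sum_falling_eq_rising) (simp add: T_map_Not)
  finally show ?thesis .
qed

lemma nth_odd_eq_even: "(arch * pole * h) $ (2 * n + 1) = (central * h) $ (2 * n)"
  unfolding arch_pole by (simp add: mult.assoc)

lemma card_rising: "card (rising n) = 4 ^ n"
proof -
  have "walks (2 * n + 1) = rising n \<union> {w \<in> walks (2 * n + 1). disp w < 0}"
  proof -
    have "disp w \<noteq> 0" if "w \<in> walks (2 * n + 1)" for w
      using odd_disp[of w] that by (auto simp: walks_def)
    thus ?thesis by (auto simp: rising_def neq_iff)
  qed
  hence "card (walks (2 * n + 1)) = card (rising n) + card {w \<in> walks (2 * n + 1). disp w < 0}"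
    by (metis (no_types, lifting) card_Un_disjoint finite_rising finite_walks finite_Un disjoint_iff
        mem_Collect_eq order.asym rising_def)
  moreover have "card {w \<in> walks (2 * n + 1). disp w < 0} = card (rising n)"
    using sum_falling_eq_rising[of n "\<lambda>_. 1 :: nat"] by simp
  ultimately show ?thesis
    by (simp add: card_walks power_mult)
qed

lemma sum_moment_2:
  "(\<Sum>w\<in>rising n. (height_sum w)\<^sup>2
      + 2 * (c * height_square_sum w)) = (central * closed_poly2 (fps_const c) pole) $ (2 * n)"
proof -
  have "(central * closed_poly2 (fps_const c) pole) $ (2 * n) = (\<Sum>w\<in>rising n. fact 2 * exp_weight (height_sum w) (c * height_square_sum w) $ 2)"
    unfolding nth_odd_eq_even[symmetric] closed_slice_2[symmetric] closed_slice_nth ..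
  also have "\<dots> = (\<Sum>w\<in>rising n. (height_sum w)\<^sup>2 + 2 * (c * height_square_sum w))"
    using exp_weight_nth(3) by (simp add: fact_numeral)
  finally show ?thesis ..
qed

lemma sum_moment_4:
  "(\<Sum>w\<in>rising n. (height_sum w) ^ 4 + 12 * (height_sum w)\<^sup>2 * (c * height_square_sum w)
      + 12 * (c * height_square_sum w)\<^sup>2) =
     (central * closed_poly4 (fps_const c) pole) $ (2 * n)"
proof -
  have "(central * closed_poly4 (fps_const c) pole) $ (2 * n) = (\<Sum>w\<in>rising n. fact 4 * exp_weight (height_sum w) (c * height_square_sum w) $ 4)"
    unfolding nth_odd_eq_even[symmetric] closed_slice_4[symmetric] closed_slice_nth ..
  also have "\<dots> = (\<Sum>w\<in>rising n. (height_sum w) ^ 4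
      + 12 * (height_sum w)\<^sup>2 * (c * height_square_sum w)
      + 12 * (c * height_square_sum w)\<^sup>2)"
    using exp_weight_nth(5) by (simp add: fact_numeral)
  finally show ?thesis ..
qed

text \<open>The leading part of the size of the core that belongs to the walk. The moments at \<open>c = 0\<close> and
  \<open>c = - (2 n + 1)\<close> suffice for it: it is \<open>-1/8\<close> of the second moment expression at
  \<open>c = - (2 n + 1)\<close>, and \<open>192\<close> times its square is the fourth one there plus twice the fourth one
  at \<open>c = 0\<close>.\<close>

definition model_size :: "nat \<Rightarrow> bool list \<Rightarrow> real" where
  "model_size n w = (2 * real n + 1) * height_square_sum w / 4 - (height_sum w)\<^sup>2 / 8"

lemma ratio_limit: "(\<lambda>n. (2 * real n + 1) / real n) \<longlonglongrightarrow> 2"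
proof -
  have "(\<lambda>n. 2 + inverse (real n)) \<longlonglongrightarrow> 2 + 0"
    by (intro tendsto_intros lim_inverse_n)
  moreover have "eventually (\<lambda>n. 2 + inverse (real n) = (2 * real n + 1) / real n) at_top"
    using eventually_gt_at_top[of 0] by eventually_elim (simp add: field_simps)
  ultimately show ?thesis using Lim_transform_eventually by fastforce
qed

lemma height_sum_square_limit: "(\<lambda>n. (\<Sum>w\<in>rising n. (height_sum w)\<^sup>2) / (4 ^ n * real n ^ 3)) \<longlonglongrightarrow> 3/2"
proof -
  obtain A0 A1 where A: "\<And>C. central * closed_poly2 C pole = A0
      + C * A1" "lead 4 A0 (3/2)" "lead 3 A1 2"
    using central_closed_poly2 by blast
  have "(\<Sum>w\<in>rising n. (height_sum w)\<^sup>2) = A0 $ (2 * n)" for n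
    using sum_moment_2[where c = 0 and n = n] by (simp add: A(1))
  thus ?thesis using A(2) by (simp add: lead_def)
qed

lemma model_size_limit: "(\<lambda>n. (\<Sum>w\<in>rising n. model_size n w) / (4 ^ n * real n ^ 3)) \<longlonglongrightarrow> 5/16"
proof -
  obtain A0 A1 where A: "\<And>C. central * closed_poly2 C pole = A0
      + C * A1" "lead 4 A0 (3/2)" "lead 3 A1 2"
    using central_closed_poly2 by blast
  define a0 where "a0 n = A0 $ (2 * n) / (4 ^ n * real n ^ 3)" for n
  define a1 where "a1 n = A1 $ (2 * n) / (4 ^ n * real n ^ 2)" for n
  have lim: "a0 \<longlonglongrightarrow> 3/2" "a1 \<longlonglongrightarrow> 2"
    using A(2,3) by (simp_all add: lead_def a0_def[abs_def] a1_def[abs_def])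
  have sum_Y: "(\<Sum>w\<in>rising n. model_size n w) = - (A0 $ (2 * n) - (2 * real n
      + 1) * A1 $ (2 * n)) / 8" for n
  proof -
    have "(\<Sum>w\<in>rising n. model_size n w) =
       - (\<Sum>w\<in>rising n. (height_sum w)\<^sup>2 + 2 * ((- (2 * real n
           + 1)) * height_square_sum w)) / 8"
      unfolding sum_negf[symmetric] sum_divide_distrib
      by (intro sum.cong) (simp_all add: model_size_def field_simps)
    thus ?thesis unfolding sum_moment_2 A(1) by (simp add: algebra_simps)
  qed
  have "(\<lambda>n. - (a0 n - (2 * real n
      + 1) / real n * a1 n) / 8) \<longlonglongrightarrow> - (3/2 - 2 * 2) / 8"
    by (intro tendsto_intros lim ratio_limit) simp
  moreover have "eventually (\<lambda>n. - (a0 n - (2 * real n + 1) / real n * a1 n) / 8 =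
      (\<Sum>w\<in>rising n. model_size n w) / (4 ^ n * real n ^ 3)) at_top"
    using eventually_gt_at_top[of 0]
    by eventually_elim (simp add: a0_def a1_def sum_Y field_simps power3_eq_cube power2_eq_square)
  ultimately show ?thesis using Lim_transform_eventually by fastforce
qed

lemma model_size_square_limit:
  "(\<lambda>n. (\<Sum>w\<in>rising n. (model_size n w)\<^sup>2) / (4 ^ n * real n ^ 6)) \<longlonglongrightarrow> 1217/7680"
proof -
  obtain A0 A1 A2 where A: "\<And>C. central * closed_poly4 C pole = A0 + C * A1 + C\<^sup>2 * A2"
    "lead 7 A0 (159/40)" "lead 6 A1 (123/4)" "lead 5 A2 20"
    using central_closed_poly4 by blast
  define a0 where "a0 n = A0 $ (2 * n) / (4 ^ n * real n ^ 6)" for n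
  define a1 where "a1 n = A1 $ (2 * n) / (4 ^ n * real n ^ 5)" for n
  define a2 where "a2 n = A2 $ (2 * n) / (4 ^ n * real n ^ 4)" for n
  have lim: "a0 \<longlonglongrightarrow> 159/40" "a1 \<longlonglongrightarrow> 123/4" "a2 \<longlonglongrightarrow> 20"
    using A(2-4) by (simp_all add: lead_def a0_def[abs_def] a1_def[abs_def] a2_def[abs_def])
  have sum_Y: "(\<Sum>w\<in>rising n. (model_size n w)\<^sup>2) =
      (3 * A0 $ (2 * n) - (2 * real n + 1) * A1 $ (2 * n) + (2 * real n
          + 1)\<^sup>2 * A2 $ (2 * n)) / 192" for n
  proof -
    define L where "L = 2 * real n + 1"
    define m where "m c w = (height_sum w) ^ 4 + 12 * (height_sum w)\<^sup>2 * (c * height_square_sum w)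
        + 12 * (c * height_square_sum w)\<^sup>2" for c w
    have "(model_size n w)\<^sup>2 = (m (- L) w + 2 * m 0 w) / 192" for w
      unfolding model_size_def m_def L_def[symmetric] by (simp add: power2_eq_square power4_eq_xxxx
          field_simps)
    hence eq: "(\<Sum>w\<in>rising n. (model_size n w)\<^sup>2) = ((\<Sum>w\<in>rising n. m (- L) w)
        + 2 * (\<Sum>w\<in>rising n. m 0 w)) / 192"
      by (simp only: sum.distrib sum_distrib_left sum_divide_distrib[symmetric])
    have sm: "(\<Sum>w\<in>rising n. m c w) = A0 $ (2 * n) + c * A1 $ (2 * n)
        + c\<^sup>2 * A2 $ (2 * n)" for c
      unfolding m_def sum_moment_4 A(1) by (simp add: fps_const_power)
    show ?thesis unfolding eq sm L_def[symmetric] by (simp add: algebra_simps)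
  qed
  have "(\<lambda>n. (3 * a0 n - (2 * real n + 1) / real n * a1 n + ((2 * real n
      + 1) / real n)\<^sup>2 * a2 n) / 192)
     \<longlonglongrightarrow> (3 * (159/40) - 2 * (123/4) + 2\<^sup>2 * 20) / 192"
    by (intro tendsto_intros lim ratio_limit) simp
  moreover have "(3 * a0 n - (2 * real n + 1) / real n * a1 n + ((2 * real n
      + 1) / real n)\<^sup>2 * a2 n) / 192 =
      (\<Sum>w\<in>rising n. (model_size n w)\<^sup>2) / (4 ^ n * real n ^ 6)" if "n > 0" for n
  proof -
    define Q where "Q = (4::real) ^ n * real n ^ 6"
    have "Q > 0" using that by (simp add: Q_def)
    have "a0 n = A0 $ (2 * n) / Q" "a1 n = real n * A1 $ (2 * n) / Q"
      "a2 n = (real n)\<^sup>2 * A2 $ (2 * n) / Q"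
      using that by (simp_all add: a0_def a1_def a2_def Q_def field_simps eval_nat_numeral)
    moreover define M where "M = 2 * real n + 1"
    have e: "M / real n * (real n * x / Q) = M * x / Q"
      "(M / real n)\<^sup>2 * ((real n)\<^sup>2 * x / Q) = M\<^sup>2 * x / Q" for x
      using that by (simp_all add: power_divide)
    have "(\<Sum>w\<in>rising n. (model_size n w)\<^sup>2) / Q = (3 * (A0 $ (2 * n) / Q) -
        (2 * real n + 1) / real n * (real n * A1 $ (2 * n) / Q) +
        ((2 * real n + 1) / real n)\<^sup>2 * ((real n)\<^sup>2 * A2 $ (2 * n) / Q)) / 192"
      unfolding sum_Y M_def[symmetric] e by (simp add: add_divide_distrib diff_divide_distrib)
    ultimately show ?thesis by (simp only: Q_def[symmetric])
  qed
  hence "eventually (\<lambda>n. (3 * a0 n - (2 * real n + 1) / real n * a1 n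
       + ((2 * real n + 1) / real n)\<^sup>2 * a2 n) / 192 =
      (\<Sum>w\<in>rising n. (model_size n w)\<^sup>2) / (4 ^ n * real n ^ 6)) at_top"
    using eventually_gt_at_top[of 0] by (rule eventually_mono[rotated])
  ultimately show ?thesis using Lim_transform_eventually by fastforce
qed

section \<open>Height sequences read off from walks\<close>

text \<open>Follows a walk from \<open>s\<close> and records a value at each step that leads away from the origin: the new
  position for a step up, the old position for a step down. So positive values stand for even and
  nonpositive ones for odd residues, and the steps towards the origin encode how far the height
  falls between two recorded values. At the origin every step leads away.\<close>

fun emit :: "int \<Rightarrow> bool list \<Rightarrow> int list" where
  "emit s [] = []"
| "emit s (True # w) = (if s \<ge> 0 then (s + 1) # emit (s + 1) w else emit (s + 1) w)"
| "emit s (False # w) = (if s \<le> 0 then s # emit (s - 1) w else emit (s - 1) w)"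

text \<open>Consecutive signed heights of a core: a height grows by at most one, and an even column
  (\<open>y > 0\<close>) forbids an odd one directly after it, while an odd column may be followed by an even one.\<close>

definition follows :: "int \<Rightarrow> int \<Rightarrow> bool" where
  "follows y z \<longleftrightarrow> (if y > 0 then 0 \<le> z \<and> z \<le> y
      + 1 else y - 1 \<le> z \<and> z \<le> 1)"

fun chain :: "int \<Rightarrow> int list \<Rightarrow> bool" where
  "chain y [] = True"
| "chain y (z # zs) = (follows y z \<and> chain z zs)"

text \<open>The position of the walk right after it has recorded \<open>y\<close>.\<close>

definition after :: "int \<Rightarrow> int" where
  "after y = (if y > 0 then y else y - 1)"

text \<open>The values that can be recorded next from position \<open>s\<close>.\<close>

definition reach :: "int \<Rightarrow> int \<Rightarrow> bool" where
  "reach s z \<longleftrightarrow> (if s > 0 then 0 \<le> z \<and> z \<le> s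
      + 1 else if s < 0 then s \<le> z \<and> z \<le> 1 else 0 \<le> z \<and> z \<le> 1)"

lemma follows_iff_reach: "follows y z \<longleftrightarrow> reach (after y) z"
  by (auto simp: follows_def reach_def after_def)

lemma emit_append: "emit s (v @ w) = emit s v @ emit (s + disp v) w"
proof (induction v arbitrary: s)
  case (Cons b v)
  show ?case by (cases b) (auto simp: Cons.IH algebra_simps)
qed simp

lemma emit_reach: "emit s w = z # zs \<Longrightarrow> reach s z \<and> chain z zs"
proof (induction w arbitrary: s z zs)
  case (Cons b w)
  have step: "reach t y \<and> chain y ys" if "emit t w = y # ys" for t y ys
    using Cons.IH that by blast
  have tail: "chain z zs" if "emit (after z) w = zs"
    using that step[of "after z"] by (cases zs) (auto simp: follows_iff_reach)
  show ?case
  proof (cases b)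
    case True
    show ?thesis
    proof (cases "s \<ge> 0")
      case True
      with Cons.prems \<open>b\<close> have "z = s + 1" "zs = emit (s + 1) w" by auto
      thus ?thesis using True tail by (auto simp: reach_def after_def)
    next
      case False
      with Cons.prems \<open>b\<close> have "emit (s + 1) w = z # zs" by simp
      from step[OF this] False show ?thesis by (auto simp: reach_def split: if_splits)
    qed
  next
    case False
    hence b: "\<not> b" .
    show ?thesis
    proof (cases "s \<le> 0")
      case True
      with Cons.prems b have "z = s" "zs = emit (s - 1) w" by auto
      thus ?thesis using True tail by (auto simp: reach_def after_def)
    next
      case False
      with Cons.prems b have "emit (s - 1) w = z # zs" by simp
      from step[OF this] False show ?thesis by (auto simp: reach_def split: if_splits)
    qed
  qed
qed simp

text \<open>At the first difference one walk moves away from the origin and records \<open>s\<close> or \<open>s + 1\<close>, which the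
  other one cannot record as its next value.\<close>

lemma emit_inj: "length v = length w \<Longrightarrow> emit s v = emit s w \<Longrightarrow> v = w"
proof (induction v w arbitrary: s rule: list_induct2)
  case (Cons b v c w)
  show ?case
  proof (cases "b = c")
    case True
    thus ?thesis using Cons by (cases c) (auto split: if_splits)
  next
    case False
    have no: False if "emit s (True # x) = emit s (False # y)" for x y
    proof (cases "s = 0")
      case True
      thus ?thesis using that by simp
    next
      case s: False
      show ?thesis
      proof (cases "s > 0")
        case True
        hence "emit (s - 1) y = (s + 1) # emit (s + 1) x" using that by simp
        from emit_reach[OF this] True show ?thesis by (auto simp: reach_def split: if_splits)
      next
        case False
        hence "emit (s + 1) x = s # emit (s - 1) y" using that s by simp
        from emit_reach[OF this] False s show ?thesis by (auto simp: reach_def split: if_splits)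
      qed
    qed
    show ?thesis using False Cons.prems no[of v w] no[of w v] by (cases b; cases c) auto
  qed
qed simp

text \<open>Steps away from the origin raise the absolute position by one, all others lower it by one.\<close>

lemma length_emit:
  "2 * int (length (emit s w)) = int (length w) + \<bar>s + disp w\<bar> - \<bar>s\<bar>"
proof (induction w arbitrary: s)
  case (Cons b w)
  show ?case using Cons.IH[of "s + step b"] by (cases b) (auto simp: algebra_simps)
qed simp

lemma last_emit_nonpos:
  "emit s w \<noteq> [] \<Longrightarrow> s + disp w < 0 \<Longrightarrow> last (emit s w) \<le> 0"
proof (induction w rule: rev_induct)
  case (snoc b w)
  show ?case using snoc by (cases b) (auto simp: emit_append split: if_splits)
qed simp

lemma disp_replicate: "disp (replicate k b) = int k * step b"
  by (induction k) (auto simp: algebra_simps)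

lemma emit_down: "int k \<le> s \<Longrightarrow> emit s (replicate k False @ w) = emit (s - int k) w"
  by (induction k arbitrary: s) (auto simp: algebra_simps)

lemma emit_up: "int k \<le> - s \<Longrightarrow> emit s (replicate k True @ w) = emit (s + int k) w"
  by (induction k arbitrary: s) (auto simp: algebra_simps)

lemma emit_single:
  assumes "reach s z"
  obtains v where "\<And>w. emit s (v @ (z > 0) # w) = z # emit (after z) w"
    "s + disp (v @ [z > 0]) = after z"
proof -
  consider "z > 0" "s \<ge> 0" | "z > 0" "s < 0" | "z \<le> 0" "s > 0" | "z \<le> 0" "s \<le> 0" by linarith
  thus ?thesis
  proof cases
    case 1
    define k where "k = nat (s - z + 1)"
    have k: "int k = s - z + 1" using 1 assms by (auto simp: k_def reach_def split: if_splits)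
    show ?thesis
      by (rule that[of "replicate k False"]) (use 1 k in \<open>auto simp: emit_down after_def disp_replicate\<close>)
  next
    case 2
    define k where "k = nat (- s)"
    have k: "int k = - s" "z = 1" using 2 assms by (auto simp: k_def reach_def split: if_splits)
    show ?thesis
      by (rule that[of "replicate k True"]) (use 2 k in \<open>auto simp: emit_up after_def disp_replicate\<close>)
  next
    case 3
    define k where "k = nat s"
    have k: "int k = s" "z = 0" using 3 assms by (auto simp: k_def reach_def split: if_splits)
    show ?thesis
      by (rule that[of "replicate k False"]) (use 3 k in \<open>auto simp: emit_down after_def disp_replicate\<close>)
  next
    case 4
    define k where "k = nat (z - s)"
    have k: "int k = z - s" using 4 assms by (auto simp: k_def reach_def split: if_splits)
    show ?thesis
      by (rule that[of "replicate k True"]) (use 4 k in \<open>auto simp: emit_up after_def disp_replicate\<close>)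
  qed
qed

lemma emit_exists:
  assumes "reach s z" "chain z zs"
  shows "\<exists>v. emit s (v @ [last (z # zs) > 0]) = z # zs \<and>
             s + disp (v @ [last (z # zs) > 0]) = after (last (z # zs))"
  using assms
proof (induction zs arbitrary: s z)
  case Nil
  obtain v where "\<And>w. emit s (v @ (z > 0) # w) = z # emit (after z) w" "s
      + disp (v @ [z > 0]) = after z"
    using emit_single[OF Nil(1)] by blast
  thus ?case by (intro exI[of _ v]) auto
next
  case (Cons y ys)
  obtain v where v: "\<And>w. emit s (v @ (z > 0) # w) = z # emit (after z) w" "s
      + disp (v @ [z > 0]) = after z"
    using emit_single[OF Cons.prems(1)] by blast
  have "reach (after z) y" "chain y ys"
    using Cons.prems by (auto simp: follows_iff_reach)
  from Cons.IH[OF this] obtain x where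
    "emit (after z) (x @ [last (y # ys) > 0]) = y # ys"
    "after z + disp (x @ [last (y # ys) > 0]) = after (last (y # ys))" by blast
  thus ?case using v by (intro exI[of _ "v @ (z > 0) # x"]) (simp add: add.assoc)
qed

text \<open>The columns form a cycle: the height of residue \<open>1\<close> is bounded by that of residue \<open>2 n\<close> plus two. A
  virtual predecessor \<open>- (max (last ys) 0 + 1)\<close> of the first entry expresses this as an ordinary step.\<close>

definition signed_heights :: "nat \<Rightarrow> int list set" where
  "signed_heights n = {ys. length ys = n \<and> chain (- (max (last ys) 0 + 1)) ys}"

text \<open>The walk is started two below \<open>start w\<close>, since the heights are measured from a point that differs from
  the mirror by \<open>3/2\<close>. The extra final step makes the walk record the last even column.\<close>

definition heights :: "bool list \<Rightarrow> int list" where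
  "heights w = emit (start w - 2) (w @ [True])"

lemma rising_start:
  assumes "w \<in> rising n"
  obtains p where "p \<ge> -1" "disp w = 2 * p + 3" "start w = - p - 1" "p + 2 \<le> int n + 1"
proof -
  have w: "length w = 2 * n + 1" "disp w > 0" using assms by (auto simp: rising_def walks_def)
  obtain d where d: "disp w = 2 * d + 1" using odd_disp[of w] w by (auto elim: oddE)
  have "start w = - d" unfolding start_def d by presburger
  thus ?thesis using that[of "d - 1"] d w abs_disp_le[of w] by auto
qed

text \<open>The value \<open>max (last ys) 0\<close> determines the starting point, after which injectivity of the scan
  applies. Conversely a height sequence is realised by a walk, padded by steps up that stay below
  the origin if its last entry is not positive; its length is then forced.\<close>

lemma heights_bij:
  assumes "n > 0"
  shows "bij_betw heights (rising n) (signed_heights n)"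
proof -
  have facts: "length (heights w) = n \<and> max (last (heights w)) 0 = - start w \<and>
      chain (- (max (last (heights w)) 0 + 1)) (heights w)" if w: "w \<in> rising n" for w
  proof -
    obtain p where p: "p \<ge> -1" "disp w = 2 * p + 3" "start w = - p - 1"
      using rising_start[OF w] by blast
    have len: "length w = 2 * n + 1" using w by (simp add: rising_def walks_def)
    have "2 * int (length (heights w)) = 2 * int n"
      unfolding heights_def length_emit using p len by simp
    hence l: "length (heights w) = n" by simp
    have last: "max (last (heights w)) 0 = p + 1"
    proof (cases "p = -1")
      case True
      hence "heights w = emit (start w - 2) w"
        using p by (simp add: heights_def emit_append)
      moreover have "last (emit (start w - 2) w) \<le> 0"
        using l assms calculation True p by (intro last_emit_nonpos) auto
      ultimately show ?thesis using True by simp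
    next
      case False
      thus ?thesis using p by (simp add: heights_def emit_append)
    qed
    obtain z zs where z: "heights w = z # zs" using l assms by (cases "heights w") auto
    have "reach (start w - 2) z \<and> chain z zs"
      using emit_reach z unfolding heights_def by blast
    hence "chain (- (p + 2)) (heights w)"
      using p by (simp add: z follows_iff_reach after_def)
    moreover have "- (max (last (heights w)) 0 + 1) = - (p + 2)" using last by simp
    ultimately have "chain (- (max (last (heights w)) 0 + 1)) (heights w)" by (simp only:)
    moreover have "max (last (heights w)) 0 = - start w" using last p by simp
    ultimately show ?thesis using l by blast
  qed
  show ?thesis
    unfolding bij_betw_def
  proof (intro conjI subset_antisym subsetI inj_onI)
    fix v w assume vw: "v \<in> rising n" "w \<in> rising n" "heights v = heights w"
    hence "start v = start w" using facts[OF vw(1)] facts[OF vw(2)] by simp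
    hence "v @ [True] = w @ [True]"
      using vw by (intro emit_inj[where s = "start v - 2"]) (auto simp: heights_def rising_def walks_def)
    thus "v = w" by simp
  next
    fix ys assume "ys \<in> heights ` rising n"
    thus "ys \<in> signed_heights n" using facts by (auto simp: signed_heights_def)
  next
    fix ys assume "ys \<in> signed_heights n"
    hence ys: "length ys = n" "chain (- (max (last ys) 0 + 1)) ys" by (auto simp: signed_heights_def)
    define p where "p = max (last ys) 0 - 1"
    define s where "s = - (p + 3)"
    obtain z zs where z: "ys = z # zs" using ys(1) assms by (cases ys) auto
    have p: "p \<ge> -1" by (simp add: p_def)
    have "reach s z" "chain z zs"
      using ys(2) p by (auto simp: z follows_iff_reach after_def s_def p_def split: if_splits)
    from emit_exists[OF this] obtain v where
      v: "emit s (v @ [last ys > 0]) = ys" "s + disp (v @ [last ys > 0]) = after (last ys)"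
      unfolding z by blast
    obtain w where w: "emit s (w @ [True]) = ys" "s + disp w = p"
    proof (cases "last ys > 0")
      case True
      thus ?thesis using v by (intro that[of v]) (auto simp: after_def p_def)
    next
      case False
      define k where "k = nat (- last ys)"
      have "replicate k True @ [True] = replicate (Suc k) True @ []"
        by (simp add: replicate_append_same)
      hence "emit (s + disp (v @ [False])) (replicate k True @ [True]) = []"
        using v(2) False by (simp only:) (subst emit_up; simp add: after_def k_def)
      hence "emit s ((v @ [False]) @ (replicate k True @ [True])) = ys"
        unfolding emit_append[of s "v @ [False]"] using v(1) False by simp
      moreover have "s + disp (v @ [False] @ replicate k True) = p"
        using v(2) False by (simp add: after_def p_def k_def disp_replicate)
      ultimately show ?thesis by (intro that[of "v @ [False] @ replicate k True"]) simp_all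
    qed
    have "2 * int (length ys) = int (length (w @ [True])) + \<bar>s
        + disp (w @ [True])\<bar> - \<bar>s\<bar>"
      unfolding w(1)[symmetric] by (rule length_emit)
    hence len: "length w = 2 * n + 1" using w(2) ys(1) p by (simp add: s_def)
    have disp: "disp w = 2 * p + 3" using w(2) by (simp add: s_def)
    have st: "start w = s + 2" unfolding start_def disp s_def by presburger
    have "w \<in> rising n" using len disp p by (auto simp: rising_def walks_def)
    moreover have "heights w = ys" using w(1) st by (simp add: heights_def)
    ultimately show "ys \<in> heights ` rising n" by blast
  qed
qed

section \<open>Beta sets of partitions\<close>

definition beta :: "nat list \<Rightarrow> nat set" where
  "beta xs = (\<lambda>i. part xs i + length xs - i) ` {1..length xs}"

lemma partitions_part_pos: "xs \<in> partitions \<Longrightarrow> i \<in> {1..length xs} \<Longrightarrow> part xs i > 0"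
  by (auto simp: partitions_def part_def)

lemma partitions_part_mono:
  assumes "xs \<in> partitions" "1 \<le> i" "i \<le> j" "j \<le> length xs"
  shows "part xs j \<le> part xs i"
proof (cases "i = j")
  case False
  have "sorted_wrt (\<ge>) xs" using assms(1) by (simp add: partitions_def)
  hence "xs ! (i - 1) \<ge> xs ! (j - 1)"
    using assms False by (intro sorted_wrt_nth_less[of "(\<ge>)"]) auto
  thus ?thesis by (simp add: part_def)
qed simp

lemma beta_strict_antimono:
  assumes "xs \<in> partitions" "1 \<le> i" "i < j" "j \<le> length xs"
  shows "part xs j + length xs - j < part xs i + length xs - i"
  using partitions_part_mono[of xs i j] assms by simp

lemma beta_inj: "xs \<in> partitions \<Longrightarrow> inj_on (\<lambda>i. part xs i
    + length xs - i) {1..length xs}"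
proof (rule inj_onI)
  fix i j assume A: "xs \<in> partitions" "i \<in> {1..length xs}" "j \<in> {1..length xs}"
    "part xs i + length xs - i = part xs j + length xs - j"
  thus "i = j"
    using beta_strict_antimono[OF A(1), of i j] beta_strict_antimono[OF A(1), of j i]
    by (metis atLeastAtMost_iff less_irrefl linorder_neqE_nat)
qed

lemma card_beta: "xs \<in> partitions \<Longrightarrow> card (beta xs) = length xs"
  using card_image[OF beta_inj] by (simp add: beta_def)

lemma finite_beta [simp]: "finite (beta xs)"
  by (simp add: beta_def)

lemma beta_pos: "xs \<in> partitions \<Longrightarrow> 0 \<notin> beta xs"
  using partitions_part_pos[of xs] by (force simp: beta_def)

lemma sum_beta:
  assumes "xs \<in> partitions"
  shows "2 * (\<Sum>b\<in>beta xs. int b) = 2 * int (size_of xs)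
      + int (length xs) * (int (length xs) - 1)"
proof -
  have "(\<Sum>b\<in>beta xs. int b) = (\<Sum>i\<in>{1..length xs}. int (part xs i + length xs - i))"
    unfolding beta_def sum.reindex[OF beta_inj[OF assms]] by (simp add: comp_def)
  also have "\<dots> = (\<Sum>i\<in>{1..length xs}. int (part xs i) + (int (length xs) - int i))"
    by (intro sum.cong) (auto simp: of_nat_diff)
  also have "\<dots> = (\<Sum>i\<in>{1..length xs}. int (part xs i))
      + (\<Sum>i\<in>{1..length xs}. int (length xs) - int i)"
    by (rule sum.distrib)
  also have "(\<Sum>i\<in>{1..length xs}. int (part xs i)) = int (size_of xs)"
    unfolding size_of_def part_def sum_list_sum_nth
    by (simp add: sum.atLeast1_atMost_eq atLeast0LessThan)
  finally have "(\<Sum>b\<in>beta xs. int b) = int (size_of xs)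
      + (\<Sum>i\<in>{1..length xs}. int (length xs) - int i)" .
  moreover have "2 * (\<Sum>i\<in>{1..k}. int k - int i) = int k * (int k - 1)" for k :: nat
  proof -
    have "(\<Sum>i\<in>{1..k}. int k - int i) = (\<Sum>i<k. int i)"
      by (rule sum.reindex_bij_witness[of _ "\<lambda>i. k - i" "\<lambda>i. k - i"]) auto
    also have "2 * (\<Sum>i<k. int i) = int k * (int k - 1)"
      by (induction k) (auto simp: algebra_simps)
    finally show ?thesis .
  qed
  ultimately show ?thesis by (simp only: distrib_left)
qed

lemma conj_part_iff:
  assumes "xs \<in> partitions" "i \<in> {1..length xs}"
  shows "j \<le> part xs i \<longleftrightarrow> i \<le> conj_part xs j"
proof -
  define D where "D = {i \<in> {1..length xs}. j \<le> part xs i}"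
  have fin: "finite D" by (simp add: D_def)
  show ?thesis
  proof
    assume "j \<le> part xs i"
    hence "{1..i} \<subseteq> D" using partitions_part_mono[OF assms(1)] assms(2)
      by (auto simp: D_def intro: order_trans)
    from card_mono[OF fin this] show "i \<le> conj_part xs j" by (simp add: conj_part_def D_def)
  next
    assume i: "i \<le> conj_part xs j"
    show "j \<le> part xs i"
    proof (rule ccontr)
      assume "\<not> j \<le> part xs i"
      hence "D \<subseteq> {1..<i}" using partitions_part_mono[OF assms(1), of i] assms(2)
        by (force simp: D_def not_le)
      from card_mono[OF _ this] have "card D \<le> i - 1" by simp
      moreover have "1 \<le> i" using assms(2) by simp
      ultimately have "card D < i" by linarith
      thus False using i by (simp add: conj_part_def D_def)
    qed
  qed
qed

lemma conj_part_le: "conj_part xs j \<le> length xs"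
proof -
  have "card {i \<in> {1..length xs}. j \<le> part xs i} \<le> card {1..length xs}"
    by (intro card_mono) auto
  thus ?thesis by (simp add: conj_part_def)
qed

definition closed_under :: "nat \<Rightarrow> nat set \<Rightarrow> bool" where
  "closed_under r B \<longleftrightarrow> (\<forall>b\<in>B. r \<le> b \<longrightarrow> b - r \<in> B)"

text \<open>For a cell in column \<open>j\<close>, the rows that reach column \<open>j\<close> have beta numbers above
  \<open>x = j - 1 + (k - conj_part xs j)\<close>, where \<open>k\<close> is the number of parts, the other rows have beta numbers
  below, and the hook length is the beta number of the row minus \<open>x\<close>.\<close>

lemma hook_not_in_beta:
  assumes "xs \<in> partitions" "(i, j) \<in> cells xs"
  shows "j - 1 + (length xs - conj_part xs j) \<notin> beta xs"
    "hook_length xs (i, j) = int (part xs i + length xs - i) - int (j - 1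
        + (length xs - conj_part xs j))"
proof -
  have ij: "i \<in> {1..length xs}" "1 \<le> j" using assms(2) by (auto simp: cells_def)
  show "j - 1 + (length xs - conj_part xs j) \<notin> beta xs"
  proof
    assume "j - 1 + (length xs - conj_part xs j) \<in> beta xs"
    then obtain r where r: "r \<in> {1..length xs}"
      "j - 1 + (length xs - conj_part xs j) = part xs r + length xs - r"
      by (auto simp: beta_def)
    show False using conj_part_iff[OF assms(1) r(1), of j] conj_part_le[of xs j] r ij(2)
      by (cases "r \<le> conj_part xs j") auto
  qed
  show "hook_length xs (i, j) = int (part xs i + length xs - i) - int (j - 1
      + (length xs - conj_part xs j))"
    using ij conj_part_le[of xs j] by (auto simp: hook_length_def of_nat_diff)
qed

text \<open>Conversely a number \<open>x\<close> that is missing from the beta set belongs to the column whose height is the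
  number of beta numbers above \<open>x\<close>.\<close>

lemma hook_exists:
  assumes xs: "xs \<in> partitions" and i: "i \<in> {1..length xs}"
    and x: "x < part xs i + length xs - i" "x \<notin> beta xs"
  obtains j where "(i, j) \<in> cells xs" "hook_length xs (i, j) = int (part xs i
      + length xs - i) - int x"
proof -
  define k where "k = length xs"
  define h where "h r = part xs r + k - r" for r
  define D where "D = {r \<in> {1..k}. x < h r}"
  define c where "c = card D"
  have h_in: "h r \<in> beta xs" if "r \<in> {1..k}" for r
    using that by (auto simp: beta_def h_def k_def)
  have anti: "h b < h a" if "1 \<le> a" "a < b" "b \<le> k" for a b
    using beta_strict_antimono[OF xs that(1,2)] that(3) by (simp add: h_def k_def)
  have D_iff: "x < h r \<longleftrightarrow> r \<le> c" if r: "r \<in> {1..k}" for r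
  proof
    assume "x < h r"
    hence "{1..r} \<subseteq> D" using r anti
      by (auto simp: D_def) (metis le_neq_implies_less less_trans)
    from card_mono[OF _ this] show "r \<le> c" by (simp add: c_def D_def)
  next
    assume "r \<le> c"
    show "x < h r"
    proof (rule ccontr)
      assume "\<not> x < h r"
      hence "D \<subseteq> {1..<r}" using r anti
        by (auto simp: D_def) (metis less_trans linorder_neqE_nat not_le)
      from card_mono[OF _ this] have "c \<le> r - 1" by (simp add: c_def)
      moreover have "1 \<le> r" using r by simp
      ultimately show False using \<open>r \<le> c\<close> by linarith
    qed
  qed
  have ck: "c \<le> k"
  proof -
    have "D \<subseteq> {1..k}" by (auto simp: D_def)
    from card_mono[OF _ this] show ?thesis by (simp add: c_def)
  qed
  have ic: "i \<le> c" using D_iff[of i] i x(1) by (simp add: h_def k_def)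
  have below: "h r < x" if "r \<in> {1..k}" "c < r" for r
    using D_iff[of r] that h_in[of r] x(2) by (metis leD linorder_neqE_nat)
  have xk: "k - c \<le> x"
  proof (cases "c = k")
    case False
    hence "h (c + 1) < x" using ck by (intro below) auto
    moreover have "part xs (c
        + 1) > 0" using False ck by (intro partitions_part_pos[OF xs]) (auto simp: k_def)
    ultimately show ?thesis using False ck by (simp add: h_def)
  qed simp
  \<comment> \<open>\<open>x\<close> is the \<open>j\<close>-th missing number, as \<open>k - c\<close> beta numbers lie below it\<close>
  define j where "j = x + 1 + c - k"
  have j: "j + k = x + 1 + c" "1 \<le> j" using xk ck by (auto simp: j_def)
  have part_iff: "j \<le> part xs r \<longleftrightarrow> r \<le> c" if r: "r \<in> {1..k}" for r
  proof
    assume jr: "j \<le> part xs r"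
    show "r \<le> c"
    proof (rule ccontr)
      assume "\<not> r \<le> c"
      hence c1: "c + 1 \<in> {1..k}" "c + 1 \<le> r" using r by auto
      have "h (c + 1) < x" using c1 by (intro below) auto
      moreover have "part xs r \<le> part xs (c + 1)"
        using c1 r by (intro partitions_part_mono[OF xs]) (auto simp: k_def)
      ultimately show False using j jr c1 by (simp add: h_def)
    qed
  next
    assume rc: "r \<le> c"
    have c1: "c \<in> {1..k}" using rc r ck by auto
    have "x < h c" using D_iff[OF c1] by simp
    moreover have "part xs c \<le> part xs r"
      using c1 r rc by (intro partitions_part_mono[OF xs]) (auto simp: k_def)
    ultimately show "j \<le> part xs r" using j c1 by (simp add: h_def)
  qed
  have "{r \<in> {1..length xs}. j \<le> part xs r} = {1..c}"
    using part_iff ck by (auto simp: k_def)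
  hence conj: "conj_part xs j = c" by (simp add: conj_part_def)
  show ?thesis
  proof (rule that[of j])
    show "(i, j) \<in> cells xs" using i ic j part_iff[of i] by (auto simp: cells_def k_def)
    show "hook_length xs (i, j) = int (part xs i + length xs - i) - int x"
      using i j conj by (simp add: hook_length_def k_def of_nat_diff)
  qed
qed

text \<open>The classical criterion for cores in terms of beta sets.\<close>

lemma hooks_avoid_iff:
  assumes xs: "xs \<in> partitions" and r: "r > 0"
  shows "(\<forall>c\<in>cells xs. hook_length xs c \<noteq> int r) \<longleftrightarrow> closed_under r (beta xs)"
proof
  assume L: "\<forall>c\<in>cells xs. hook_length xs c \<noteq> int r"
  show "closed_under r (beta xs)"
    unfolding closed_under_def
  proof (intro ballI impI)
    fix b assume b: "b \<in> beta xs" "r \<le> b"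
    then obtain i where i: "i \<in> {1..length xs}" "b = part xs i + length xs - i"
      by (auto simp: beta_def)
    show "b - r \<in> beta xs"
    proof (rule ccontr)
      assume "b - r \<notin> beta xs"
      moreover have "b - r < part xs i + length xs - i" using b r i by simp
      ultimately obtain j where "(i, j) \<in> cells xs"
        "hook_length xs (i, j) = int (part xs i + length xs - i) - int (b - r)"
        using hook_exists[OF xs i(1)] by metis
      thus False using L i b by (auto simp: of_nat_diff)
    qed
  qed
next
  assume R: "closed_under r (beta xs)"
  show "\<forall>c\<in>cells xs. hook_length xs c \<noteq> int r"
  proof (intro ballI notI)
    fix c assume c: "c \<in> cells xs" "hook_length xs c = int r"
    obtain i j where ij: "c = (i, j)" by (cases c)
    define b where "b = part xs i + length xs - i"
    define x where "x = j - 1 + (length xs - conj_part xs j)"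
    have "x \<notin> beta xs" "int r = int b - int x"
      using hook_not_in_beta[OF xs c(1)[unfolded ij]] c(2) by (auto simp: ij b_def x_def)
    moreover have "b \<in> beta xs"
      using c(1) by (auto simp: ij cells_def beta_def b_def)
    moreover have "b - r = x" "r \<le> b" using \<open>int r = int b - int x\<close> by auto
    ultimately show False using R by (auto simp: closed_under_def)
  qed
qed

lemma distinct_iff_beta:
  assumes xs: "xs \<in> partitions"
  shows "distinct xs \<longleftrightarrow> (\<forall>b\<in>beta xs. Suc b \<notin> beta xs)"
proof
  assume d: "distinct xs"
  show "\<forall>b\<in>beta xs. Suc b \<notin> beta xs"
  proof (intro ballI notI)
    fix b assume "b \<in> beta xs" "Suc b \<in> beta xs"
    then obtain i j where ij: "i \<in> {1..length xs}" "j \<in> {1..length xs}"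
      "b = part xs j + length xs - j" "Suc b = part xs i + length xs - i"
      unfolding beta_def by auto
    have "i < j"
      using beta_strict_antimono[OF xs, of j i] ij by (cases i j rule: linorder_cases) auto
    moreover have "part xs i \<noteq> part xs j"
      using d ij \<open>i < j\<close> by (auto simp: part_def nth_eq_iff_index_eq)
    moreover have "part xs j \<le> part xs i"
      using ij \<open>i < j\<close> by (intro partitions_part_mono[OF xs]) auto
    ultimately show False using ij by auto
  qed
next
  assume R: "\<forall>b\<in>beta xs. Suc b \<notin> beta xs"
  have strict: "part xs (Suc i) < part xs i" if "1 \<le> i" "Suc i \<le> length xs" for i
  proof (rule ccontr)
    assume "\<not> part xs (Suc i) < part xs i"
    moreover have "part xs (Suc i) \<le> part xs i"
      using that by (intro partitions_part_mono[OF xs]) auto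
    ultimately have "Suc (part xs (Suc i) + length xs - Suc i) = part xs i + length xs - i"
      using that by simp
    moreover have "part xs (Suc i) + length xs - Suc i \<in> beta xs" "part xs i
        + length xs - i \<in> beta xs"
      unfolding beta_def using that by (auto intro!: imageI)
    ultimately show False using R by metis
  qed
  have "sorted_wrt (>) xs"
  proof (subst sorted_wrt_iff_nth_Suc_transp)
    show "\<forall>i. Suc i < length xs \<longrightarrow> xs ! i > xs ! Suc i"
      using strict[of "Suc _"] by (auto simp: part_def)
  qed (auto simp: transp_def)
  thus "distinct xs" by (induction xs) auto
qed

lemma beta_Cons: "beta (x # xs) = insert (x + length xs) (beta xs)"
proof -
  have "{1..length (x # xs)} = insert 1 (Suc ` {1..length xs})"
    by (auto simp: image_Suc_atLeastAtMost)
  hence "beta (x # xs) =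
      (\<lambda>i. part (x # xs) i + length (x # xs) - i) ` insert 1 (Suc ` {1..length xs})"
    by (simp only: beta_def)
  also have "\<dots> = insert (x + length xs)
      ((\<lambda>i. part (x # xs) (Suc i) + length (x # xs) - Suc i) ` {1..length xs})"
    by (simp only: image_insert image_image) (simp add: part_def)
  also have "(\<lambda>i. part (x # xs) (Suc i) + length (x # xs) - Suc i) ` {1..length xs} = beta xs"
    unfolding beta_def by (intro image_cong refl) (auto simp: part_def nth_Cons')
  finally show ?thesis .
qed

lemma partitions_Cons: "x # xs \<in> partitions \<longleftrightarrow> x > 0 \<and> xs \<in> partitions \<and> (\<forall>y\<in>set xs. y \<le> x)"
  by (auto simp: partitions_def)

lemma beta_less:
  assumes "x # xs \<in> partitions" "b \<in> beta xs"
  shows "b < x + length xs"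
proof -
  obtain i where i: "1 \<le> i" "i \<le> length xs" "b = part xs i + length xs - i"
    using assms(2) by (auto simp: beta_def)
  have "part xs i \<in> set xs" using i by (auto simp: part_def)
  hence "part xs i \<le> x" using assms(1) by (auto simp: partitions_Cons)
  thus ?thesis using i by linarith
qed

lemma beta_inj_on: "inj_on beta partitions"
proof (rule inj_onI)
  fix xs ys assume "xs \<in> partitions" "ys \<in> partitions" "beta xs = beta ys"
  thus "xs = ys"
  proof (induction xs arbitrary: ys)
    case Nil
    have "length ys = length ([] :: nat list)"
      using card_beta[OF Nil.prems(1)] card_beta[OF Nil.prems(2)] Nil.prems(3) by metis
    thus ?case by simp
  next
    case (Cons x xs)
    have len: "length ys = Suc (length xs)"
      using card_beta[OF Cons.prems(1)] card_beta[OF Cons.prems(2)] Cons.prems(3) by simp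
    then obtain y zs where y: "ys = y # zs" "length zs = length xs" by (cases ys) auto
    have Max: "Max (beta (a # as)) = a + length as" "a + length as \<notin> beta as"
      if "a # as \<in> partitions" for a as
    proof -
      show "Max (beta (a # as)) = a + length as"
        unfolding beta_Cons using beta_less[OF that] by (intro Max_eqI) (auto dest: less_imp_le)
      show "a + length as \<notin> beta as" using beta_less[OF that] by blast
    qed
    have "x = y" using Max(1)[OF Cons.prems(1)] Max(1)[of y zs] Cons.prems y by simp
    moreover have "beta xs = beta zs"
      using Max(2)[OF Cons.prems(1)] Max(2)[of y zs] Cons.prems y \<open>x = y\<close>
        beta_Cons[of x xs] beta_Cons[of y zs] by (metis insert_ident)
    ultimately show ?case using Cons y by (auto simp: partitions_Cons)
  qed
qed

text \<open>By removing the largest element, which becomes the first part.\<close>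

lemma beta_surj: "finite B \<Longrightarrow> 0 \<notin> B \<Longrightarrow> \<exists>xs\<in>partitions. beta xs = B"
proof (induction "card B" arbitrary: B)
  case 0
  thus ?case by (intro bexI[of _ "[]"]) (auto simp: beta_def partitions_def)
next
  case (Suc k)
  define m where "m = Max B"
  have m: "m \<in> B" "\<And>b. b \<in> B \<Longrightarrow> b \<le> m"
    using Suc by (auto simp: m_def intro!: Max_in)
  have "card (B - {m}) = k" using Suc m by simp
  then obtain xs where xs: "xs \<in> partitions" "beta xs = B - {m}"
    using Suc.hyps(1)[of "B - {m}"] Suc.prems by auto
  have len: "length xs = k" using card_beta[OF xs(1)] xs(2) \<open>card (B - {m}) = k\<close> by simp
  have bound: "y + k \<le> m" if "y \<in> set xs" for y
  proof -
    have ne: "xs \<noteq> []" using that by auto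
    have "y \<le> hd xs" using xs(1) that ne by (cases xs) (auto simp: partitions_def)
    moreover have "part xs 1 + length xs - 1 \<in> beta xs"
      unfolding beta_def using ne by (auto intro!: imageI simp: Suc_le_eq)
    hence "hd xs + k - 1 < m"
      using m(2) xs(2) len ne by (auto simp: part_def hd_conv_nth order.order_iff_strict)
    ultimately show ?thesis by simp
  qed
  have "k < m"
  proof (cases "xs = []")
    case True
    thus ?thesis using len m Suc.prems by (cases m) auto
  next
    case False
    then obtain y where "y \<in> set xs" by (cases xs) auto
    moreover have "y > 0" using xs(1) calculation by (auto simp: partitions_def)
    ultimately show ?thesis using bound by force
  qed
  moreover have "y \<le> m - k" if "y \<in> set xs" for y
    using bound[OF that] by linarith
  ultimately have P: "(m - k) # xs \<in> partitions"
    using xs(1) by (auto simp: partitions_Cons)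
  moreover have "beta ((m - k) # xs) = B"
    using beta_Cons \<open>k < m\<close> len xs(2) m by auto
  ultimately show ?case by blast
qed

section \<open>Core partitions as families of columns\<close>

text \<open>The height of the column of residue \<open>r\<close>, where entry \<open>k\<close> of the list describes the residues
  \<open>2 k + 1\<close> (negative entries) and \<open>2 k + 2\<close> (positive entries).\<close>

definition col :: "int list \<Rightarrow> nat \<Rightarrow> nat" where
  "col ys r = (if even r then nat (ys ! (r div 2 - 1)) else nat (- ys ! (r div 2)))"

text \<open>The beta set with \<open>c r\<close> elements in the residue class of \<open>r\<close>, filled from the bottom. Multiples of
  \<open>2 n + 1\<close> are absent from the beta set of a core, as otherwise \<open>0\<close> would be in it.\<close>

definition tower_set :: "nat \<Rightarrow> (nat \<Rightarrow> nat) \<Rightarrow> nat set" where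
  "tower_set n c = {x. x mod (2 * n + 1) \<noteq> 0 \<and> x div (2 * n + 1) < c (x mod (2 * n + 1))}"

text \<open>Subtracting \<open>2 n + 3\<close> moves one row down and two residues to the left, except that from residue \<open>1\<close> it
  leads two rows down to residue \<open>2 n\<close>, and from residue \<open>2\<close> to a multiple of \<open>2 n + 1\<close>.\<close>

definition cols_ok :: "nat \<Rightarrow> (nat \<Rightarrow> nat) \<Rightarrow> bool" where
  "cols_ok n c \<longleftrightarrow> (\<forall>r\<in>{3..2 * n}. c r \<le> c (r - 2)
      + 1) \<and> c 2 \<le> 1 \<and> c 1 \<le> c (2 * n) + 2 \<and>
     (\<forall>r\<in>{1..<2 * n}. c r = 0 \<or> c (r + 1) = 0)"

definition core_set :: "nat \<Rightarrow> nat set \<Rightarrow> bool" where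
  "core_set n B \<longleftrightarrow> finite B \<and> 0 \<notin> B \<and> closed_under (2 * n
      + 1) B \<and> closed_under (2 * n + 3) B \<and>
     (\<forall>b\<in>B. Suc b \<notin> B)"

lemma chain_iff:
  "chain y ys \<longleftrightarrow> (\<forall>k<length ys. follows (if k = 0 then y else ys ! (k - 1)) (ys ! k))"
proof (induction ys arbitrary: y)
  case (Cons z zs)
  show ?case unfolding chain.simps Cons.IH
    by (auto simp: All_less_Suc2 nth_Cons')
qed simp

lemma follows_iff:
  "follows y z \<longleftrightarrow> nat z \<le> nat y + 1 \<and> nat (- z) \<le> nat (- y)
      + 1 \<and> (y > 0 \<longrightarrow> z \<ge> 0)"
  by (auto simp: follows_def)

lemma signed_heights_iff:
  assumes n: "n > 0"
  shows "ys \<in> signed_heights n \<longleftrightarrow> length ys = n \<and> cols_ok n (col ys)"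
proof (cases "length ys = n")
  case len: True
  define F where "F k = follows (if k = 0 then - (max (last ys) 0
      + 1) else ys ! (k - 1)) (ys ! k)" for k
  have last: "last ys = ys ! (n - 1)" using len n by (subst last_conv_nth) auto
  have col_even: "col ys (2 * k + 2) = nat (ys ! k)" and col_odd: "col ys (2 * k
      + 1) = nat (- ys ! k)" for k
    by (simp_all add: col_def)
  have F0: "F 0 \<longleftrightarrow> col ys 2 \<le> 1 \<and> col ys 1 \<le> col ys (2 * n) + 2"
  proof -
    have "col ys 2 = nat (ys ! 0)" "col ys 1 = nat (- ys ! 0)" "col ys (2 * n) = nat (ys ! (n - 1))"
      using n by (simp_all add: col_def)
    thus ?thesis by (auto simp: F_def follows_iff last max_def nat_add_distrib split: if_splits)
  qed
  have FS: "F (Suc k) \<longleftrightarrow> col ys (2 * k + 4) \<le> col ys (2 * k + 2) + 1 \<and>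
      col ys (2 * k + 3) \<le> col ys (2 * k + 1) + 1 \<and> (col ys (2 * k + 2) = 0 \<or> col ys (2 * k
          + 3) = 0)" for k
    using col_even[of k] col_odd[of k] col_even[of "Suc k"] col_odd[of "Suc k"]
    by (auto simp: F_def follows_iff numeral_eq_Suc)
  have same: "col ys (2 * k + 1) = 0 \<or> col ys (2 * k + 2) = 0" for k
    unfolding col_even col_odd by auto
  have "(\<forall>k<n. F k) \<longleftrightarrow> cols_ok n (col ys)"
  proof
    assume L: "\<forall>k<n. F k"
    show "cols_ok n (col ys)"
      unfolding cols_ok_def
    proof (intro conjI ballI)
      show "col ys 2 \<le> 1" "col ys 1 \<le> col ys (2 * n) + 2" using L n F0 by auto
    next
      fix r assume r: "r \<in> {3..2 * n}"
      define k where "k = (r - 3) div 2"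
      have "r = 2 * k + 3 \<or> r = 2 * k + 4" "Suc k < n" using r by (auto simp: k_def)
      thus "col ys r \<le> col ys (r - 2) + 1" using L FS[of k] by auto
    next
      fix r assume r: "r \<in> {1..<2 * n}"
      define k where "k = (r - 1) div 2"
      have "r = 2 * k + 1 \<or> (r = 2 * k + 2 \<and> Suc k < n)" using r by (auto simp: k_def)
      thus "col ys r = 0 \<or> col ys (r
          + 1) = 0" using L FS[of k] same[of k] by (auto simp: numeral_eq_Suc)
    qed
  next
    assume R: "cols_ok n (col ys)"
    show "\<forall>k<n. F k"
    proof (intro allI impI)
      fix k assume k: "k < n"
      show "F k"
      proof (cases k)
        case 0
        thus ?thesis using R F0 by (simp add: cols_ok_def)
      next
        case (Suc m)
        have "2 * m + 4 \<in> {3..2 * n}" "2 * m + 3 \<in> {3..2 * n}" "2 * m + 2 \<in> {1..<2 * n}"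
          using k Suc by auto
        moreover have "col ys r \<le> col ys (r - 2) + 1" if "r \<in> {3..2 * n}" for r
          using R that by (simp add: cols_ok_def)
        moreover have "col ys r = 0 \<or> col ys (r + 1) = 0" if "r \<in> {1..<2 * n}" for r
          using R that by (simp add: cols_ok_def)
        ultimately have "col ys (2 * m + 4) \<le> col ys (2 * m + 4 - 2) + 1"
          "col ys (2 * m + 3) \<le> col ys (2 * m + 3 - 2) + 1"
          "col ys (2 * m + 2) = 0 \<or> col ys (2 * m + 2 + 1) = 0" by metis+
        thus ?thesis unfolding Suc FS by (simp add: numeral_eq_Suc)
      qed
    qed
  qed
  thus ?thesis
    unfolding signed_heights_def mem_Collect_eq chain_iff F_def len by (simp only: simp_thms)
qed (simp add: signed_heights_def)

lemma mem_tower_set: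
  assumes "r \<in> {1..2 * n}"
  shows "r + i * (2 * n + 1) \<in> tower_set n c \<longleftrightarrow> i < c r"
proof -
  have "(r + i * (2 * n + 1)) mod (2 * n + 1) = r"
    by (subst mod_mult_self1) (use assms in simp)
  moreover have "(r + i * (2 * n + 1)) div (2 * n + 1) = i"
    by (subst div_mult_self1) (use assms in simp_all)
  moreover have "r \<noteq> 0" using assms by simp
  ultimately show ?thesis by (simp only: tower_set_def mem_Collect_eq simp_thms)
qed

lemma tower_setE:
  assumes "x \<in> tower_set n c"
  obtains r i where "r \<in> {1..2 * n}" "i < c r" "x = r + i * (2 * n + 1)"
proof (rule that)
  show "x mod (2 * n + 1) \<in> {1..2 * n}"
    using assms mod_less_divisor[of "2 * n + 1" x] by (auto simp: tower_set_def)
  show "x div (2 * n + 1) < c (x mod (2 * n + 1))" using assms by (simp add: tower_set_def)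
  show "x = x mod (2 * n + 1) + x div (2 * n + 1) * (2 * n + 1)"
    by (rule mod_div_mult_eq[symmetric])
qed

lemma tower_set_eq: "tower_set n c = (\<lambda>(r, i). r + i * (2 * n
    + 1)) ` (SIGMA r:{1..2 * n}. {..<c r})"
proof (intro subset_antisym subsetI)
  fix x assume "x \<in> tower_set n c"
  thus "x \<in> (\<lambda>(r, i). r + i * (2 * n + 1)) ` (SIGMA r:{1..2 * n}. {..<c r})"
    by (elim tower_setE) force
next
  fix x assume "x \<in> (\<lambda>(r, i). r + i * (2 * n + 1)) ` (SIGMA r:{1..2 * n}. {..<c r})"
  thus "x \<in> tower_set n c" using mem_tower_set by auto
qed

lemma tower_inj:
  fixes n :: nat
  shows "inj_on (\<lambda>(r, i). r + i * (2 * n + 1)) (SIGMA r:{1..2 * n}. {..<c r})"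
proof (rule inj_onI, clarify)
  fix r i r' i' :: nat
  assume A: "r \<in> {1..2 * n}" "r' \<in> {1..2 * n}" "r + i * (2 * n + 1) = r' + i' * (2 * n + 1)"
  have "(r + i * (2 * n + 1)) mod (2 * n + 1) = r" "(r' + i' * (2 * n + 1)) mod (2 * n + 1) = r'"
    using A(1,2) by (subst mod_mult_self1; simp)+
  hence "r = r'" using A(3) by metis
  moreover have "i * (2 * n + 1) = i' * (2 * n + 1)"
    using A(3) \<open>r = r'\<close> by linarith
  hence "i = i'" by (simp only: mult_cancel2) simp
  ultimately show "r = r' \<and> i = i'" by simp
qed

lemma core_set_tower:
  assumes n: "n > 0" and ok: "cols_ok n c"
  shows "core_set n (tower_set n c)"
  unfolding core_set_def
proof (intro conjI)
  show "finite (tower_set n c)" by (simp add: tower_set_eq)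
  show "0 \<notin> tower_set n c" by (simp add: tower_set_def)
  show "closed_under (2 * n + 1) (tower_set n c)"
    unfolding closed_under_def
  proof (intro ballI impI)
    fix x assume x: "x \<in> tower_set n c" "2 * n + 1 \<le> x"
    obtain r i where ri: "r \<in> {1..2 * n}" "i < c r" "x = r + i * (2 * n + 1)"
      using x(1) by (rule tower_setE)
    obtain j where j: "i = Suc j" using x(2) ri by (cases i) auto
    have "x - (2 * n + 1) = r + j * (2 * n + 1)" using ri j by simp
    thus "x - (2 * n + 1) \<in> tower_set n c" using mem_tower_set[OF ri(1), of j c] ri j by simp
  qed
  show "closed_under (2 * n + 3) (tower_set n c)"
    unfolding closed_under_def
  proof (intro ballI impI)
    fix x assume x: "x \<in> tower_set n c" "2 * n + 3 \<le> x"
    obtain r i where ri: "r \<in> {1..2 * n}" "i < c r" "x = r + i * (2 * n + 1)"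
      using x(1) by (rule tower_setE)
    obtain j where j: "i = Suc j" using x(2) ri by (cases i) auto
    consider "r = 1" | "r = 2" | "r \<ge> 3" using ri(1) by fastforce
    thus "x - (2 * n + 3) \<in> tower_set n c"
    proof cases
      case 1
      obtain k where k: "j = Suc k" using x(2) ri j 1 by (cases j) auto
      have "x - (2 * n + 3) = 2 * n + k * (2 * n + 1)" using ri j k 1 by simp
      moreover have "k < c (2 * n)" using ok ri j k 1 by (simp add: cols_ok_def)
      ultimately show ?thesis using mem_tower_set[of "2 * n" n k c] n by simp
    next
      case 2
      thus ?thesis using ok ri j by (simp add: cols_ok_def)
    next
      case 3
      have eq: "x - (2 * n + 3) = (r - 2) + j * (2 * n + 1)" using ri j 3 by simp
      have "c r \<le> c (r - 2) + 1" using ok ri 3 by (simp add: cols_ok_def)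
      hence "j < c (r - 2)" "r - 2 \<in> {1..2 * n}" using ri j 3 by auto
      thus ?thesis unfolding eq by (simp only: mem_tower_set)
    qed
  qed
  show "\<forall>x\<in>tower_set n c. Suc x \<notin> tower_set n c"
  proof (intro ballI notI)
    fix x assume x: "x \<in> tower_set n c" "Suc x \<in> tower_set n c"
    obtain r i where ri: "r \<in> {1..2 * n}" "i < c r" "x = r + i * (2 * n + 1)"
      using x(1) by (rule tower_setE)
    show False
    proof (cases "r = 2 * n")
      case True
      hence "Suc x = Suc i * (2 * n + 1)" using ri by simp
      hence "Suc x mod (2 * n + 1) = 0" by (metis mod_mult_self2_is_0)
      thus False using x(2) by (simp add: tower_set_def)
    next
      case False
      hence r: "r + 1 \<in> {1..2 * n}" "r \<in> {1..<2 * n}" using ri by auto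
      have "Suc x = (r + 1) + i * (2 * n + 1)" using ri by simp
      hence "i < c (r + 1)" using mem_tower_set[OF r(1), of i c] x(2) by simp
      moreover have "c r = 0 \<or> c (r + 1) = 0" using ok r(2) by (simp add: cols_ok_def)
      ultimately show False using ri by simp
    qed
  qed
qed

lemma core_set_is_tower:
  assumes n: "n > 0" and B: "core_set n B"
  obtains c where "cols_ok n c" "tower_set n c = B"
proof -
  define s where "s = 2 * n + 1"
  define c where "c r = card {i. r + i * s \<in> B}" for r
  have fin: "finite B" and no0: "0 \<notin> B" and cs: "closed_under s B" and ct: "closed_under (s
      + 2) B"
    and nc: "\<And>b. b \<in> B \<Longrightarrow> Suc b \<notin> B"
    using B by (auto simp: core_set_def s_def numeral_eq_Suc)
  have s: "s > 0" by (simp add: s_def)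
  have down: "r + j * s \<in> B" if "r + i * s \<in> B" "j \<le> i" for r i j
    using that
  proof (induction i)
    case (Suc i)
    have "r + i * s \<in> B" if "r + Suc i * s \<in> B"
      using cs that by (force simp: closed_under_def)
    thus ?case using Suc by (cases "j = Suc i") auto
  qed simp
  have fin_i: "finite {i. r + i * s \<in> B}" for r
  proof (rule finite_subset)
    show "{i. r + i * s \<in> B} \<subseteq> {..Max B}"
    proof
      fix i assume "i \<in> {i. r + i * s \<in> B}"
      hence "r + i * s \<le> Max B" using fin by simp
      moreover have "i * 1 \<le> i * s" using s by (intro mult_le_mono) auto
      ultimately have "i \<le> Max B" by linarith
      thus "i \<in> {..Max B}" by simp
    qed
  qed simp
  have mem: "r + i * s \<in> B \<longleftrightarrow> i < c r" for r i
  proof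
    assume "r + i * s \<in> B"
    hence "{..i} \<subseteq> {i. r + i * s \<in> B}" using down by auto
    from card_mono[OF fin_i this] show "i < c r" by (simp add: c_def)
  next
    assume "i < c r"
    show "r + i * s \<in> B"
    proof (rule ccontr)
      assume "r + i * s \<notin> B"
      hence "{i. r + i * s \<in> B} \<subseteq> {..<i}" using down by (force simp: not_less[symmetric])
      from card_mono[OF _ this] show False using \<open>i < c r\<close> by (simp add: c_def)
    qed
  qed
  have c0: "c 0 = 0" using mem[of 0 0] no0 by simp
  have tdown: "x \<in> B" if "x + (s + 2) \<in> B" for x
    using ct that by (force simp: closed_under_def)
  have "tower_set n c = B"
  proof -
    have "x \<in> tower_set n c \<longleftrightarrow> x \<in> B" for x
    proof -
      have "x \<in> B \<longleftrightarrow> x div s < c (x mod s)" using mem[of "x mod s" "x div s"] by simp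
      thus ?thesis
        unfolding tower_set_def s_def[symmetric] mem_Collect_eq using c0 by (metis not_less_zero)
    qed
    thus ?thesis by blast
  qed
  moreover have "cols_ok n c"
    unfolding cols_ok_def
  proof (intro conjI ballI)
    fix r assume r: "r \<in> {3..2 * n}"
    show "c r \<le> c (r - 2) + 1"
    proof (rule ccontr)
      assume nle: "\<not> c r \<le> c (r - 2) + 1"
      define q where "q = r - 2"
      have q: "r = q + 2" unfolding q_def using r by (simp; linarith)
      have "q + 2 + Suc (c q) * s \<in> B" using nle unfolding mem q by simp
      moreover have "q + 2 + Suc (c q) * s = (q + c q * s) + (s + 2)" by simp
      ultimately have "q + c q * s \<in> B" using tdown by metis
      thus False unfolding mem by simp
    qed
  next
    show "c 2 \<le> 1"
    proof (rule ccontr)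
      assume "\<not> c 2 \<le> 1"
      hence "2 + 1 * s \<in> B" unfolding mem by simp
      moreover have "2 + 1 * s = 0 + (s + 2)" by simp
      ultimately show False using tdown no0 by metis
    qed
    show "c 1 \<le> c (2 * n) + 2"
    proof (rule ccontr)
      assume "\<not> c 1 \<le> c (2 * n) + 2"
      hence "1 + (c (2 * n) + 2) * s \<in> B" unfolding mem by simp
      moreover have "1 + (c (2 * n) + 2) * s = (2 * n + c (2 * n) * s) + (s + 2)"
        by (simp add: s_def algebra_simps)
      ultimately have "2 * n + c (2 * n) * s \<in> B" using tdown by metis
      thus False unfolding mem by simp
    qed
  next
    fix r assume "r \<in> {1..<2 * n}"
    show "c r = 0 \<or> c (r + 1) = 0"
      using mem[of r 0] mem[of "r + 1" 0] nc[of r] by auto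
  qed
  ultimately show ?thesis using that by blast
qed

lemma tower_set_cong: "(\<And>r. r \<in> {1..2 * n} \<Longrightarrow> c r = d r) \<Longrightarrow> tower_set n c = tower_set n d"
  unfolding tower_set_eq by (intro arg_cong2[where f = "(`)"] Sigma_cong) auto

lemma cols_ok_cong:
  assumes "n > 0" "\<And>r. r \<in> {1..2 * n} \<Longrightarrow> c r = d r"
  shows "cols_ok n c \<longleftrightarrow> cols_ok n d"
proof -
  have "c 1 = d 1" "c 2 = d 2" "c (2 * n) = d (2 * n)"
    using assms(1) by (intro assms(2); simp)+
  moreover have "c r = d r" "c (r - 2) = d (r - 2)" if "r \<in> {3..2 * n}" for r
    by (intro assms(2); use that in \<open>simp; linarith\<close>)+
  moreover have "c r = d r" "c (r + 1) = d (r + 1)" if "r \<in> {1..<2 * n}" for r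
    using that by (intro assms(2); simp)+
  ultimately show ?thesis unfolding cols_ok_def by (simp cong: ball_cong_simp)
qed

lemma towers_bij:
  assumes n: "n > 0"
  shows "bij_betw (\<lambda>ys. tower_set n (col ys)) (signed_heights n) {B. core_set n B}"
  unfolding bij_betw_def
proof (intro conjI inj_onI subset_antisym subsetI)
  fix ys zs assume A: "ys \<in> signed_heights n" "zs \<in> signed_heights n" "tower_set n (col ys) = tower_set n (col zs)"
  have eq: "col ys r = col zs r" if "r \<in> {1..2 * n}" for r
    using mem_tower_set[OF that, of _ "col ys"] mem_tower_set[OF that, of _ "col zs"] A(3)
    by (metis linorder_neqE_nat less_irrefl)
  have len: "length ys = n" "length zs = n" using A by (auto simp: signed_heights_def)
  show "ys = zs"
  proof (rule nth_equalityI)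
    fix k assume k: "k < length ys"
    have "col ys (2 * k + 2) = col zs (2 * k + 2)" "col ys (2 * k + 1) = col zs (2 * k + 1)"
      using k len by (intro eq; simp)+
    thus "ys ! k = zs ! k" by (simp add: col_def nat_eq_iff split: if_splits)
  qed (simp add: len)
next
  fix B assume "B \<in> (\<lambda>ys. tower_set n (col ys)) ` signed_heights n"
  thus "B \<in> {B. core_set n B}" using core_set_tower[OF n] signed_heights_iff[OF n] by auto
next
  fix B assume "B \<in> {B. core_set n B}"
  then obtain c where c: "cols_ok n c" "tower_set n c = B" using core_set_is_tower[OF n] by blast
  define ys where "ys = map (\<lambda>k. int (c (2 * k + 2)) - int (c (2 * k + 1))) [0..<n]"
  have col: "col ys r = c r" if r: "r \<in> {1..2 * n}" for r
  proof -
    define k where "k = (r - 1) div 2"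
    have k: "r = 2 * k + 1 \<or> r = 2 * k + 2" "k < n" using r by (auto simp: k_def)
    have "c (2 * k + 1) = 0 \<or> c (2 * k + 2) = 0"
      using c(1) k(2) by (force simp: cols_ok_def)
    thus ?thesis using k by (auto simp: col_def ys_def)
  qed
  have "cols_ok n (col ys)"
    using c(1) col n by (subst cols_ok_cong[of n "col ys" c])
  hence "ys \<in> signed_heights n" using signed_heights_iff[OF n] by (simp add: ys_def)
  moreover have "tower_set n (col ys) = B" using tower_set_cong[of n "col ys" c] col c(2) by simp
  ultimately show "B \<in> (\<lambda>ys. tower_set n (col ys)) ` signed_heights n" by blast
qed

section \<open>The size of a core in terms of its walk\<close>

lemma card_tower_set: "card (tower_set n c) = (\<Sum>r\<in>{1..2 * n}. c r)"
  unfolding tower_set_eq card_image[OF tower_inj] by (simp add: card_SigmaI)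

lemma sum_tower_set:
  "2 * (\<Sum>x\<in>tower_set n c. int x) =
     (\<Sum>r\<in>{1..2 * n}. 2 * int r * int (c r) + (2 * int n + 1) * (int (c r) * (int (c r) - 1)))"
proof -
  have gauss: "2 * (\<Sum>i<k. int r + int i * s) = 2 * int r * int k
      + s * (int k * (int k - 1))" for r k s
    by (induction k) (auto simp: algebra_simps)
  have "(\<Sum>x\<in>tower_set n c. int x) = (\<Sum>r\<in>{1..2 * n}. \<Sum>i<c r. int r
      + int i * (2 * int n + 1))"
    unfolding tower_set_eq sum.reindex[OF tower_inj]
    by (subst sum.Sigma) (auto intro!: sum.cong simp: algebra_simps)
  hence "2 * (\<Sum>x\<in>tower_set n c. int x) =
      (\<Sum>r\<in>{1..2 * n}. 2 * (\<Sum>i<c r. int r + int i * (2 * int n + 1)))"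
    by (simp only: sum_distrib_left[of 2 _ "{1..2 * n}"])
  thus ?thesis by (simp only: gauss)
qed

lemma sum_residue_pairs:
  fixes n :: nat
  shows "(\<Sum>r\<in>{1..2 * n}. f r) = (\<Sum>k<n. f (2 * k + 1) + f (2 * k
      + 2) :: 'a :: comm_monoid_add)"
  by (induction n) (simp_all add: add.assoc)

text \<open>With column heights \<open>c r\<close>, twice the size is \<open>(2 n + 1) * sum of (c r)\<^sup>2 - (sum of c r)\<^sup>2\<close> plus
  the linear term \<open>sum of (2 r - 2 n) * c r\<close>.\<close>

lemma size_estimate:
  assumes xs: "xs \<in> partitions" and beta: "beta xs = tower_set n (col ys)" and len: "length ys = n"
  defines "N \<equiv> \<Sum>y\<leftarrow>ys. \<bar>y\<bar>" and "A \<equiv> \<Sum>y\<leftarrow>ys. y\<^sup>2"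
  shows "\<bar>2 * int (size_of xs) - ((2 * int n + 1) * A - N\<^sup>2)\<bar> \<le> 2 * int n * N"
proof -
  define c where "c r = int (col ys r)" for r
  have "(\<Sum>r\<in>{1..2 * n}. c r) = (\<Sum>k<n. \<bar>ys ! k\<bar>)"
    unfolding sum_residue_pairs by (intro sum.cong) (auto simp: c_def col_def)
  hence N: "(\<Sum>r\<in>{1..2 * n}. c r) = N"
    by (simp add: N_def sum_list_sum_nth len atLeast0LessThan)
  have "(\<Sum>r\<in>{1..2 * n}. (c r)\<^sup>2) = (\<Sum>k<n. (ys ! k)\<^sup>2)"
    unfolding sum_residue_pairs by (intro sum.cong) (auto simp: c_def col_def nat_eq_iff not_le)
  hence A: "(\<Sum>r\<in>{1..2 * n}. (c r)\<^sup>2) = A"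
    by (simp add: A_def sum_list_sum_nth len atLeast0LessThan)
  have k: "int (length xs) = N"
    using card_beta[OF xs] unfolding beta card_tower_set N[symmetric] c_def of_nat_sum[symmetric] by
        simp
  have "2 * int (size_of xs) = (\<Sum>r\<in>{1..2 * n}. 2 * int r * c r + (2 * int n
      + 1) * (c r * (c r - 1))) - N * (N - 1)"
    using sum_beta[OF xs] unfolding k beta sum_tower_set c_def by simp
  also have "(\<Sum>r\<in>{1..2 * n}. 2 * int r * c r + (2 * int n + 1) * (c r * (c r - 1))) =
      (\<Sum>r\<in>{1..2 * n}. (2 * int r - 2 * int n - 1) * c r + (2 * int n + 1) * (c r)\<^sup>2)"
    by (intro sum.cong) (auto simp: algebra_simps power2_eq_square)
  also have "\<dots> = (\<Sum>r\<in>{1..2 * n}. (2 * int r - 2 * int n) * c r) - N + (2 * int n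
      + 1) * A"
    unfolding N[symmetric] A[symmetric] sum_distrib_left sum.distrib sum_subtractf[symmetric]
    by (intro arg_cong2[where f = "(+)"] sum.cong) (auto simp: algebra_simps)
  finally have "2 * int (size_of xs) - ((2 * int n + 1) * A - N\<^sup>2) =
      (\<Sum>r\<in>{1..2 * n}. (2 * int r - 2 * int n) * c r)"
    by (simp add: algebra_simps power2_eq_square)
  also have "\<bar>\<dots>\<bar> \<le> (\<Sum>r\<in>{1..2 * n}. 2 * int n * c r)"
    by (intro order_trans[OF sum_abs] sum_mono)
       (auto simp: abs_mult c_def intro!: mult_right_mono)
  also have "\<dots> = 2 * int n * N" by (simp add: N[symmetric] sum_distrib_left)
  finally show ?thesis .
qed

lemma real_level: "real (level (s + 2)) = (if s \<ge> -1 then real_of_int s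
    + 1 else - real_of_int s - 2)"
  by (auto simp: level_def)

lemma path_sum_nonneg: "(\<And>m. v m \<ge> 0) \<Longrightarrow> path_sum v i w \<ge> 0"
  by (induction w arbitrary: i) auto

lemma abs_telescope_step:
  fixes c :: real
  assumes "\<bar>2 * c - v - (t - x) / d\<bar> \<le> k" "\<bar>2 * S - T - (e - t) / d\<bar> \<le> K"
  shows "\<bar>2 * (c + S) - (v + T) - (e - x) / d\<bar> \<le> k + K"
proof -
  have eq: "2 * (c + S) - (v + T) - (e - x) / d = (2 * c - v - (t - x) / d) + (2 * S - T - (e - t) / d)"
    by (simp add: diff_divide_distrib)
  show ?thesis unfolding eq by (rule order_trans[OF abs_triangle_ineq add_mono[OF assms]])
qed

text \<open>A step away from absolute position \<open>r\<close> adds about \<open>2 r - r\<close> to the difference of the two sums, any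
  other step about \<open>- r\<close>, and both agree up to a constant with the change of half the squared position.\<close>

lemma emit_abs_sum:
  "\<bar>2 * real_of_int (\<Sum>y\<leftarrow>emit s w. \<bar>y\<bar>) - path_sum (\<lambda>m. real m
      + 1) (s + 2) w
     - ((real_of_int (s
         + disp w))\<^sup>2 - (real_of_int s)\<^sup>2) / 2\<bar> \<le> 4 * real (length w)"
proof (induction w arbitrary: s)
  case (Cons b w)
  define t where "t = s + step b"
  define e where "e = real_of_int (t + disp w)"
  define c where "c = (if b then (if s \<ge> 0 then s + 1 else 0) else (if s \<le> 0 then - s else 0))"
  define x where "x = real_of_int s"
  have step: "\<bar>2 * real_of_int c - (real (level (s + 2))
      + 1) - ((real_of_int t)\<^sup>2 - x\<^sup>2) / 2\<bar> \<le> 4"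
  proof -
    have sq: "((x + 1)\<^sup>2 - x\<^sup>2) / 2 = x + 1/2" "((x - 1)\<^sup>2 - x\<^sup>2) / 2 = - x
        + 1/2"
      by (simp_all add: power2_eq_square field_simps)
    consider "s \<ge> 1" | "s = 0" | "s = -1" | "s \<le> -2" by linarith
    thus ?thesis
    proof cases
      case 1
      hence "x \<ge> 1" by (simp add: x_def)
      thus ?thesis using 1 sq by (cases b) (simp_all add: real_level t_def c_def x_def[symmetric]
          add_divide_distrib diff_divide_distrib)
    next
      case 4
      hence "x \<le> -2" by (simp add: x_def)
      thus ?thesis using 4 sq by (cases b) (simp_all add: real_level t_def c_def x_def[symmetric]
          add_divide_distrib diff_divide_distrib)
    next
      case 2
      hence "x = 0" by (simp add: x_def)
      thus ?thesis using 2 by (cases b) (simp_all add: level_def t_def c_def)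
    next
      case 3
      hence "x = -1" by (simp add: x_def)
      thus ?thesis using 3 by (cases b) (simp_all add: level_def t_def c_def)
    qed
  qed
  have sum_eq: "(\<Sum>y\<leftarrow>emit s (b # w). \<bar>y\<bar>) = c
      + (\<Sum>y\<leftarrow>emit t w. \<bar>y\<bar>)"
    by (cases b) (auto simp: c_def t_def)
  have path_eq: "path_sum (\<lambda>m. real m + 1) (s + 2) (b # w) =
      (real (level (s + 2)) + 1) + path_sum (\<lambda>m. real m + 1) (t + 2) w"
    by (simp add: t_def algebra_simps del: step.simps)
  have end_eq: "real_of_int (s + disp (b # w)) = e" by (simp add: t_def e_def)
  have len_eq: "real (length (b # w)) = real (length w) + 1" by simp
  show ?case
    using abs_telescope_step[OF step Cons.IH[of t, folded e_def]]
    unfolding sum_eq path_eq end_eq len_eq of_int_add[of c] x_def[symmetric] by simp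
qed simp

text \<open>The same comparison for the squares, with a third of the cubed absolute position as potential.\<close>

lemma emit_square_sum:
  "\<bar>2 * real_of_int (\<Sum>y\<leftarrow>emit s w. y\<^sup>2) - path_sum (\<lambda>m. (real m
      + 1)\<^sup>2) (s + 2) w
     - (\<bar>real_of_int (s + disp w)\<bar> ^ 3 - \<bar>real_of_int s\<bar> ^ 3) / 3\<bar>
   \<le> 12 * (path_sum (\<lambda>m. real m + 1) (s + 2) w + real (length w))"
proof (induction w arbitrary: s)
  case (Cons b w)
  define t where "t = s + step b"
  define e where "e = real_of_int (t + disp w)"
  define c where "c = (if b then (if s \<ge> 0 then (s
      + 1)\<^sup>2 else 0) else (if s \<le> 0 then s\<^sup>2 else 0))"
  define x where "x = real_of_int s"
  have step: "\<bar>2 * real_of_int c - (real (level (s + 2)) + 1)\<^sup>2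
     - (\<bar>real_of_int t\<bar> ^ 3 - \<bar>x\<bar> ^ 3) / 3\<bar> \<le> 12 * ((real (level (s + 2))
         + 1) + 1)"
  proof -
    consider "s \<ge> 1" | "s = 0" | "s = -1" | "s \<le> -2" by linarith
    thus ?thesis
    proof cases
      case 1
      hence x: "x \<ge> 1" by (simp add: x_def)
      have "2 * (x + 1)\<^sup>2 - (x + 1 + 1)\<^sup>2 - ((x + 1) ^ 3 - x ^ 3) / 3 = - x - 7/3"
        "2 * 0 - (x + 1 + 1)\<^sup>2 - ((x - 1) ^ 3 - x ^ 3) / 3 = - 5 * x - 11/3"
        by (simp_all add: power2_eq_square power3_eq_cube field_simps)
      thus ?thesis using 1 x
        by (cases b) (simp_all add: real_level t_def c_def x_def[symmetric])
    next
      case 4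
      hence x: "x \<le> -2" by (simp add: x_def)
      have "2 * 0 - (- x - 2 + 1)\<^sup>2 - ((- (x + 1)) ^ 3 - (- x) ^ 3) / 3 = - x - 2/3"
        "2 * x\<^sup>2 - (- x - 2 + 1)\<^sup>2 - ((- (x - 1)) ^ 3 - (- x) ^ 3) / 3 = - x - 4/3"
        by (simp_all add: power2_eq_square power3_eq_cube field_simps)
      moreover have "\<bar>x\<bar> = - x" "\<bar>x + 1\<bar> = - (x
          + 1)" "\<bar>x - 1\<bar> = - (x - 1)" using x by auto
      ultimately show ?thesis using 4 x
        by (cases b) (simp_all only: real_level t_def c_def x_def[symmetric] step.simps if_True if_False
            of_int_add of_int_diff of_int_1 of_int_0 of_int_power of_int_minus, simp_all add:
                x_def[symmetric])
    next
      case 2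
      hence "x = 0" by (simp add: x_def)
      thus ?thesis using 2 by (cases b) (simp_all add: level_def t_def c_def)
    next
      case 3
      hence "x = -1" by (simp add: x_def)
      thus ?thesis using 3 by (cases b) (simp_all add: level_def t_def c_def)
    qed
  qed
  have sum_eq: "(\<Sum>y\<leftarrow>emit s (b # w). y\<^sup>2) = c
      + (\<Sum>y\<leftarrow>emit t w. y\<^sup>2)"
    by (cases b) (auto simp: c_def t_def)
  have path_eq: "path_sum v (s + 2) (b # w) = v (level (s + 2)) + path_sum v (t + 2) w" for v
    by (simp add: t_def algebra_simps del: step.simps)
  have end_eq: "real_of_int (s + disp (b # w)) = e" by (simp add: t_def e_def)
  have len_eq: "real (length (b # w)) = real (length w) + 1" by simp
  show ?case
    using abs_telescope_step[OF step Cons.IH[of t, folded e_def]]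
    unfolding sum_eq path_eq end_eq len_eq of_int_add[of c] x_def[symmetric] by (simp add:
        algebra_simps)
qed simp

text \<open>Since the walk ends on the other side of the mirror, this bounds the square of the starting point by
  the sum of the heights. It controls the end contributions of the cubic potential.\<close>

lemma signed_square_le:
  "real_of_int (s + disp w) * \<bar>real_of_int (s
      + disp w)\<bar> - real_of_int s * \<bar>real_of_int s\<bar>
     \<le> 2 * path_sum (\<lambda>m. real m + 1) (s + 2) w + 6 * real (length w)"
proof (induction w arbitrary: s)
  case (Cons b w)
  define t where "t = s + step b"
  define e where "e = real_of_int (t + disp w)"
  define x where "x = real_of_int s"
  have step: "real_of_int t * \<bar>real_of_int t\<bar> - x * \<bar>x\<bar> \<le> 2 * (real (level (s
      + 2)) + 1) + 6"
  proof -
    consider "s \<ge> 1" | "s = 0" | "s = -1" | "s \<le> -2" by linarith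
    thus ?thesis
    proof cases
      case 1
      hence "x \<ge> 1" by (simp add: x_def)
      thus ?thesis using 1 by (cases b) (simp_all add: real_level t_def x_def[symmetric] algebra_simps)
    next
      case 4
      hence "x \<le> -2" by (simp add: x_def)
      thus ?thesis using 4
        by (cases b) (simp_all add: real_level t_def x_def[symmetric] algebra_simps abs_of_nonpos)
    next
      case 2
      hence "x = 0" by (simp add: x_def)
      thus ?thesis using 2 by (cases b) (simp_all add: level_def t_def)
    next
      case 3
      hence "x = -1" by (simp add: x_def)
      thus ?thesis using 3 by (cases b) (simp_all add: level_def t_def)
    qed
  qed
  have path_eq: "path_sum v (s + 2) (b # w) = v (level (s + 2)) + path_sum v (t + 2) w" for v
    by (simp add: t_def algebra_simps del: step.simps)
  have end_eq: "real_of_int (s + disp (b # w)) = e" by (simp add: t_def e_def)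
  have len_eq: "real (length (b # w)) = real (length w) + 1" by simp
  show ?case
    using add_mono[OF step Cons.IH[of t, folded e_def]]
    unfolding path_eq end_eq len_eq x_def[symmetric] by (simp add: algebra_simps)
qed simp

lemma heights_estimates:
  fixes n :: nat
  assumes w: "w \<in> rising n"
  defines "L \<equiv> 2 * real n
      + 1" and "N \<equiv> real_of_int (\<Sum>y\<leftarrow>heights w. \<bar>y\<bar>)"
    and "A \<equiv> real_of_int (\<Sum>y\<leftarrow>heights w. y\<^sup>2)"
  shows "\<bar>2 * N - height_sum w\<bar> \<le> 9 * L" "\<bar>2 * A - height_square_sum w\<bar> \<le> 47 * (height_sum w
      + L)"
proof -
  obtain p where p: "p \<ge> -1" "disp w = 2 * p + 3" "start w = - p - 1" "p + 2 \<le> int n + 1"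
    using rising_start[OF w] by blast
  define s where "s = - (p + 3)"
  define P where "P = real_of_int p"
  have P: "P \<ge> -1" "P + 2 \<le> L" using p by (auto simp: P_def L_def)
  have len: "real (length w) = L" using w by (simp add: rising_def walks_def L_def)
  have s: "start w = s + 2" "s + disp w = p" using p by (auto simp: s_def)
  have s_real: "real_of_int s = - (P + 3)" by (simp add: s_def P_def)
  have h: "heights w = emit s w @ (if p \<ge> 0 then [p + 1] else [])"
    using s by (auto simp: heights_def emit_append)
  have N: "N = real_of_int (\<Sum>y\<leftarrow>emit s w. \<bar>y\<bar>) + (P + 1)"
    and A: "A = real_of_int (\<Sum>y\<leftarrow>emit s w. y\<^sup>2) + (P + 1)\<^sup>2"
    using p(1) by (auto simp: N_def A_def h P_def)
  have T: "height_sum w = path_sum (\<lambda>m. real m + 1) (s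
      + 2) w" "height_square_sum w = path_sum (\<lambda>m. (real m + 1)\<^sup>2) (s + 2) w"
    by (simp_all add: height_sum_def height_square_sum_def s)
  have "\<bar>2 * (N - (P + 1)) - height_sum w - (P\<^sup>2 - (P + 3)\<^sup>2) / 2\<bar> \<le> 4 * L"
    using emit_abs_sum[of s w] unfolding T[symmetric] s(2) len s_real N P_def[symmetric] power2_minus by
        simp
  moreover have "(P\<^sup>2 - (P + 3)\<^sup>2) / 2 = - (6 * P
      + 9) / 2" by (simp add: power2_eq_square algebra_simps)
  ultimately have "\<bar>2 * (N - (P + 1)) - height_sum w - (- (6 * P
      + 9) / 2)\<bar> \<le> 4 * L" by (simp only:)
  thus "\<bar>2 * N - height_sum w\<bar> \<le> 9 * L" using P by (simp add: abs_le_iff field_simps)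
  have *: "\<bar>2 * (A - (P + 1)\<^sup>2) - height_square_sum w - (\<bar>P\<bar> ^ 3 - \<bar>P
      + 3\<bar> ^ 3) / 3\<bar> \<le> 12 * (height_sum w + L)"
    using emit_square_sum[of s w] unfolding T[symmetric] s(2) len s_real A P_def[symmetric]
        abs_minus_cancel by simp
  have "P * \<bar>P\<bar> - (- (P + 3)) * \<bar>- (P + 3)\<bar> \<le> 2 * height_sum w + 6 * L"
    using signed_square_le[of s w] unfolding T[symmetric] s(2) len s_real P_def[symmetric] .
  moreover have "- ((- (P + 3)) * \<bar>- (P + 3)\<bar>) = (P + 3)\<^sup>2"
    using P(1) by (simp only: abs_minus_cancel) (simp add: power2_eq_square algebra_simps)
  moreover have "P * \<bar>P\<bar> \<ge> -1"
  proof (cases "p = -1")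
    case False
    hence "P \<ge> 0" using p(1) by (simp add: P_def)
    hence "P * \<bar>P\<bar> \<ge> 0" by simp
    thus ?thesis by linarith
  qed (simp add: P_def)
  ultimately have q: "(P + 3)\<^sup>2 \<le> 2 * height_sum w + 6 * L + 1" by linarith
  have "\<bar>(\<bar>P\<bar> ^ 3 - \<bar>P + 3\<bar> ^ 3) / 3\<bar> + 2 * (P + 1)\<^sup>2 \<le> 5 * (P
      + 3)\<^sup>2"
  proof (cases "p = -1")
    case True
    thus ?thesis by (simp add: P_def)
  next
    case False
    hence "P \<ge> 0" using p(1) by (simp add: P_def)
    hence eq: "(\<bar>P\<bar> ^ 3 - \<bar>P + 3\<bar> ^ 3) / 3 = - (3 * P\<^sup>2 + 9 * P + 9)"
      by (simp add: power3_eq_cube power2_eq_square algebra_simps add_divide_distrib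
          diff_divide_distrib)
    have "0 \<le> 3 * P\<^sup>2 + 9 * P + 9" using \<open>P \<ge> 0\<close> by simp
    hence "\<bar>(\<bar>P\<bar> ^ 3 - \<bar>P + 3\<bar> ^ 3) / 3\<bar> = 3 * P\<^sup>2 + 9 * P + 9"
      unfolding eq abs_minus_cancel by (rule abs_of_nonneg)
    moreover have "(P + 1)\<^sup>2 = P\<^sup>2 + 2 * P + 1" "(P + 3)\<^sup>2 = P\<^sup>2 + 6 * P + 9"
      by (simp_all add: power2_eq_square algebra_simps)
    ultimately show ?thesis using \<open>P \<ge> 0\<close> by (simp only:) (simp add: algebra_simps)
  qed
  moreover have "\<bar>2 * a - t\<bar> \<le> c + d"
    if "\<bar>2 * (a - k) - t - z\<bar> \<le> c" "\<bar>z\<bar>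
        + 2 * k \<le> d" "k \<ge> 0" for a t c d k z :: real
    using that by (auto simp: abs_if split: if_splits)
  ultimately have "\<bar>2 * A - height_square_sum w\<bar> \<le> 12 * (height_sum w + L) + 5 * (P
      + 3)\<^sup>2"
    using * zero_le_power2 by blast
  also have "\<dots> \<le> 47 * (height_sum w + L)"
  proof -
    have "L \<ge> 1" by (simp add: L_def)
    moreover have "height_sum w \<ge> 0" unfolding T by (intro path_sum_nonneg) auto
    ultimately have "12 * (height_sum w + L) + 5 * z \<le> 47 * (height_sum w
        + L)" if "z \<le> 2 * height_sum w + 6 * L + 1" for z
      using that by (simp add: algebra_simps)
    from this[OF q] show ?thesis .
  qed
  finally show "\<bar>2 * A - height_square_sum w\<bar> \<le> 47 * (height_sum w + L)" .
qed

lemma size_approx: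
  assumes w: "w \<in> rising n" and xs: "xs \<in> partitions" "beta xs = tower_set n (col (heights w))"
    and len: "length (heights w) = n"
  shows "\<bar>real (size_of xs) - model_size n w\<bar> \<le> 25 * (2 * real n + 1) * (height_sum w
      + (2 * real n + 1))"
proof -
  define L where "L = 2 * real n + 1"
  define N where "N = real_of_int (\<Sum>y\<leftarrow>heights w. \<bar>y\<bar>)"
  define A where "A = real_of_int (\<Sum>y\<leftarrow>heights w. y\<^sup>2)"
  define T where "T = height_sum w"
  have L: "L \<ge> 1" by (simp add: L_def)
  have T0: "T \<ge> 0" unfolding T_def height_sum_def by (intro path_sum_nonneg) auto
  have e: "\<bar>2 * N - T\<bar> \<le> 9 * L" "\<bar>2 * A - height_square_sum w\<bar> \<le> 47 * (T
      + L)"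
    using heights_estimates[OF w] by (simp_all add: N_def A_def L_def T_def)
  have "real_of_int \<bar>2 * int (size_of xs) - ((2 * int n
      + 1) * (\<Sum>y\<leftarrow>heights w. y\<^sup>2) - (\<Sum>y\<leftarrow>heights w. \<bar>y\<bar>)\<^sup>2)\<bar>
     \<le> real_of_int (2 * int n * (\<Sum>y\<leftarrow>heights w. \<bar>y\<bar>))"
    using size_estimate[OF xs len] by (simp only: of_int_le_iff)
  hence 1: "\<bar>2 * real (size_of xs) - (L * A - N\<^sup>2)\<bar> \<le> (L - 1) * N"
    by (simp add: L_def A_def N_def)
  have "N \<ge> 0" unfolding N_def by (simp, rule sum_list_nonneg) auto
  have 2: "(L - 1) * N \<le> L * (T / 2 + 9 / 2 * L)"
    using e(1) L \<open>N \<ge> 0\<close> by (intro mult_mono) auto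
  have 3: "\<bar>L * (A - height_square_sum w / 2)\<bar> \<le> L * (47 / 2 * (T + L))"
  proof -
    have "\<bar>A - height_square_sum w / 2\<bar> \<le> 47 / 2 * (T
        + L)" using e(2) by (simp add: abs_le_iff field_simps)
    thus ?thesis unfolding abs_mult using L by (intro mult_mono) auto
  qed
  have 4: "\<bar>N\<^sup>2 - T\<^sup>2 / 4\<bar> \<le> (9 / 2 * L) * (T + 9 / 2 * L)"
  proof -
    have "N\<^sup>2 - T\<^sup>2 / 4 = (N - T / 2) * (N
        + T / 2)" by (simp add: power2_eq_square algebra_simps)
    moreover have "\<bar>(N - T / 2) * (N + T / 2)\<bar> \<le> (9 / 2 * L) * (T + 9 / 2 * L)"
    proof -
      have "\<bar>N - T / 2\<bar> \<le> 9 / 2 * L" using e(1) by (simp add: abs_le_iff field_simps)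
      moreover have "\<bar>N + T / 2\<bar> \<le> T + 9 / 2 * L"
        using e(1) T0 \<open>N \<ge> 0\<close> by (simp add: abs_le_iff field_simps)
      ultimately show ?thesis unfolding abs_mult using L by (intro mult_mono) auto
    qed
    ultimately show ?thesis by simp
  qed
  have "2 * model_size n w = L * height_square_sum w / 2 - T\<^sup>2 / 4" by (simp add: model_size_def L_def T_def)
  hence "2 * (real (size_of xs) - model_size n w) =
      (2 * real (size_of xs) - (L * A - N\<^sup>2))
          + L * (A - height_square_sum w / 2) - (N\<^sup>2 - T\<^sup>2 / 4)"
    by (simp add: algebra_simps)
  hence "2 * \<bar>real (size_of xs) - model_size n w\<bar> \<le>
      L * (T / 2 + 9 / 2 * L) + L * (47 / 2 * (T + L)) + (9 / 2 * L) * (T + 9 / 2 * L)"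
    using 1 2 3 4 by linarith
  also have "\<dots> \<le> 50 * (L * (T + L))"
  proof -
    have "L * (T / 2 + 9 / 2 * L) + L * (47 / 2 * (T + L)) + (9 / 2 * L) * (T + 9 / 2 * L) =
        57 / 2 * (L * T) + 193 / 4 * (L * L)" by (simp add: field_simps)
    moreover have "0 \<le> L * T" "0 \<le> L * L" using L T0 by simp_all
    moreover have "50 * (L * (T + L)) = 50 * (L * T) + 50 * (L * L)" by (simp add: algebra_simps)
    ultimately show ?thesis by linarith
  qed
  finally show ?thesis
    unfolding L_def[symmetric] T_def[symmetric] by (simp add: mult.assoc)
qed

section \<open>The coefficient of variation\<close>

lemma distinct_cores_eq:
  "distinct_cores (2 * n + 1) (2 * n + 3) = {xs \<in> partitions. core_set n (beta xs)}"
proof -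
  have "xs \<in> distinct_cores (2 * n + 1) (2 * n
      + 3) \<longleftrightarrow> xs \<in> partitions \<and> core_set n (beta xs)" for xs
  proof (cases "xs \<in> partitions")
    case True
    have "(\<forall>c\<in>cells xs. hook_length xs c \<noteq> int (2 * n
        + 1) \<and> hook_length xs c \<noteq> int (2 * n + 3)) \<longleftrightarrow>
        closed_under (2 * n + 1) (beta xs) \<and> closed_under (2 * n + 3) (beta xs)"
      using hooks_avoid_iff[OF True, of "2 * n + 1"] hooks_avoid_iff[OF True, of "2 * n + 3"] by auto
    thus ?thesis
      using True distinct_iff_beta[OF True] beta_pos[OF True]
      unfolding distinct_cores_def core_partition_def core_set_def by auto
  qed (simp add: distinct_cores_def core_partition_def)
  thus ?thesis by blast
qed

definition core_of :: "nat \<Rightarrow> bool list \<Rightarrow> nat list" where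
  "core_of n w = inv_into partitions beta (tower_set n (col (heights w)))"

lemma core_of_bij:
  assumes n: "n > 0"
  shows "bij_betw (core_of n) (rising n) (distinct_cores (2 * n + 1) (2 * n + 3))"
proof -
  have "bij_betw beta (distinct_cores (2 * n + 1) (2 * n + 3)) {B. core_set n B}"
    unfolding bij_betw_def distinct_cores_eq
  proof (intro conjI subset_antisym subsetI)
    show "inj_on beta {xs \<in> partitions. core_set n (beta xs)}"
      by (rule inj_on_subset[OF beta_inj_on]) auto
    fix B assume B: "B \<in> {B. core_set n B}"
    hence "finite B" "0 \<notin> B" by (simp_all add: core_set_def)
    then obtain xs where "xs \<in> partitions" "beta xs = B"
      using beta_surj by blast
    thus "B \<in> beta ` {xs \<in> partitions. core_set n (beta xs)}" using B by auto
  qed auto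
  hence "bij_betw (inv_into (distinct_cores (2 * n + 1) (2 * n + 3)) beta) {B. core_set n B}
      (distinct_cores (2 * n + 1) (2 * n + 3))"
    by (rule bij_betw_inv_into)
  moreover have "inv_into (distinct_cores (2 * n + 1) (2 * n + 3)) beta B = inv_into partitions beta B"
    if "B \<in> {B. core_set n B}" for B
  proof -
    have "finite B" "0 \<notin> B" using that by (simp_all add: core_set_def)
    then obtain xs where xs: "xs \<in> partitions" "beta xs = B"
      using beta_surj by blast
    have "xs \<in> distinct_cores (2 * n + 1) (2 * n + 3)"
      using xs that unfolding distinct_cores_eq by simp
    moreover have "inj_on beta (distinct_cores (2 * n + 1) (2 * n + 3))"
      unfolding distinct_cores_eq by (rule inj_on_subset[OF beta_inj_on]) auto
    ultimately show ?thesis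
      using xs beta_inj_on by (metis inv_into_f_f)
  qed
  ultimately have inv: "bij_betw (inv_into partitions beta) {B. core_set n B}
      (distinct_cores (2 * n + 1) (2 * n + 3))"
    by (subst (asm) bij_betw_cong) auto
  have "bij_betw ((inv_into partitions beta \<circ> (\<lambda>ys. tower_set n (col ys))) \<circ> heights) (rising n)
      (distinct_cores (2 * n + 1) (2 * n + 3))"
    by (intro bij_betw_trans[OF heights_bij[OF n]] bij_betw_trans[OF towers_bij[OF n]] inv)
  thus ?thesis by (simp add: comp_def core_of_def[abs_def])
qed

lemma size_core_of:
  assumes n: "n > 0" and w: "w \<in> rising n"
  shows "\<bar>real (size_of (core_of n w)) - model_size n w\<bar> \<le> 25 * (2 * real n
      + 1) * (height_sum w + (2 * real n + 1))"
proof (rule size_approx[OF w])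
  have h: "heights w \<in> signed_heights n"
    using heights_bij[OF n] w by (auto simp: bij_betw_def)
  hence "core_set n (tower_set n (col (heights w)))"
    using towers_bij[OF n] by (auto simp: bij_betw_def)
  hence "finite (tower_set n (col (heights w)))" "0 \<notin> tower_set n (col (heights w))"
    by (simp_all add: core_set_def)
  then obtain xs where "xs \<in> partitions" "beta xs = tower_set n (col (heights w))"
    using beta_surj by blast
  hence "tower_set n (col (heights w)) \<in> beta ` partitions" by (metis imageI)
  thus "core_of n w \<in> partitions" "beta (core_of n w) = tower_set n (col (heights w))"
    unfolding core_of_def by (rule inv_into_into, rule f_inv_into_f)
  show "length (heights w) = n" using h by (simp add: signed_heights_def)
qed

definition size_error :: "nat \<Rightarrow> bool list \<Rightarrow> real" where
  "size_error n w = real (size_of (core_of n w)) - model_size n w"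

text \<open>The error is \<open>O(n * (height_sum + n))\<close> and \<open>height_sum\<close> has second moment of order \<open>n\<^sup>3\<close>, so the mean
  square error is of order \<open>n\<^sup>5\<close>.\<close>

lemma size_error_limit:
  "(\<lambda>n. (\<Sum>w\<in>rising n. (size_error n w)\<^sup>2) / (4 ^ n * real n ^ 6)) \<longlonglongrightarrow> 0"
proof (rule tendsto_sandwich[OF _ _ tendsto_const])
  define t where "t n = (\<Sum>w\<in>rising n. (height_sum w)\<^sup>2) / (4 ^ n * real n ^ 3)" for n
  define r where "r n = (2 * real n + 1) / real n" for n
  show "eventually (\<lambda>n. 0 \<le> (\<Sum>w\<in>rising n. (size_error n w)\<^sup>2) / (4 ^ n * real n ^ 6)) at_top"
    by (intro always_eventually allI divide_nonneg_nonneg sum_nonneg) auto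
  have "(\<Sum>w\<in>rising n. (size_error n w)\<^sup>2) / (4 ^ n * real n ^ 6)
      \<le> 1250 * (r n)\<^sup>2 * (t n * inverse (real n)
          + (r n)\<^sup>2 * (inverse (real n))\<^sup>2)" if n: "n > 0" for n
  proof -
    define L where "L = 2 * real n + 1"
    have "(size_error n w)\<^sup>2 \<le> 1250 * L\<^sup>2 * ((height_sum w)\<^sup>2
        + L\<^sup>2)" if w: "w \<in> rising n" for w
    proof -
      have "(size_error n w)\<^sup>2 \<le> (25 * L * (height_sum w + L))\<^sup>2"
        using size_core_of[OF n w] unfolding size_error_def L_def by (rule power2_le_iff_abs_le[THEN
            iffD2, rotated])
          (auto intro!: mult_nonneg_nonneg add_nonneg_nonneg simp: height_sum_def path_sum_nonneg)
      also have "\<dots> = 625 * L\<^sup>2 * (height_sum w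
          + L)\<^sup>2" by (simp add: power_mult_distrib)
      also have "\<dots> \<le> 625 * L\<^sup>2 * (2 * ((height_sum w)\<^sup>2 + L\<^sup>2))"
        using sum_squares_bound[of "height_sum w" L] by (intro mult_left_mono) (auto simp: power2_sum)
      finally show ?thesis by (simp add: algebra_simps)
    qed
    hence "(\<Sum>w\<in>rising n. (size_error n w)\<^sup>2) \<le> (\<Sum>w\<in>rising n. 1250 * L\<^sup>2 * ((height_sum w)\<^sup>2
        + L\<^sup>2))"
      by (rule sum_mono)
    also have "\<dots> = 1250 * L\<^sup>2 * ((\<Sum>w\<in>rising n. (height_sum w)\<^sup>2)
        + 4 ^ n * L\<^sup>2)"
      by (simp add: sum_distrib_left[symmetric] sum.distrib card_rising)
    finally have "(\<Sum>w\<in>rising n. (size_error n w)\<^sup>2) / (4 ^ n * real n ^ 6) \<le>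
        1250 * L\<^sup>2 * ((\<Sum>w\<in>rising n. (height_sum w)\<^sup>2)
            + 4 ^ n * L\<^sup>2) / (4 ^ n * real n ^ 6)"
      using n by (intro divide_right_mono) auto
    also have "\<dots> = 1250 * (r n)\<^sup>2 * (t n * inverse (real n)
        + (r n)\<^sup>2 * (inverse (real n))\<^sup>2)"
      using n unfolding r_def t_def L_def[symmetric] by (simp add: field_simps eval_nat_numeral)
    finally show ?thesis .
  qed
  thus "eventually (\<lambda>n. (\<Sum>w\<in>rising n. (size_error n w)\<^sup>2) / (4 ^ n * real n ^ 6)
      \<le> 1250 * (r n)\<^sup>2 * (t n * inverse (real n)
          + (r n)\<^sup>2 * (inverse (real n))\<^sup>2)) at_top"
    using eventually_gt_at_top[of 0] by (rule eventually_mono[rotated])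
  have "(\<lambda>n. 1250 * (r n)\<^sup>2 * (t n * inverse (real n)
      + (r n)\<^sup>2 * (inverse (real n))\<^sup>2))
     \<longlonglongrightarrow> 1250 * 2\<^sup>2 * (3/2 * 0 + 2\<^sup>2 * 0\<^sup>2)"
    unfolding r_def t_def
    by (intro tendsto_intros ratio_limit height_sum_square_limit lim_inverse_n)
  thus "(\<lambda>n. 1250 * (r n)\<^sup>2 * (t n * inverse (real n)
      + (r n)\<^sup>2 * (inverse (real n))\<^sup>2)) \<longlonglongrightarrow> 0"
    by simp
qed

text \<open>By the Cauchy-Schwarz inequality the error of small mean square does not affect the limit.\<close>

lemma size_limit:
  "(\<lambda>n. (\<Sum>w\<in>rising n. real (size_of (core_of n w))) / (4 ^ n * real n ^ 3)) \<longlonglongrightarrow> 5/16"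
proof -
  define e where "e n = (\<Sum>w\<in>rising n. (size_error n w)\<^sup>2) / (4 ^ n * real n ^ 6)" for n
  have "(\<lambda>n. sqrt (e n)) \<longlonglongrightarrow> sqrt 0"
    unfolding e_def by (intro tendsto_intros size_error_limit)
  hence null: "(\<lambda>n. sqrt (e n)) \<longlonglongrightarrow> 0" by simp
  have bound: "norm ((\<Sum>w\<in>rising n. size_error n w) / (4 ^ n * real n ^ 3)) \<le> sqrt (e n)" for n
  proof -
    have "(\<Sum>w\<in>rising n. 1 * size_error n w)\<^sup>2 \<le> (\<Sum>w\<in>rising n. 1\<^sup>2) * (\<Sum>w\<in>rising n. (size_error n w)\<^sup>2)"
      by (rule Cauchy_Schwarz_ineq_sum)
    hence "(\<Sum>w\<in>rising n. size_error n w)\<^sup>2 / (4 ^ n * real n ^ 3)\<^sup>2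
        \<le> 4 ^ n * (\<Sum>w\<in>rising n. (size_error n w)\<^sup>2) / (4 ^ n * real n ^ 3)\<^sup>2"
      by (intro divide_right_mono) (auto simp: card_rising)
    also have "\<dots> = e n"
    proof -
      have "(4 ^ n * real n ^ 3)\<^sup>2 = 4 ^ n * (4 ^ n * real n ^ 6)"
        by (simp add: power2_eq_square eval_nat_numeral)
      thus ?thesis by (simp add: e_def)
    qed
    finally have "((\<Sum>w\<in>rising n. size_error n w) / (4 ^ n * real n ^ 3))\<^sup>2 \<le> e n"
      by (simp only: power_divide)
    thus ?thesis by (intro real_le_rsqrt) (simp only: real_norm_def power2_abs)
  qed
  have "(\<lambda>n. (\<Sum>w\<in>rising n. size_error n w) / (4 ^ n * real n ^ 3)) \<longlonglongrightarrow> 0"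
    by (rule Lim_null_comparison[OF always_eventually[OF allI[OF bound]] null])
  from tendsto_add[OF model_size_limit this] show ?thesis
    by (simp add: size_error_def sum_subtractf add_divide_distrib[symmetric])
qed

lemma size_square_limit:
  "(\<lambda>n. (\<Sum>w\<in>rising n. (real (size_of (core_of n w)))\<^sup>2) / (4 ^ n * real n ^ 6)) \<longlonglongrightarrow> 1217/7680"
proof -
  define e where "e n = (\<Sum>w\<in>rising n. (size_error n w)\<^sup>2) / (4 ^ n * real n ^ 6)" for n
  define y where "y n = (\<Sum>w\<in>rising n. (model_size n w)\<^sup>2) / (4 ^ n * real n ^ 6)" for n
  define m where "m n = (\<Sum>w\<in>rising n. model_size n w * size_error n w) / (4 ^ n * real n ^ 6)" for n
  have lim: "e \<longlonglongrightarrow> 0" "y \<longlonglongrightarrow> 1217/7680"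
    unfolding e_def[abs_def] y_def[abs_def] by (rule size_error_limit model_size_square_limit)+
  have "(\<lambda>n. sqrt (y n * e n)) \<longlonglongrightarrow> sqrt (1217/7680 * 0)"
    by (intro tendsto_intros lim)
  hence null: "(\<lambda>n. sqrt (y n * e n)) \<longlonglongrightarrow> 0" by simp
  have bound: "norm (m n) \<le> sqrt (y n * e n)" for n
  proof -
    have "(m n)\<^sup>2 \<le> y n * e n"
      using divide_right_mono[OF Cauchy_Schwarz_ineq_sum[of "model_size n" "size_error n" "rising n"], of "(4 ^ n * real n ^ 6)\<^sup>2"]
      by (simp add: m_def y_def e_def power_divide power2_eq_square)
    thus ?thesis by (intro real_le_rsqrt) (simp only: real_norm_def power2_abs)
  qed
  have "m \<longlonglongrightarrow> 0"
    by (rule Lim_null_comparison[OF always_eventually[OF allI[OF bound]] null])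
  hence "(\<lambda>n. y n + 2 * m n + e n) \<longlonglongrightarrow> 1217/7680 + 2 * 0 + 0"
    by (intro tendsto_intros lim)
  moreover have "(\<Sum>w\<in>rising n. (real (size_of (core_of n w)))\<^sup>2) / (4 ^ n * real n ^ 6) = y n
      + 2 * m n + e n" for n
  proof -
    have "(real (size_of (core_of n w)))\<^sup>2 = (model_size n w)\<^sup>2
        + 2 * (model_size n w * size_error n w) + (size_error n w)\<^sup>2" for w
      by (simp add: size_error_def power2_eq_square algebra_simps)
    thus ?thesis
      by (simp add: y_def m_def e_def sum.distrib sum_distrib_left[symmetric] add_divide_distrib)
  qed
  ultimately show ?thesis by simp
qed

theorem mainTheorem9:
  fixes P :: "nat \<Rightarrow> nat list pmf" and X :: "nat \<Rightarrow> nat list \<Rightarrow> real"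
  defines "P \<equiv> (\<lambda>n. pmf_of_set (distinct_cores (2 * n + 1) (2 * n + 3)))"
    and "X \<equiv> (\<lambda>n xs. real (size_of xs))"
  shows "(\<lambda>n. coeff_of_variation (P n) (X n)) \<longlonglongrightarrow> sqrt 14010 / 150
    \<and> sqrt 14010 / 150 \<noteq> (0 :: real)
    \<and> \<not> concentrated_about_mean P X"
proof -
  define a where "a n = (\<Sum>w\<in>rising n. real (size_of (core_of n w))) / (4 ^ n * real n ^ 3)" for n
  define b where "b n = (\<Sum>w\<in>rising n. (real (size_of (core_of n w)))\<^sup>2) / (4 ^ n * real n ^ 6)" for n
  have lim: "a \<longlonglongrightarrow> 5/16" "b \<longlonglongrightarrow> 1217/7680"
    unfolding a_def[abs_def] b_def[abs_def] by (rule size_limit size_square_limit)+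
  have cv: "sqrt (b n - (a n)\<^sup>2) / a n = coeff_of_variation (P n) (X n)" if n: "n > 0" for n
  proof -
    define S where "S = distinct_cores (2 * n + 1) (2 * n + 3)"
    have bij: "bij_betw (core_of n) (rising n) S"
      unfolding S_def by (rule core_of_bij[OF n])
    have card: "card S = 4 ^ n" using bij_betw_same_card[OF bij] by (simp add: card_rising)
    have fin: "finite S" using bij_betw_finite[OF bij] by simp
    have ne: "S \<noteq> {}" using card by auto
    have E: "measure_pmf.expectation (pmf_of_set S) f = (\<Sum>w\<in>rising n. f (core_of n w)) / 4 ^ n" for f :: "nat list \<Rightarrow> real"
      using integral_pmf_of_set[OF ne fin, of f] sum.reindex_bij_betw[OF bij, of f] card by simp
    have P: "P n = pmf_of_set S" by (simp add: P_def S_def)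
    have int: "integrable (measure_pmf (pmf_of_set S)) f" for f :: "nat list \<Rightarrow> real"
      using fin ne by (intro integrable_measure_pmf_finite) simp
    have mean: "measure_pmf.expectation (P n) (X n) = a n * real n ^ 3"
      using n by (simp add: P E X_def a_def)
    have "measure_pmf.variance (P n) (X n) =
        measure_pmf.expectation (P n) (\<lambda>xs. (X n xs)\<^sup>2) - (measure_pmf.expectation (P n) (X n))\<^sup>2"
      unfolding P by (intro measure_pmf.variance_eq int)
    also have "\<dots> = b n * real n ^ 6 - (a n * real n ^ 3)\<^sup>2"
      unfolding mean using n by (simp add: P E X_def b_def)
    also have "\<dots> = (b n - (a n)\<^sup>2) * (real n ^ 3)\<^sup>2"
      by (simp add: power_mult_distrib algebra_simps power_mult[symmetric])
    finally have var: "measure_pmf.variance (P n) (X n) = (b n - (a n)\<^sup>2) * (real n ^ 3)\<^sup>2" .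
    have "coeff_of_variation (P n) (X n) = (sqrt (b n - (a n)\<^sup>2) * \<bar>real n ^ 3\<bar>) / (a n * real n ^ 3)"
      unfolding coeff_of_variation_def var by (simp only: mean real_sqrt_mult real_sqrt_abs)
    thus ?thesis using n by simp
  qed
  have "(\<lambda>n. sqrt (b n - (a n)\<^sup>2) / a n) \<longlonglongrightarrow> sqrt (1217/7680 - (5/16)\<^sup>2) / (5/16)"
    by (intro tendsto_intros lim) simp
  also have "sqrt (1217/7680 - (5/16)\<^sup>2) / (5/16) = sqrt 14010 / 150"
  proof -
    have "sqrt (1217/7680 - (5/16)\<^sup>2) / (5/16) = sqrt ((1217/7680 - (5/16)\<^sup>2) / (5/16)\<^sup>2)"
      by (simp only: real_sqrt_divide real_sqrt_abs abs_divide abs_numeral)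
    also have "(1217/7680 - (5/16)\<^sup>2) / (5/16)\<^sup>2 = (14010 / 150\<^sup>2 :: real)"
      by (simp add: power2_eq_square)
    also have "sqrt (14010 / 150\<^sup>2) = sqrt 14010 / 150"
      by (simp only: real_sqrt_divide real_sqrt_abs abs_numeral)
    finally show ?thesis .
  qed
  finally have "(\<lambda>n. sqrt (b n - (a n)\<^sup>2) / a n) \<longlonglongrightarrow> sqrt 14010 / 150" .
  moreover have "eventually (\<lambda>n. sqrt (b n - (a n)\<^sup>2) / a n = coeff_of_variation (P n) (X n)) at_top"
    using eventually_gt_at_top[of 0] cv by (rule eventually_mono)
  ultimately have main: "(\<lambda>n. coeff_of_variation (P n) (X n)) \<longlonglongrightarrow> sqrt 14010 / 150"
    by (rule Lim_transform_eventually)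
  moreover have nz: "sqrt 14010 / 150 \<noteq> (0 :: real)" by simp
  moreover have "\<not> concentrated_about_mean P X"
    unfolding concentrated_about_mean_def using LIMSEQ_unique[OF main] nz by blast
  ultimately show ?thesis by blast
qed

end
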